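(* Let $X=\mathbb{P}(q_0,q_1,\dots,q_n)$ be a weighted projective space, where $q_0,\dots,q_n$ are positive integers with $\gcd(q_0,\dots,\hat q_i,\dots,q_n)=1$ for every $i$ (the hat meaning omission), and let $\ell=\mathrm{lcm}(q_0,\dots,q_n)$. Let $\alpha_0$ be the generator of $\mathrm{Cl}(X)\simeq\mathbb{Z}$ of degree $1$. Fix $d_1,\dots,d_n\in\mathbb{N}$ and consider $f_1,\dots,f_n\in S$ with $f_i\in S_{\ell d_i\alpha_0}$, and let $I=\langle f_1,\dots,f_n\rangle$. Let $d_{reg}$ be an integer with $d_{reg}>\ell\left(\sum_{i=1}^nd_i\right)-\sum_{j=0}^nq_j$ such that $d_{reg}\,\alpha_0$ is $V_X(I)$-basepoint free. If $V_X(I)$ is a complete intersection (that is, zero-dimensional), then for any $V_X(I)$-basepoint free $d_0\,\alpha_0\in\mathrm{Cl}(X)_+$ with $d_0>0$, the pair $(d_{reg}\,\alpha_0,\ d_0\,\alpha_0)$ is a regularity pair for $I$.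
   Context: The Cox ring of $X=\mathbb{P}(q_0,\dots,q_n)$ is $S=\mathbb{C}[x_0,\dots,x_n]$ graded by $\mathrm{Cl}(X)\simeq\mathbb{Z}$ via $\deg x_i=q_i\alpha_0$, with irrelevant ideal $B=\langle x_0,\dots,x_n\rangle$; $\mathrm{Pic}(X)$ is generated by $\ell\alpha_0$, and $\alpha_0$ is a nef $\mathbb{Q}$-Cartier class. $\mathrm{Cl}(X)_+$ is the set of classes of effective torus-invariant divisors. A homogeneous ideal $I\subset S$ defines a closed subscheme $V_X(I)\subset X$, with reduced variety $\mathrm{Var}_X(I)$. $V_X(I)$ is a complete intersection if $I$ can be generated by $\mathrm{codim}_XV_X(I)$ homogeneous elements. A degree $\alpha\in\mathrm{Cl}(X)$ is $V_X(I)$-basepoint free if for no point $\zeta\in\mathrm{Var}_X(I)$ do all $f\in S_\alpha$ vanish at $\zeta$ (for $V_X(I)$ zero-dimensional, equivalently some $h\in S_\alpha$ vanishes at no point of $\mathrm{Var}_X(I)$). For $V_X(I)$ zero-dimensional of degree $\delta^+$ (number of points counted with multiplicity), $\mathrm{Reg}(I)=\{\alpha\in\mathrm{Cl}(X)\mid\dim_{\mathbb C}(S/I)_\alpha=\delta^+,\ I_\alpha=(I:B^\infty)_\alpha,\ \alpha\text{ is }V_X(I)\text{-basepoint free}\}$. A pair $(\alpha,\beta)\in\mathrm{Cl}(X)^2$ is a regularity pair if $\alpha,\alpha+\beta\in\mathrm{Reg}(I)$ and $\beta$ is $V_X(I)$-basepoint free. *)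

theory Defs
  imports
    "HOL-Library.Poly_Mapping"
    "HOL-Library.Extended_Nat"
    "HOL-Library.Extended_Real"
    "HOL-Library.FuncSet"
    "HOL-Computational_Algebra.Fraction_Field"
    "HOL-Algebra.Ideal_Product"
begin

text \<open>
  Conventions for \<open>X = P(q\<^sub>0,\<dots>,q\<^sub>n)\<close>: the weights are a function \<open>q :: nat \<Rightarrow> nat\<close> of which only the
  values at \<open>0,\<dots>,n\<close> matter, and \<open>Cl(X)\<close> is identified with \<open>int\<close> through its generator
  \<open>\<alpha>\<^sub>0 = 1\<close>, so that the class \<open>d \<alpha>\<^sub>0\<close> is the integer \<open>d\<close>.
\<close>


section \<open>The Cox ring\<close>

text \<open>Complex polynomials in variables indexed by \<open>nat\<close>: an exponent vector is an element of
  \<open>nat \<Rightarrow>\<^sub>0 nat\<close>. The Cox ring is the subring of the polynomials in \<open>x\<^sub>0,\<dots>,x\<^sub>n\<close>.\<close>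

type_synonym poly_cox = "(nat \<Rightarrow>\<^sub>0 nat) \<Rightarrow>\<^sub>0 complex"

definition cox_ring :: "nat \<Rightarrow> poly_cox ring" where
  "cox_ring n = \<lparr> carrier = {f. \<forall>m\<in>Poly_Mapping.keys f. Poly_Mapping.keys m \<subseteq> {..n}},
                  monoid.mult = (*), one = 1, ring.zero = 0, add = (+) \<rparr>"

definition const :: "complex \<Rightarrow> poly_cox" where
  "const c = Poly_Mapping.single 0 c"

definition var :: "nat \<Rightarrow> poly_cox" where
  "var i = Poly_Mapping.single (Poly_Mapping.single i 1) 1"

definition peval :: "(nat \<Rightarrow> complex) \<Rightarrow> poly_cox \<Rightarrow> complex" where
  "peval z f = (\<Sum>m\<in>Poly_Mapping.keys f.
     Poly_Mapping.lookup f m * (\<Prod>i\<in>Poly_Mapping.keys m. z i ^ Poly_Mapping.lookup m i))"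

definition wdegree :: "(nat \<Rightarrow> nat) \<Rightarrow> (nat \<Rightarrow>\<^sub>0 nat) \<Rightarrow> nat" where
  "wdegree q m = (\<Sum>i\<in>Poly_Mapping.keys m. q i * Poly_Mapping.lookup m i)"

definition graded_piece :: "nat \<Rightarrow> (nat \<Rightarrow> nat) \<Rightarrow> int \<Rightarrow> poly_cox set" where
  "graded_piece n q \<alpha> = {f \<in> carrier (cox_ring n).
     \<forall>m\<in>Poly_Mapping.keys f. int (wdegree q m) = \<alpha>}"

definition homogeneous :: "nat \<Rightarrow> (nat \<Rightarrow> nat) \<Rightarrow> poly_cox \<Rightarrow> bool" where
  "homogeneous n q f \<longleftrightarrow> (\<exists>\<alpha>. f \<in> graded_piece n q \<alpha>)"

definition homogeneous_ideal :: "nat \<Rightarrow> (nat \<Rightarrow> nat) \<Rightarrow> poly_cox set \<Rightarrow> bool" where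
  "homogeneous_ideal n q I \<longleftrightarrow>
     (\<exists>G. (\<forall>g\<in>G. homogeneous n q g) \<and> I = Idl\<^bsub>cox_ring n\<^esub> G)"

definition irrelevant_ideal :: "nat \<Rightarrow> poly_cox set" where
  "irrelevant_ideal n = Idl\<^bsub>cox_ring n\<^esub> (var ` {..n})"

text \<open>\<open>(I : B\<^sup>\<infinity>)\<close>; the power of \<open>B\<close> is taken in the multiplicative monoid of ideals, whose unit is
  the whole ring.\<close>

definition saturation :: "nat \<Rightarrow> poly_cox set \<Rightarrow> poly_cox set" where
  "saturation n I = {f \<in> carrier (cox_ring n).
     \<exists>k::nat. \<forall>b \<in> irrelevant_ideal n [^]\<^bsub>ideals_set (cox_ring n)\<^esub> k. b * f \<in> I}"

text \<open>The torus-invariant prime divisors are the \<open>x\<^sub>i = 0\<close>, of class \<open>q\<^sub>i \<alpha>\<^sub>0\<close>.\<close>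

definition effective_classes :: "nat \<Rightarrow> (nat \<Rightarrow> nat) \<Rightarrow> int set" where
  "effective_classes n q = {\<Sum>i\<le>n. int (a i) * int (q i) | a :: nat \<Rightarrow> nat. True}"


section \<open>Points and closed subsets of the weighted projective space\<close>

text \<open>The points are the orbits of the action of the nonzero complex numbers with weights \<open>q\<close> on
  the punctured affine space, whose elements are extended by \<open>0\<close> beyond the index \<open>n\<close>.\<close>

definition punctured_space :: "nat \<Rightarrow> (nat \<Rightarrow> complex) set" where
  "punctured_space n = {z. (\<forall>i>n. z i = 0) \<and> (\<exists>i\<le>n. z i \<noteq> 0)}"

definition orbit_rel :: "nat \<Rightarrow> (nat \<Rightarrow> nat) \<Rightarrow> ((nat \<Rightarrow> complex) \<times> (nat \<Rightarrow> complex)) set" where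
  "orbit_rel n q = {(z, w). z \<in> punctured_space n \<and> w \<in> punctured_space n \<and>
     (\<exists>t. t \<noteq> 0 \<and> (\<forall>i\<le>n. w i = t ^ q i * z i))}"

definition wproj :: "nat \<Rightarrow> (nat \<Rightarrow> nat) \<Rightarrow> (nat \<Rightarrow> complex) set set" where
  "wproj n q = punctured_space n // orbit_rel n q"

definition vanishes_at :: "poly_cox \<Rightarrow> (nat \<Rightarrow> complex) set \<Rightarrow> bool" where
  "vanishes_at f \<zeta> \<longleftrightarrow> (\<forall>z\<in>\<zeta>. peval z f = 0)"

definition Var :: "nat \<Rightarrow> (nat \<Rightarrow> nat) \<Rightarrow> poly_cox set \<Rightarrow> (nat \<Rightarrow> complex) set set" where
  "Var n q I = {\<zeta> \<in> wproj n q. \<forall>f\<in>I. vanishes_at f \<zeta>}"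

definition zariski_closed :: "nat \<Rightarrow> (nat \<Rightarrow> nat) \<Rightarrow> (nat \<Rightarrow> complex) set set \<Rightarrow> bool" where
  "zariski_closed n q Z \<longleftrightarrow> (\<exists>J. homogeneous_ideal n q J \<and> Z = Var n q J)"

definition irreducible_closed :: "nat \<Rightarrow> (nat \<Rightarrow> nat) \<Rightarrow> (nat \<Rightarrow> complex) set set \<Rightarrow> bool" where
  "irreducible_closed n q Z \<longleftrightarrow> zariski_closed n q Z \<and> Z \<noteq> {} \<and>
     (\<forall>Z1 Z2. zariski_closed n q Z1 \<longrightarrow> zariski_closed n q Z2 \<longrightarrow> Z = Z1 \<union> Z2 \<longrightarrow>
        Z = Z1 \<or> Z = Z2)"

text \<open>Krull dimension of a closed subset; the empty set has dimension \<open>-\<infinity>\<close>.\<close>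

definition zariski_dim :: "nat \<Rightarrow> (nat \<Rightarrow> nat) \<Rightarrow> (nat \<Rightarrow> complex) set set \<Rightarrow> ereal" where
  "zariski_dim n q Z = Sup {ereal (real k) | k. \<exists>C :: nat \<Rightarrow> (nat \<Rightarrow> complex) set set.
     (\<forall>i\<le>k. irreducible_closed n q (C i) \<and> C i \<subseteq> Z) \<and> (\<forall>i<k. C i \<subset> C (Suc i))}"

definition zero_dimensional :: "nat \<Rightarrow> (nat \<Rightarrow> nat) \<Rightarrow> poly_cox set \<Rightarrow> bool" where
  "zero_dimensional n q I \<longleftrightarrow> zariski_dim n q (Var n q I) = 0"

text \<open>The codimension in the \<open>n\<close>-dimensional irreducible variety \<open>X\<close>.\<close>

definition zariski_codim :: "nat \<Rightarrow> (nat \<Rightarrow> nat) \<Rightarrow> (nat \<Rightarrow> complex) set set \<Rightarrow> ereal" where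
  "zariski_codim n q Z = ereal (real n) - zariski_dim n q Z"

definition complete_intersection :: "nat \<Rightarrow> (nat \<Rightarrow> nat) \<Rightarrow> poly_cox set \<Rightarrow> bool" where
  "complete_intersection n q I \<longleftrightarrow>
     (\<exists>(c::nat) (g :: nat \<Rightarrow> poly_cox). ereal (real c) = zariski_codim n q (Var n q I) \<and>
        (\<forall>i\<in>{1..c}. homogeneous n q (g i)) \<and> I = Idl\<^bsub>cox_ring n\<^esub> (g ` {1..c}))"

definition basepoint_free :: "nat \<Rightarrow> (nat \<Rightarrow> nat) \<Rightarrow> poly_cox set \<Rightarrow> int \<Rightarrow> bool" where
  "basepoint_free n q I \<alpha> \<longleftrightarrow>
     \<not> (\<exists>\<zeta>\<in>Var n q I. \<forall>f\<in>graded_piece n q \<alpha>. vanishes_at f \<zeta>)"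


section \<open>Degree of a zero-dimensional subscheme\<close>

text \<open>Dimension of the complex vector space \<open>V/W\<close>, for subspaces \<open>W \<subseteq> V\<close> of a complex algebra with
  structure map \<open>\<iota>\<close>: the size of a finite \<open>B \<subseteq> V\<close> whose classes form a basis of \<open>V/W\<close>, and \<open>\<infinity>\<close> if
  there is none. All such \<open>B\<close> have the same size; the infimum only selects it.\<close>

definition quotient_basis :: "(complex \<Rightarrow> 'a::comm_ring_1) \<Rightarrow> 'a set \<Rightarrow> 'a set \<Rightarrow> 'a set \<Rightarrow> bool" where
  "quotient_basis \<iota> V W B \<longleftrightarrow> finite B \<and> B \<subseteq> V \<and>
     (\<forall>v\<in>V. \<exists>!c. c \<in> B \<rightarrow>\<^sub>E UNIV \<and> v - (\<Sum>b\<in>B. \<iota> (c b) * b) \<in> W)"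

definition quotient_dim :: "(complex \<Rightarrow> 'a::comm_ring_1) \<Rightarrow> 'a set \<Rightarrow> 'a set \<Rightarrow> enat" where
  "quotient_dim \<iota> V W = (INF B\<in>{B. quotient_basis \<iota> V W B}. enat (card B))"

text \<open>The local ring of \<open>X\<close> at \<open>\<zeta>\<close>, inside the fraction field of the polynomial ring, and the stalk
  at \<open>\<zeta>\<close> of the ideal sheaf of \<open>V\<^sub>X(I)\<close>. On the chart \<open>x\<^sub>i \<noteq> 0\<close>, which is the spectrum of the
  degree-\<open>0\<close> part of \<open>S\<close> localized at \<open>x\<^sub>i\<close>, this subscheme is cut out by the degree-\<open>0\<close> part of the
  localization of \<open>I\<close>; localizing further at \<open>\<zeta>\<close> gives the fractions below.\<close>

definition local_ring :: "nat \<Rightarrow> (nat \<Rightarrow> nat) \<Rightarrow> (nat \<Rightarrow> complex) set \<Rightarrow> poly_cox fract set" where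
  "local_ring n q \<zeta> = {Fraction_Field.Fract g h | g h \<alpha>.
     g \<in> graded_piece n q \<alpha> \<and> h \<in> graded_piece n q \<alpha> \<and> \<not> vanishes_at h \<zeta>}"

definition local_ideal ::
  "nat \<Rightarrow> (nat \<Rightarrow> nat) \<Rightarrow> poly_cox set \<Rightarrow> (nat \<Rightarrow> complex) set \<Rightarrow> poly_cox fract set" where
  "local_ideal n q I \<zeta> = {Fraction_Field.Fract g h | g h \<alpha>.
     g \<in> I \<inter> graded_piece n q \<alpha> \<and> h \<in> graded_piece n q \<alpha> \<and> \<not> vanishes_at h \<zeta>}"

definition point_multiplicity ::
  "nat \<Rightarrow> (nat \<Rightarrow> nat) \<Rightarrow> poly_cox set \<Rightarrow> (nat \<Rightarrow> complex) set \<Rightarrow> enat" where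
  "point_multiplicity n q I \<zeta> =
     quotient_dim (\<lambda>c. Fraction_Field.Fract (const c) 1) (local_ring n q \<zeta>) (local_ideal n q I \<zeta>)"

text \<open>\<open>\<delta>\<^sup>+\<close>, meaningful when \<open>V\<^sub>X(I)\<close> is zero-dimensional, so that \<open>Var\<^sub>X(I)\<close> is finite.\<close>

definition scheme_degree :: "nat \<Rightarrow> (nat \<Rightarrow> nat) \<Rightarrow> poly_cox set \<Rightarrow> enat" where
  "scheme_degree n q I = (\<Sum>\<zeta>\<in>Var n q I. point_multiplicity n q I \<zeta>)"


section \<open>Regularity\<close>

definition Reg :: "nat \<Rightarrow> (nat \<Rightarrow> nat) \<Rightarrow> poly_cox set \<Rightarrow> int set" where
  "Reg n q I = {\<alpha>.
     quotient_dim const (graded_piece n q \<alpha>) (I \<inter> graded_piece n q \<alpha>) = scheme_degree n q I \<and>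
     I \<inter> graded_piece n q \<alpha> = saturation n I \<inter> graded_piece n q \<alpha> \<and>
     basepoint_free n q I \<alpha>}"

definition regularity_pair :: "nat \<Rightarrow> (nat \<Rightarrow> nat) \<Rightarrow> poly_cox set \<Rightarrow> int \<times> int \<Rightarrow> bool" where
  "regularity_pair n q I p \<longleftrightarrow> (case p of (\<alpha>, \<beta>) \<Rightarrow>
     \<alpha> \<in> Reg n q I \<and> \<alpha> + \<beta> \<in> Reg n q I \<and> basepoint_free n q I \<beta>)"


section \<open>Basic facts\<close>

lemma cox_ring_cring: "cring (cox_ring n)"
proof -
  let ?C = "carrier (cox_ring n)"
  have mem: "f \<in> ?C \<longleftrightarrow> (\<forall>m\<in>Poly_Mapping.keys f. Poly_Mapping.keys m \<subseteq> {..n})" for f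
    by (simp add: cox_ring_def)
  have times: "f * g \<in> ?C" if fg: "f \<in> ?C" "g \<in> ?C" for f g
    unfolding mem
  proof
    fix m assume "m \<in> Poly_Mapping.keys (f * g)"
    then obtain a b where m: "m = a + b" "a \<in> Poly_Mapping.keys f" "b \<in> Poly_Mapping.keys g"
      using Poly_Mapping.keys_mult[of f g] by blast
    then have "Poly_Mapping.keys a \<subseteq> {..n}" "Poly_Mapping.keys b \<subseteq> {..n}"
      using fg unfolding mem by blast+
    then show "Poly_Mapping.keys m \<subseteq> {..n}"
      using Poly_Mapping.keys_add[of a b] unfolding m(1) by blast
  qed
  have plus: "f + g \<in> ?C" if "f \<in> ?C" "g \<in> ?C" for f g
    using that Poly_Mapping.keys_add[of f g] unfolding mem by blast
  have uminus: "- f \<in> ?C" if "f \<in> ?C" for f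
    using that unfolding mem by simp
  have zero: "0 \<in> ?C" and one: "1 \<in> ?C"
    unfolding mem by simp_all
  have ops [simp]: "mult (cox_ring n) = (*)" "add (cox_ring n) = (+)"
    "one (cox_ring n) = 1" "zero (cox_ring n) = 0"
    by (simp_all add: cox_ring_def)
  show ?thesis
  proof (rule cringI)
    show "abelian_group (cox_ring n)"
    proof (rule abelian_groupI)
      fix f assume "f \<in> ?C"
      then show "\<exists>g\<in>?C. g \<oplus>\<^bsub>cox_ring n\<^esub> f = \<zero>\<^bsub>cox_ring n\<^esub>"
        by (intro bexI[of _ "- f"] uminus) simp_all
    qed (simp_all add: plus zero add.assoc add.commute)
    show "comm_monoid (cox_ring n)"
      by (rule comm_monoidI) (simp_all add: times one mult.assoc mult.commute)
  qed (simp add: distrib_right)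
qed

text \<open>For an ideal with \<open>n\<close> homogeneous generators, being zero-dimensional already makes it a
  complete intersection.\<close>

lemma zero_dimensional_imp_complete_intersection:
  assumes "\<And>i. i \<in> {1..n} \<Longrightarrow> homogeneous n q (f i)"
    and "zero_dimensional n q (Idl\<^bsub>cox_ring n\<^esub> (f ` {1..n}))"
  shows "complete_intersection n q (Idl\<^bsub>cox_ring n\<^esub> (f ` {1..n}))"
  unfolding complete_intersection_def
  by (rule exI[of _ n], rule exI[of _ f])
     (use assms in \<open>auto simp: zero_dimensional_def zariski_codim_def\<close>)

end

theory Submission
  imports Defs "HOL-Analysis.Continuum_Not_Denumerable"
    "HOL-Computational_Algebra.Fundamental_Theorem_Algebra"
begin

text \<open>
  Since \<open>Var\<^sub>X(I)\<close> is finite, some form \<open>h\<close> of positive degree divisible by \<open>\<ell>\<close> vanishes at none of its points.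
  By the Nullstellensatz \<open>f\<^sub>1,\<dots>,f\<^sub>n,h\<close> generate an ideal containing powers of all variables, and as
  these powers form a regular sequence, the Koszul complex of \<open>f\<^sub>1,\<dots>,f\<^sub>n,h\<close> is exact in degree one:
  if \<open>a\<close> is regular on a module \<open>M\<close> and lies in the ideal, it annihilates the Koszul homology, so that
  \<open>H\<^sub>p(M)\<close> is a quotient of \<open>H\<^sub>p\<^sub>+\<^sub>1(M/aM)\<close>, and after \<open>n+1\<close> such steps the homology of \<open>n+1\<close>
  elements has run out of degrees. So \<open>h\<close> is a nonzerodivisor modulo \<open>I\<close>, and \<open>I\<close> is saturated.
  Moreover the Hilbert function of \<open>S/(f\<^sub>1,\<dots>,f\<^sub>n,h)\<close> only depends on the degrees, and can be computed
  for powers of the variables because all degrees are divisible by all weights: it vanishes above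
  \<open>\<ell> \<Sum> d\<^sub>i + deg h - \<Sum> q\<^sub>j\<close>. So multiplication by \<open>h\<close> is bijective from \<open>(S/I)\<^sub>\<alpha>\<close> to \<open>(S/I)\<close> in degree
  \<open>\<alpha> + deg h\<close> when \<open>\<alpha>\<close> exceeds the bound, and dividing by a form of degree \<open>\<alpha>\<close> without zeros on
  \<open>Var\<^sub>X(I)\<close> identifies \<open>(S/I)\<^sub>\<alpha>\<close> with the product of the local rings of \<open>V\<^sub>X(I)\<close>.
\<close>

section \<open>Finite quotients of complex vector spaces\<close>

text \<open>Two kinds of forms without zeros on the points are needed. A form \<open>k\<close> of
  degree \<alpha> trivializes the class \<alpha> at every point, and basepoint freeness provides it.
  The common denominator of given local fractions, by which one has to divide modulo the ideal, must
  moreover have degree divisible by every weight, since the Hilbert function is compared with that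
  of powers of variables. So fractions are expanded by powers of \<open>h\<close> and of their
  denominators until the degree is a multiple of deg h. The bound does not depend on the
  denominator: adjoining a form of degree b to the generators raises the bound by b, exactly as
  multiplying by it raises the degree. The bound for n + 1 forms of degrees D_i is the largest
  degree of a monomial with exponents m_i <= D_i / q_i - 1. Krull dimension, defined by chains of
  irreducible closed sets, yields finiteness only if irreducible sets can be produced. The prime
  ideals for this come from Zorn's lemma, by the same construction as in the Nullstellensatz, where
  a cardinality argument replaces Noether normalization.\<close>

text \<open>Gaussian elimination, one equation \<open>k\<close> at a time: a pivot \<open>u0\<close>
  clears the \<open>k\<close>-th entries of the other vectors and is removed; its coefficient is
  recovered afterwards. It serves the dimension counts and the linear relation in the
  Nullstellensatz.\<close>

lemma homogeneous_system_nontrivial: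
  fixes v :: "'u \<Rightarrow> 'k \<Rightarrow> 'f::field"
  assumes "finite K" "finite U" "card K < card U"
  shows "\<exists>c. (\<exists>u\<in>U. c u \<noteq> 0) \<and> (\<forall>k\<in>K. (\<Sum>u\<in>U. c u * v u k) = 0)"
  using assms
proof (induction K arbitrary: U v rule: finite_induct)
  case empty
  then have "U \<noteq> {}" by auto
  then show ?case by (intro exI[of _ "\<lambda>_. 1"]) auto
next
  case (insert k K)
  show ?case
  proof (cases "\<forall>u\<in>U. v u k = 0")
    case True
    have "card K < card U" using insert by auto
    from insert.IH[OF insert.prems(1) this, of v] True show ?thesis by auto
  next
    case False
    then obtain u0 where u0: "u0 \<in> U" "v u0 k \<noteq> 0" by blast
    let ?U = "U - {u0}"
    have "card K < card ?U" using insert u0 by auto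
    with insert.IH[of ?U "\<lambda>u j. v u j - v u k / v u0 k * v u0 j"] insert.prems(1)
    obtain c where c: "\<exists>u\<in>?U. c u \<noteq> 0"
      "\<And>j. j \<in> K \<Longrightarrow> (\<Sum>u\<in>?U. c u * (v u j - v u k / v u0 k * v u0 j)) = 0" by auto
    define s where "s = (\<Sum>u\<in>?U. c u * v u k) / v u0 k"
    let ?c = "\<lambda>u. if u = u0 then - s else c u"
    have split: "(\<Sum>u\<in>U. ?c u * v u j) = (\<Sum>u\<in>?U. c u * v u j) - s * v u0 j" for j
    proof -
      have "(\<Sum>u\<in>U. ?c u * v u j) = - s * v u0 j + (\<Sum>u\<in>?U. ?c u * v u j)"
        using insert.prems(1) u0(1) by (subst sum.remove[of _ u0]) auto
      also have "(\<Sum>u\<in>?U. ?c u * v u j) = (\<Sum>u\<in>?U. c u * v u j)"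
        by (intro sum.cong) auto
      finally show ?thesis by simp
    qed
    have "(\<Sum>u\<in>U. ?c u * v u k) = 0"
      unfolding split using u0(2) by (simp add: s_def)
    moreover have "(\<Sum>u\<in>U. ?c u * v u j) = 0" if "j \<in> K" for j
    proof -
      have "0 = (\<Sum>u\<in>?U. c u * v u j - c u * v u k / v u0 k * v u0 j)"
        using c(2)[OF that] by (simp add: algebra_simps)
      also have "\<dots> = (\<Sum>u\<in>?U. c u * v u j) - s * v u0 j"
        by (simp add: sum_subtractf s_def sum_divide_distrib sum_distrib_right)
      finally show ?thesis unfolding split by simp
    qed
    moreover have "\<exists>u\<in>U. ?c u \<noteq> 0" using c(1) by auto
    ultimately show ?thesis by (intro exI[of _ ?c]) blast
  qed
qed

text \<open>Instantiated for the polynomials and for their fraction field, the two places where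
  \<open>quotient_dim\<close> is taken.\<close>

locale complex_algebra =
  fixes \<iota> :: "complex \<Rightarrow> 'a::comm_ring_1"
  assumes iota_add: "\<iota> (a + b) = \<iota> a + \<iota> b"
    and iota_mult: "\<iota> (a * b) = \<iota> a * \<iota> b"
    and iota_one: "\<iota> 1 = 1"
begin

sublocale vector_space "\<lambda>c x. \<iota> c * x"
  by unfold_locales (simp_all add: iota_add iota_mult iota_one algebra_simps)

lemma iota_zero: "\<iota> 0 = 0"
  using scale_zero_left[of 1] by simp

lemma iota_diff: "\<iota> (a - b) = \<iota> a - \<iota> b"
  using scale_left_diff_distrib[of a b 1] by simp

lemma iota_sum: "\<iota> (sum g A) = (\<Sum>x\<in>A. \<iota> (g x))"
  using scale_sum_left[of g A 1] by simp

lemma subspace_lincomb: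
  "subspace W \<Longrightarrow> (\<And>x. x \<in> A \<Longrightarrow> g x \<in> W) \<Longrightarrow> (\<Sum>x\<in>A. \<iota> (c x) * g x) \<in> W"
  by (intro subspace_sum subspace_scale)

text \<open>Uniqueness at the vector 0 gives independence modulo \<open>W\<close>, because any
  relation competes with the zero coefficients; conversely, the difference of two coefficient
  families of one vector is a relation.\<close>

lemma quotient_basis_iff:
  assumes V: "subspace V" and W: "subspace W"
  shows "quotient_basis \<iota> V W B \<longleftrightarrow> finite B \<and> B \<subseteq> V \<and>
    (\<forall>v\<in>V. \<exists>c. v - (\<Sum>b\<in>B. \<iota> (c b) * b) \<in> W) \<and>
    (\<forall>c. (\<Sum>b\<in>B. \<iota> (c b) * b) \<in> W \<longrightarrow> (\<forall>b\<in>B. c b = 0))" (is "?L \<longleftrightarrow> ?R")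
proof
  assume L: ?L
  have "c b = 0" if c: "(\<Sum>b\<in>B. \<iota> (c b) * b) \<in> W" and b: "b \<in> B" for c b
  proof -
    let ?P = "\<lambda>c. c \<in> B \<rightarrow>\<^sub>E UNIV \<and> 0 - (\<Sum>b\<in>B. \<iota> (c b) * b) \<in> W"
    have "\<exists>!c. ?P c" using L subspace_0[OF V] unfolding quotient_basis_def by blast
    then obtain e where e: "\<forall>c. ?P c \<longrightarrow> c = e" by (elim ex1E) (rule that)
    have "?P (restrict c B)" using subspace_neg[OF W c] by simp
    moreover have "?P (restrict (\<lambda>_. 0) B)" using subspace_0[OF W] by (simp add: iota_zero)
    ultimately have "restrict c B = restrict (\<lambda>_. 0) B" using e by metis
    then show ?thesis using b by (metis restrict_apply')
  qed
  with L show ?R unfolding quotient_basis_def by blast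
next
  assume R: ?R
  show ?L unfolding quotient_basis_def
  proof (intro conjI ballI)
    fix v assume "v \<in> V"
    then obtain c where c: "v - (\<Sum>b\<in>B. \<iota> (c b) * b) \<in> W" using R by blast
    show "\<exists>!c. c \<in> B \<rightarrow>\<^sub>E UNIV \<and> v - (\<Sum>b\<in>B. \<iota> (c b) * b) \<in> W"
    proof (rule ex1I[of _ "restrict c B"])
      show "restrict c B \<in> B \<rightarrow>\<^sub>E UNIV \<and> v - (\<Sum>b\<in>B. \<iota> (restrict c B b) * b) \<in> W"
        using c by simp
    next
      fix e assume e: "e \<in> B \<rightarrow>\<^sub>E UNIV \<and> v - (\<Sum>b\<in>B. \<iota> (e b) * b) \<in> W"
      have "(v - (\<Sum>b\<in>B. \<iota> (e b) * b)) - (v - (\<Sum>b\<in>B. \<iota> (c b) * b)) \<in> W"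
        using subspace_diff[OF W] e c by blast
      moreover have "(v - (\<Sum>b\<in>B. \<iota> (e b) * b)) - (v - (\<Sum>b\<in>B. \<iota> (c b) * b))
          = (\<Sum>b\<in>B. \<iota> (c b - e b) * b)"
        by (simp add: scale_left_diff_distrib sum_subtractf)
      ultimately have "\<forall>b\<in>B. c b - e b = 0"
        using R[THEN conjunct2, THEN conjunct2, THEN conjunct2, rule_format, of "\<lambda>b. c b - e b"] by simp
      then show "e = restrict c B" using e by (auto simp: fun_eq_iff PiE_def extensional_def)
    qed
  qed (use R in auto)
qed

text \<open>Expanded in \<open>B'\<close> modulo \<open>W\<close>, the elements of \<open>B\<close>
  would satisfy a nontrivial relation if there were more of them.\<close>

lemma quotient_basis_card_le:
  assumes V: "subspace V" and W: "subspace W"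
    and B: "quotient_basis \<iota> V W B" and B': "quotient_basis \<iota> V W B'"
  shows "card B \<le> card B'"
proof (rule ccontr)
  assume "\<not> ?thesis"
  then have lt: "card B' < card B" by simp
  note B = B[unfolded quotient_basis_iff[OF V W]] and B' = B'[unfolded quotient_basis_iff[OF V W]]
  have "\<forall>b\<in>B. \<exists>c. b - (\<Sum>b'\<in>B'. \<iota> (c b') * b') \<in> W" using B B' by blast
  then obtain v where v: "\<And>b. b \<in> B \<Longrightarrow> b - (\<Sum>b'\<in>B'. \<iota> (v b b') * b') \<in> W" by metis
  obtain c where c: "\<exists>b\<in>B. c b \<noteq> 0" "\<And>b'. b' \<in> B' \<Longrightarrow> (\<Sum>b\<in>B. c b * v b b') = 0"
    using homogeneous_system_nontrivial[of B' B v] B B' lt by blast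
  have "(\<Sum>b\<in>B. \<iota> (c b) * (b - (\<Sum>b'\<in>B'. \<iota> (v b b') * b'))) \<in> W"
    by (rule subspace_lincomb[OF W v])
  also have "(\<Sum>b\<in>B. \<iota> (c b) * (b - (\<Sum>b'\<in>B'. \<iota> (v b b') * b')))
     = (\<Sum>b\<in>B. \<iota> (c b) * b) - (\<Sum>b\<in>B. \<Sum>b'\<in>B'. \<iota> (c b * v b b') * b')"
    by (simp add: right_diff_distrib sum_subtractf sum_distrib_left)
  also have "(\<Sum>b\<in>B. \<Sum>b'\<in>B'. \<iota> (c b * v b b') * b') = (\<Sum>b'\<in>B'. \<iota> (\<Sum>b\<in>B. c b * v b b') * b')"
    by (subst sum.swap) (simp add: iota_sum sum_distrib_right)
  also have "\<dots> = 0" using c(2) by (simp add: iota_zero)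
  finally have "(\<Sum>b\<in>B. \<iota> (c b) * b) \<in> W" by simp
  then show False using B c(1) by blast
qed

lemma quotient_dim_eq_card:
  assumes V: "subspace V" and W: "subspace W" and B: "quotient_basis \<iota> V W B"
  shows "quotient_dim \<iota> V W = enat (card B)"
  unfolding quotient_dim_def
proof (rule antisym)
  show "(INF B\<in>{B. quotient_basis \<iota> V W B}. enat (card B)) \<le> enat (card B)"
    using B by (intro INF_lower) simp
  show "enat (card B) \<le> (INF B\<in>{B. quotient_basis \<iota> V W B}. enat (card B))"
    using quotient_basis_card_le[OF V W B] by (intro INF_greatest) simp
qed

lemma quotient_basis_exists:
  assumes V: "subspace V" and W: "subspace W"
    and "finite A" "A \<subseteq> V" "\<And>v. v \<in> V \<Longrightarrow> \<exists>c. v - (\<Sum>a\<in>A. \<iota> (c a) * a) \<in> W"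
  shows "\<exists>B. quotient_basis \<iota> V W B"
  using assms(3-)
proof (induction A rule: finite_psubset_induct)
  case (psubset A)
  show ?case
  proof (cases "\<forall>c. (\<Sum>a\<in>A. \<iota> (c a) * a) \<in> W \<longrightarrow> (\<forall>a\<in>A. c a = 0)")
    case True
    then have "quotient_basis \<iota> V W A"
      unfolding quotient_basis_iff[OF V W]
      using psubset.hyps psubset.prems by (intro conjI ballI) assumption+
    then show ?thesis ..
  next
    case False
    then obtain c a0 where c: "(\<Sum>a\<in>A. \<iota> (c a) * a) \<in> W" "a0 \<in> A" "c a0 \<noteq> 0" by blast
    let ?A = "A - {a0}"
    have "\<exists>e. v - (\<Sum>a\<in>?A. \<iota> (e a) * a) \<in> W" if v: "v \<in> V" for v
    proof -
      obtain e where e: "v - (\<Sum>a\<in>A. \<iota> (e a) * a) \<in> W" using psubset.prems(2) v by blast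
      \<comment> \<open>This multiple of the relation makes the coefficient of the redundant
        \<open>a0\<close> vanish.\<close>
      let ?r = "e a0 / c a0"
      have "(v - (\<Sum>a\<in>A. \<iota> (e a) * a)) + \<iota> ?r * (\<Sum>a\<in>A. \<iota> (c a) * a) \<in> W"
        by (rule subspace_add[OF W e subspace_scale[OF W c(1)]])
      also have "(v - (\<Sum>a\<in>A. \<iota> (e a) * a)) + \<iota> ?r * (\<Sum>a\<in>A. \<iota> (c a) * a)
          = v - (\<Sum>a\<in>A. \<iota> (e a - ?r * c a) * a)"
        by (simp add: left_diff_distrib iota_diff sum_subtractf sum_distrib_left)
      also have "(\<Sum>a\<in>A. \<iota> (e a - ?r * c a) * a) = (\<Sum>a\<in>?A. \<iota> (e a - ?r * c a) * a)"
        using c psubset.hyps by (subst sum.remove[of _ a0]) (auto simp: iota_zero)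
      finally show ?thesis by (intro exI)
    qed
    then show ?thesis using psubset.IH[of ?A] psubset.prems c(2) by blast
  qed
qed

text \<open>\<open>quotient_basis\<close> speaks of sets, while bases arise as indexed families. If
  two members coincided, the coefficients 1 and -1 would give a relation, so independence forces
  injectivity.\<close>

lemma quotient_basis_image:
  assumes V: "subspace V" and W: "subspace W" and P: "finite P" "\<And>p. p \<in> P \<Longrightarrow> g p \<in> V"
    and span: "\<And>v. v \<in> V \<Longrightarrow> \<exists>c. v - (\<Sum>p\<in>P. \<iota> (c p) * g p) \<in> W"
    and indep: "\<And>c p. (\<Sum>p\<in>P. \<iota> (c p) * g p) \<in> W \<Longrightarrow> p \<in> P \<Longrightarrow> c p = 0"
  shows "\<exists>B. quotient_basis \<iota> V W B \<and> card B = card P"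
proof -
  have inj: "inj_on g P"
  proof (rule inj_onI, rule ccontr)
    fix p p' assume p: "p \<in> P" "p' \<in> P" "g p = g p'" "p \<noteq> p'"
    let ?c = "\<lambda>x. if x = p then 1 else if x = p' then - 1 else (0::complex)"
    have eq: "\<iota> (- 1) = - 1" using iota_diff[of 0 1] by (simp add: iota_zero iota_one)
    have "(\<Sum>x\<in>P. \<iota> (?c x) * g x) = (\<Sum>x\<in>{p, p'}. \<iota> (?c x) * g x)"
      using P(1) p by (intro sum.mono_neutral_right) (auto simp: iota_zero)
    also have "\<dots> = 0" using p(3,4) by (simp add: iota_one eq)
    finally have "?c p = 0" using indep[of ?c p] subspace_0[OF W] p(1) by metis
    then show False by simp
  qed
  have "quotient_basis \<iota> V W (g ` P)"
    unfolding quotient_basis_iff[OF V W]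
  proof (intro conjI ballI allI impI)
    fix v assume "v \<in> V"
    then obtain c where "v - (\<Sum>p\<in>P. \<iota> (c p) * g p) \<in> W" using span by blast
    then show "\<exists>c. v - (\<Sum>b\<in>g ` P. \<iota> (c b) * b) \<in> W"
      by (intro exI[of _ "c \<circ> the_inv_into P g"])
         (simp add: sum.reindex[OF inj] the_inv_into_f_f[OF inj])
  next
    fix c b assume c: "(\<Sum>b\<in>g ` P. \<iota> (c b) * b) \<in> W" and b: "b \<in> g ` P"
    from b obtain p where p: "p \<in> P" "b = g p" by blast
    from c have "(\<Sum>p\<in>P. \<iota> (c (g p)) * g p) \<in> W" by (simp add: sum.reindex[OF inj])
    from indep[OF this p(1)] show "c b = 0" using p(2) by simp
  qed (use P in auto)
  then show ?thesis using card_image[OF inj] by blast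
qed

text \<open>Additivity of dimension along W \<subseteq> W' \<subseteq> V. With the disjoint sum as
  index set, overlaps of \<open>B\<close> and \<open>C\<close> need no separate treatment.\<close>

lemma quotient_basis_tower:
  assumes V: "subspace V" and W': "subspace W'" and W: "subspace W" and sub: "W \<subseteq> W'" "W' \<subseteq> V"
    and B: "quotient_basis \<iota> V W' B" and C: "quotient_basis \<iota> W' W C"
  shows "\<exists>A. quotient_basis \<iota> V W A \<and> card A = card B + card C"
proof -
  note B = B[unfolded quotient_basis_iff[OF V W']] and C = C[unfolded quotient_basis_iff[OF W' W]]
  have fin: "finite B" "finite C" using B C by auto
  let ?g = "case_sum id id :: 'a + 'a \<Rightarrow> 'a"
  have split: "(\<Sum>p\<in>B <+> C. \<iota> (c p) * ?g p)
      = (\<Sum>b\<in>B. \<iota> (c (Inl b)) * b) + (\<Sum>b\<in>C. \<iota> (c (Inr b)) * b)" for c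
    using fin by (subst sum.Plus) auto
  have "\<exists>A. quotient_basis \<iota> V W A \<and> card A = card (B <+> C)"
  proof (rule quotient_basis_image[OF V W, of _ ?g])
    show "finite (B <+> C)" using fin by simp
    show "?g p \<in> V" if "p \<in> B <+> C" for p using that B C sub by auto
  next
    fix v assume "v \<in> V"
    then obtain c where c: "v - (\<Sum>b\<in>B. \<iota> (c b) * b) \<in> W'" using B by blast
    then obtain e where "v - (\<Sum>b\<in>B. \<iota> (c b) * b) - (\<Sum>b\<in>C. \<iota> (e b) * b) \<in> W" using C by blast
    then show "\<exists>c. v - (\<Sum>p\<in>B <+> C. \<iota> (c p) * ?g p) \<in> W"
      by (intro exI[of _ "case_sum c e"]) (unfold split, simp add: diff_diff_eq)
  next
    fix c p assume c: "(\<Sum>p\<in>B <+> C. \<iota> (c p) * ?g p) \<in> W" and p: "p \<in> B <+> C"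
    have C': "(\<Sum>b\<in>C. \<iota> (c (Inr b)) * b) \<in> W'"
      using C by (intro subspace_lincomb[OF W']) auto
    have "(\<Sum>b\<in>B. \<iota> (c (Inl b)) * b) \<in> W'"
      using subspace_diff[OF W' subsetD[OF sub(1) c] C'] by (simp add: split)
    then have 0: "c (Inl b) = 0" if "b \<in> B" for b
      using B[THEN conjunct2, THEN conjunct2, THEN conjunct2, rule_format, of "\<lambda>b. c (Inl b)"] that by simp
    then have "(\<Sum>b\<in>C. \<iota> (c (Inr b)) * b) \<in> W" using c by (simp add: split iota_zero)
    then have "c (Inr b) = 0" if "b \<in> C" for b
      using C[THEN conjunct2, THEN conjunct2, THEN conjunct2, rule_format, of "\<lambda>b. c (Inr b)"] that by simp
    with 0 p show "c p = 0" by auto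
  qed
  then show ?thesis using fin by (simp add: card_Plus)
qed

end

text \<open>\<open>\<phi>\<close> induces an isomorphism of V/W onto the product of the V' z / W' z:
  \<open>ker\<close> makes it injective, \<open>surj\<close> surjective. No product space is formed,
  as all factors live in one algebra. With a single index this is invariance of dimension under
  isomorphism.\<close>

lemma quotient_basis_product:
  assumes "complex_algebra \<iota>" "complex_algebra \<iota>'"
    and V: "module.subspace (\<lambda>c x. \<iota> c * x) V" and W: "module.subspace (\<lambda>c x. \<iota> c * x) W"
    and V': "\<And>z. z \<in> Z \<Longrightarrow> module.subspace (\<lambda>c x. \<iota>' c * x) (V' z)"
    and W': "\<And>z. z \<in> Z \<Longrightarrow> module.subspace (\<lambda>c x. \<iota>' c * x) (W' z)"
    and Z: "finite Z" and B: "\<And>z. z \<in> Z \<Longrightarrow> quotient_basis \<iota>' (V' z) (W' z) (B z)"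
    and add: "\<And>x y. \<phi> (x + y) = \<phi> x + \<phi> y" and scale: "\<And>c x. \<phi> (\<iota> c * x) = \<iota>' c * \<phi> x"
    and into: "\<And>v z. v \<in> V \<Longrightarrow> z \<in> Z \<Longrightarrow> \<phi> v \<in> V' z"
    and ker: "\<And>v. v \<in> V \<Longrightarrow> v \<in> W \<longleftrightarrow> (\<forall>z\<in>Z. \<phi> v \<in> W' z)"
    and surj: "\<And>u. (\<And>z. z \<in> Z \<Longrightarrow> u z \<in> V' z) \<Longrightarrow> \<exists>v\<in>V. \<forall>z\<in>Z. \<phi> v - u z \<in> W' z"
  shows "\<exists>A. quotient_basis \<iota> V W A \<and> card A = (\<Sum>z\<in>Z. card (B z))"
proof -
  interpret s: complex_algebra \<iota> by fact
  interpret t: complex_algebra \<iota>' by fact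
  interpret h: module_hom "\<lambda>c x. \<iota> c * x" "\<lambda>c x. \<iota>' c * x" \<phi>
    by unfold_locales (auto simp: add scale)
  have B: "finite (B z)" "B z \<subseteq> V' z" "v \<in> V' z \<Longrightarrow> \<exists>c. v - (\<Sum>b\<in>B z. \<iota>' (c b) * b) \<in> W' z"
    "(\<Sum>b\<in>B z. \<iota>' (c b) * b) \<in> W' z \<Longrightarrow> b \<in> B z \<Longrightarrow> c b = 0" if "z \<in> Z" for z v c b
    using B[OF that] unfolding t.quotient_basis_iff[OF V'[OF that] W'[OF that]] by blast+
  have finB: "finite (B z)" if "z \<in> Z" for z using B(1)[OF that] .
  let ?P = "Sigma Z B"
  \<comment> \<open>Lifts of the tuples with a basis vector at \<open>z\<close> and 0 elsewhere;
    these lifts form the basis.\<close>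
  have "\<exists>v\<in>V. \<forall>y\<in>Z. \<phi> v - (if y = z then b else 0) \<in> W' y" if "z \<in> Z" "b \<in> B z" for z b
    using B(2)[OF that(1)] that(2) t.subspace_0[OF V'] by (intro surj) auto
  then have "\<forall>p\<in>?P. \<exists>v\<in>V. \<forall>y\<in>Z. \<phi> v - (if y = fst p then snd p else 0) \<in> W' y" by auto
  then obtain g where g: "\<And>p. p \<in> ?P \<Longrightarrow> g p \<in> V"
    "\<And>p y. p \<in> ?P \<Longrightarrow> y \<in> Z \<Longrightarrow> \<phi> (g p) - (if y = fst p then snd p else 0) \<in> W' y" by metis
  have key: "\<phi> (\<Sum>p\<in>?P. \<iota> (c p) * g p) - (\<Sum>b\<in>B z. \<iota>' (c (z, b)) * b) \<in> W' z" if z: "z \<in> Z" for c z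
  proof -
    have "(\<Sum>p\<in>?P. \<iota>' (c p) * (\<phi> (g p) - (if z = fst p then snd p else 0))) \<in> W' z"
      using g(2)[OF _ z] by (intro t.subspace_lincomb[OF W'[OF z]])
    also have "(\<Sum>p\<in>?P. \<iota>' (c p) * (\<phi> (g p) - (if z = fst p then snd p else 0)))
      = \<phi> (\<Sum>p\<in>?P. \<iota> (c p) * g p) - (\<Sum>p\<in>?P. \<iota>' (c p) * (if z = fst p then snd p else 0))"
      by (simp add: h.sum scale sum_subtractf right_diff_distrib)
    also have "(\<Sum>p\<in>?P. \<iota>' (c p) * (if z = fst p then snd p else 0))
       = (\<Sum>y\<in>Z. \<Sum>b\<in>B y. if z = y then \<iota>' (c (y, b)) * b else 0)"
      using Z finB by (subst sum.Sigma) (auto intro!: sum.cong)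
    also have "\<dots> = (\<Sum>y\<in>Z. if z = y then \<Sum>b\<in>B y. \<iota>' (c (y, b)) * b else 0)"
      by (intro sum.cong) auto
    also have "\<dots> = (\<Sum>b\<in>B z. \<iota>' (c (z, b)) * b)" using Z z by simp
    finally show ?thesis .
  qed
  have "\<exists>A. quotient_basis \<iota> V W A \<and> card A = card ?P"
  proof (rule s.quotient_basis_image[OF V W, of _ g])
    show "finite ?P" using Z finB by auto
  next
    fix v assume v: "v \<in> V"
    have "\<forall>z\<in>Z. \<exists>c. \<phi> v - (\<Sum>b\<in>B z. \<iota>' (c b) * b) \<in> W' z" using B(3) into[OF v] by blast
    then obtain c where c: "\<And>z. z \<in> Z \<Longrightarrow> \<phi> v - (\<Sum>b\<in>B z. \<iota>' (c z b) * b) \<in> W' z" by metis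
    let ?w = "\<Sum>p\<in>?P. \<iota> (c (fst p) (snd p)) * g p"
    have w: "?w \<in> V" by (intro s.subspace_lincomb[OF V] g)
    have "\<phi> (v - ?w) \<in> W' z" if z: "z \<in> Z" for z
      using t.subspace_diff[OF W'[OF z] c[OF z] key[OF z, of "\<lambda>p. c (fst p) (snd p)"]]
      by (simp add: h.diff)
    then have "v - ?w \<in> W" using ker[OF s.subspace_diff[OF V v w]] by simp
    then show "\<exists>c. v - (\<Sum>p\<in>?P. \<iota> (c p) * g p) \<in> W"
      by (rule exI[of _ "\<lambda>p. c (fst p) (snd p)"])
  next
    fix c p assume c: "(\<Sum>p\<in>?P. \<iota> (c p) * g p) \<in> W" and p: "p \<in> ?P"
    have cV: "(\<Sum>p\<in>?P. \<iota> (c p) * g p) \<in> V" by (intro s.subspace_lincomb[OF V] g)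
    have z: "fst p \<in> Z" "snd p \<in> B (fst p)" using p by auto
    have "\<phi> (\<Sum>p\<in>?P. \<iota> (c p) * g p) \<in> W' (fst p)" using ker[OF cV] c z by blast
    from t.subspace_diff[OF W'[OF z(1)] this key[OF z(1), of c]]
    have "(\<Sum>b\<in>B (fst p). \<iota>' (c (fst p, b)) * b) \<in> W' (fst p)" by simp
    then have "c (fst p, snd p) = 0"
      using B(4)[OF z(1), of "\<lambda>b. c (fst p, b)" "snd p"] z(2) by blast
    then show "c p = 0" by simp
  qed (use g in auto)
  also have "card ?P = (\<Sum>z\<in>Z. card (B z))" using Z finB by (simp add: card_SigmaI)
  finally show ?thesis .
qed


section \<open>Ideals and the Koszul complex\<close>

definition is_ideal :: "'a::comm_ring_1 set \<Rightarrow> bool" where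
  "is_ideal A \<longleftrightarrow> 0 \<in> A \<and> (\<forall>x\<in>A. \<forall>y\<in>A. x + y \<in> A) \<and> (\<forall>r. \<forall>x\<in>A. r * x \<in> A)"

definition gen :: "'a::comm_ring_1 set \<Rightarrow> 'a set" where
  "gen G = \<Inter>{A. is_ideal A \<and> G \<subseteq> A}"

lemma ideal_0: "is_ideal A \<Longrightarrow> 0 \<in> A"
  and ideal_add: "is_ideal A \<Longrightarrow> x \<in> A \<Longrightarrow> y \<in> A \<Longrightarrow> x + y \<in> A"
  and ideal_mult: "is_ideal A \<Longrightarrow> x \<in> A \<Longrightarrow> r * x \<in> A"
  by (auto simp: is_ideal_def)

lemma ideal_mult_right: "is_ideal A \<Longrightarrow> x \<in> A \<Longrightarrow> x * r \<in> A"
  using ideal_mult[of A x r] by (simp add: mult.commute)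

lemma ideal_neg: "is_ideal A \<Longrightarrow> x \<in> A \<Longrightarrow> - x \<in> A"
  using ideal_mult[of A x "- 1"] by simp

lemma ideal_diff: "is_ideal A \<Longrightarrow> x \<in> A \<Longrightarrow> y \<in> A \<Longrightarrow> x - y \<in> A"
  using ideal_add[of A x "- y"] ideal_neg[of A y] by simp

lemma ideal_sum: "is_ideal A \<Longrightarrow> (\<And>i. i \<in> S \<Longrightarrow> g i \<in> A) \<Longrightarrow> sum g S \<in> A"
  by (induction S rule: infinite_finite_induct) (auto intro: ideal_0 ideal_add)

lemma is_ideal_gen: "is_ideal (gen G)"
  unfolding gen_def is_ideal_def by auto

lemma gen_superset: "G \<subseteq> gen G"
  by (auto simp: gen_def)

lemma gen_least: "is_ideal A \<Longrightarrow> G \<subseteq> A \<Longrightarrow> gen G \<subseteq> A"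
  by (auto simp: gen_def)

lemma gen_mono: "G \<subseteq> H \<Longrightarrow> gen G \<subseteq> gen H"
  by (meson gen_least gen_superset is_ideal_gen subset_trans)

lemma gen_image_iff:
  assumes "finite K"
  shows "x \<in> gen (F ` K) \<longleftrightarrow> (\<exists>c. x = (\<Sum>i\<in>K. c i * F i))"
proof
  let ?A = "{x. \<exists>c. x = (\<Sum>i\<in>K. c i * F i)}"
  have "is_ideal ?A" unfolding is_ideal_def
  proof (intro conjI ballI allI)
    show "0 \<in> ?A" by (auto intro: exI[of _ "\<lambda>_. 0"])
  next
    fix x y assume "x \<in> ?A" "y \<in> ?A"
    then obtain c e where "x = (\<Sum>i\<in>K. c i * F i)" "y = (\<Sum>i\<in>K. e i * F i)" by blast
    then have "x + y = (\<Sum>i\<in>K. (c i + e i) * F i)" by (simp add: distrib_right sum.distrib)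
    then show "x + y \<in> ?A" by (intro CollectI exI[of _ "\<lambda>i. c i + e i"])
  next
    fix r x assume "x \<in> ?A"
    then obtain c where "x = (\<Sum>i\<in>K. c i * F i)" by blast
    then have "r * x = (\<Sum>i\<in>K. (r * c i) * F i)" by (simp add: sum_distrib_left mult.assoc)
    then show "r * x \<in> ?A" by (intro CollectI exI[of _ "\<lambda>i. r * c i"])
  qed
  moreover have "F ` K \<subseteq> ?A"
  proof clarsimp
    fix k assume "k \<in> K"
    then show "\<exists>c. F k = (\<Sum>i\<in>K. c i * F i)"
      using assms by (intro exI[of _ "\<lambda>i. if i = k then 1 else 0"]) (simp add: if_distrib[of "\<lambda>c. c * _"] cong: if_cong)
  qed
  ultimately show "x \<in> gen (F ` K) \<Longrightarrow> \<exists>c. x = (\<Sum>i\<in>K. c i * F i)" using gen_least by blast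
next
  assume "\<exists>c. x = (\<Sum>i\<in>K. c i * F i)"
  then show "x \<in> gen (F ` K)"
    using gen_superset[of "F ` K"] by (auto intro!: ideal_sum ideal_mult is_ideal_gen)
qed

lemma is_ideal_adjoin: "is_ideal A \<Longrightarrow> is_ideal {x. \<exists>y. x - a * y \<in> A}"
  unfolding is_ideal_def
proof (intro conjI ballI allI; clarsimp)
  assume A: "0 \<in> A" "\<forall>x\<in>A. \<forall>y\<in>A. x + y \<in> A" "\<forall>r. \<forall>x\<in>A. r * x \<in> A"
  show "\<exists>y. - (a * y) \<in> A" using A(1) by (intro exI[of _ 0]) simp
  { fix x y u v assume "x - a * u \<in> A" "y - a * v \<in> A"
    then have "(x - a * u) + (y - a * v) \<in> A" using A(2) by blast
    then show "\<exists>z. x + y - a * z \<in> A" by (intro exI[of _ "u + v"]) (simp add: algebra_simps) }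
  { fix r x u assume "x - a * u \<in> A"
    then have "r * (x - a * u) \<in> A" using A(3) by blast
    then show "\<exists>z. r * x - a * z \<in> A" by (intro exI[of _ "r * u"]) (simp add: algebra_simps) }
qed

lemma gen_insert: "gen (insert a G) = {x. \<exists>y. x - a * y \<in> gen G}"
proof
  show "gen (insert a G) \<subseteq> {x. \<exists>y. x - a * y \<in> gen G}"
  proof (rule gen_least[OF is_ideal_adjoin[OF is_ideal_gen]])
    have "a - a * 1 \<in> gen G" using ideal_0[OF is_ideal_gen] by simp
    moreover have "g - a * 0 \<in> gen G" if "g \<in> G" for g using gen_superset that by auto
    ultimately show "insert a G \<subseteq> {x. \<exists>y. x - a * y \<in> gen G}" by blast
  qed
  show "{x. \<exists>y. x - a * y \<in> gen G} \<subseteq> gen (insert a G)"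
  proof clarify
    fix x y assume "x - a * y \<in> gen G"
    then have "x - a * y \<in> gen (insert a G)" using gen_mono[of G "insert a G"] by auto
    moreover have "y * a \<in> gen (insert a G)"
      using gen_superset[of "insert a G"] by (intro ideal_mult is_ideal_gen) auto
    ultimately have "(x - a * y) + y * a \<in> gen (insert a G)" by (rule ideal_add[OF is_ideal_gen])
    then show "x \<in> gen (insert a G)" by (simp add: mult.commute)
  qed
qed

text \<open>The sign with which the basis vector e_i is moved past the smaller elements of
  \<open>T\<close> to its sorted place in an exterior product.\<close>

definition ksign :: "nat \<Rightarrow> nat set \<Rightarrow> 'a::comm_ring_1" where
  "ksign i T = (- 1) ^ card {j\<in>T. j < i}"

text \<open>The Koszul differential in coordinates: \<open>z T\<close> is the coefficient of the
  exterior product of the e_j with j \<in> T. All exterior degrees are treated at once; the degree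
  of a chain shows only in the size of the sets at which it is inspected.\<close>

definition koszul :: "(nat \<Rightarrow> 'a) \<Rightarrow> nat set \<Rightarrow> (nat set \<Rightarrow> 'a) \<Rightarrow> nat set \<Rightarrow> 'a::comm_ring_1" where
  "koszul F K z T = (\<Sum>i\<in>K - T. ksign i T * F i * z (insert i T))"

text \<open>Exterior multiplication by e_i from the left, in the same coordinates.\<close>

definition wedge :: "nat \<Rightarrow> (nat set \<Rightarrow> 'a) \<Rightarrow> nat set \<Rightarrow> 'a::comm_ring_1" where
  "wedge i z T = (if i \<in> T then ksign i (T - {i}) * z (T - {i}) else 0)"

lemma ksign_square: "ksign i T * ksign i T = 1"
  by (simp add: ksign_def flip: power_add mult_2)

lemma ksign_insert:
  assumes "finite T" "j \<notin> T"
  shows "ksign i (insert j T) = (if j < i then - ksign i T else ksign i T)"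
proof -
  have "{x \<in> insert j T. x < i} = (if j < i then insert j {x\<in>T. x < i} else {x\<in>T. x < i})" by auto
  then show ?thesis using assms by (simp add: ksign_def)
qed

text \<open>The rule e_i e_j = - e_j e_i: inserting the other index changes exactly one of the two
  signs.\<close>

lemma ksign_antisym:
  assumes "finite T" "i \<notin> T" "j \<notin> T" "i \<noteq> j"
  shows "ksign i T * ksign j (insert i T) = - (ksign j T * ksign i (insert j T))"
  using assms by (auto simp: ksign_insert mult.commute)

lemma sum_antisym_eq_0:
  fixes G :: "'b \<Rightarrow> 'b \<Rightarrow> 'a::ab_group_add"
  assumes "finite D" "\<And>i j. i \<in> D \<Longrightarrow> j \<in> D \<Longrightarrow> i \<noteq> j \<Longrightarrow> G i j = - G j i"
  shows "(\<Sum>i\<in>D. \<Sum>j\<in>D - {i}. G i j) = 0"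
  using assms
proof (induction D rule: finite_induct)
  case (insert a D)
  have 0: "(\<Sum>i\<in>D. \<Sum>j\<in>D - {i}. G i j) = 0"
    by (rule insert.IH) (rule insert.prems, auto)
  have 1: "(\<Sum>j\<in>insert a D - {i}. G i j) = G i a + (\<Sum>j\<in>D - {i}. G i j)" if "i \<in> D" for i
  proof -
    have "insert a D - {i} = insert a (D - {i})" using that insert.hyps by auto
    then show ?thesis using insert.hyps by simp
  qed
  have "(\<Sum>i\<in>insert a D. \<Sum>j\<in>insert a D - {i}. G i j)
    = (\<Sum>j\<in>D. G a j) + (\<Sum>i\<in>D. \<Sum>j\<in>insert a D - {i}. G i j)"
    using insert.hyps by simp
  also have "\<dots> = (\<Sum>j\<in>D. G a j) + (\<Sum>i\<in>D. G i a + (\<Sum>j\<in>D - {i}. G i j))"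
    by (simp add: 1)
  also have "\<dots> = (\<Sum>j\<in>D. G a j + G j a)"
    by (simp add: sum.distrib 0)
  also have "\<dots> = 0"
  proof (intro sum.neutral ballI)
    fix j assume "j \<in> D"
    then have "G a j = - G j a" using insert.hyps by (intro insert.prems) auto
    then show "G a j + G j a = 0" by simp
  qed
  finally show ?case .
qed simp

lemma koszul_koszul:
  assumes K: "finite K" and T: "T \<subseteq> K"
  shows "koszul F K (koszul F K z) T = 0"
proof -
  have fT: "finite T" using T K finite_subset by blast
  let ?G = "\<lambda>i j. ksign i T * F i * (ksign j (insert i T) * F j * z (insert j (insert i T)))"
  have "koszul F K (koszul F K z) T = (\<Sum>i\<in>K - T. \<Sum>j\<in>(K - T) - {i}. ?G i j)"
    unfolding koszul_def sum_distrib_left by (intro sum.cong) auto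
  also have "\<dots> = 0"
  proof (rule sum_antisym_eq_0)
    fix i j assume ij: "i \<in> K - T" "j \<in> K - T" "i \<noteq> j"
    have "?G i j = (ksign i T * ksign j (insert i T)) * (F i * F j * z (insert j (insert i T)))"
      by (simp add: mult_ac)
    also have "\<dots> = - (ksign j T * ksign i (insert j T)) * (F i * F j * z (insert i (insert j T)))"
      using ij fT by (subst ksign_antisym) (auto simp: insert_commute)
    also have "\<dots> = - ?G j i" by (simp add: mult_ac)
    finally show "?G i j = - ?G j i" .
  qed (use K in auto)
  finally show ?thesis .
qed

text \<open>Multiplication by \<open>F i\<close> is null-homotopic, with homotopy
  \<open>wedge i\<close>. If i \<notin> T, only the summand j = i survives. If i \<in> T, the
  differential of \<open>z\<close> at \<open>T - {i}\<close> has one summand more than the left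
  side, and this one is \<open>F i * z T\<close> after the signs cancel.\<close>

lemma koszul_wedge:
  fixes F :: "nat \<Rightarrow> 'a::comm_ring_1"
  assumes K: "finite K" and T: "T \<subseteq> K" and i: "i \<in> K"
  shows "koszul F K (wedge i z) T = F i * z T - wedge i (koszul F K z) T"
proof (cases "i \<in> T")
  case False
  have "koszul F K (wedge i z) T = (\<Sum>j\<in>K - T. if j = i then F i * z T else 0)"
    unfolding koszul_def
  proof (intro sum.cong refl)
    fix j assume j: "j \<in> K - T"
    have "ksign i T * F i * (ksign i T * z T) = (ksign i T * ksign i T) * (F i * z T)"
      by (simp add: mult_ac)
    then have "ksign i T * F i * (ksign i T * z T) = F i * z T" by (simp add: ksign_square)
    then show "ksign j T * F j * wedge i z (insert j T) = (if j = i then F i * z T else 0)"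
      using False j by (auto simp: wedge_def)
  qed
  also have "\<dots> = F i * z T" using K i False by simp
  finally show ?thesis using False by (simp add: wedge_def)
next
  case True
  define U where "U = T - {i}"
  have U: "finite U" "i \<notin> U" "T = insert i U" "U \<subseteq> K"
    using T True K finite_subset by (auto simp: U_def)
  have KU: "K - U = insert i (K - T)" using U T i by auto
  have "wedge i (koszul F K z) T = ksign i U * (ksign i U * F i * z T)
      + (\<Sum>j\<in>K - T. ksign i U * (ksign j U * F j * z (insert j U)))"
    using True K U unfolding wedge_def koszul_def U_def[symmetric] KU
    by (simp add: distrib_left sum_distrib_left)
  also have "ksign i U * (ksign i U * F i * z T) = (ksign i U * ksign i U) * (F i * z T)"
    by (simp add: mult_ac)
  also have "(\<Sum>j\<in>K - T. ksign i U * (ksign j U * F j * z (insert j U))) = - koszul F K (wedge i z) T"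
    unfolding koszul_def sum_negf[symmetric]
  proof (intro sum.cong refl)
    fix j assume j: "j \<in> K - T"
    then have ne: "j \<noteq> i" "j \<notin> U" using U by auto
    have eq: "insert j T - {i} = insert j U" using U ne by auto
    have "(ksign j T * ksign i (insert j U) :: 'a) = - (ksign i U * ksign j U)"
    proof -
      \<comment> \<open>A square equal to 1 is inserted so that antisymmetry, which pairs a sign at
        \<open>U\<close> with one at an enlarged set, becomes applicable.\<close>
      have "(ksign i U * ksign j U :: 'a) = ksign i U * (ksign j T * ksign j T) * ksign j U"
        by (simp add: ksign_square)
      also have "\<dots> = (ksign i U * ksign j T) * (ksign j T * ksign j U)"
        by (simp only: mult.assoc)
      also have "(ksign i U * ksign j T :: 'a) = - (ksign j U * ksign i (insert j U))"
        unfolding U(3) using U ne by (intro ksign_antisym) auto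
      also have "- (ksign j U * ksign i (insert j U) :: 'a) * (ksign j T * ksign j U)
         = - (ksign j T * ksign i (insert j U)) * (ksign j U * ksign j U)" by (simp add: mult_ac)
      finally have "(ksign i U * ksign j U :: 'a) = - (ksign j T * ksign i (insert j U))"
        by (simp add: ksign_square)
      then show ?thesis by (metis minus_minus)
    qed
    moreover have "ksign j T * F j * wedge i z (insert j T)
        = (ksign j T * ksign i (insert j U)) * (F j * z (insert j U))"
      using True eq by (simp add: wedge_def mult_ac)
    ultimately have eqn: "ksign j T * F j * wedge i z (insert j T) = - (ksign i U * ksign j U) * (F j * z (insert j U))"
      by (simp only:)
    show "ksign i U * (ksign j U * F j * z (insert j U)) = - (ksign j T * F j * wedge i z (insert j T))"
      unfolding eqn by (simp add: mult_ac)
  qed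
  finally show ?thesis by (simp add: ksign_square)
qed

lemma koszul_lincomb:
  "koszul F K (\<lambda>T. \<Sum>i\<in>L. r i * w i T) T = (\<Sum>i\<in>L. r i * koszul F K (w i) T)"
proof -
  have "koszul F K (\<lambda>T. \<Sum>i\<in>L. r i * w i T) T
      = (\<Sum>j\<in>K - T. \<Sum>i\<in>L. r i * (ksign j T * F j * w i (insert j T)))"
    unfolding koszul_def sum_distrib_left by (simp add: mult_ac)
  also have "\<dots> = (\<Sum>i\<in>L. r i * koszul F K (w i) T)"
    unfolding koszul_def sum_distrib_left by (rule sum.swap)
  finally show ?thesis .
qed

lemma koszul_diff: "koszul F K (\<lambda>T. u T - v T) T = koszul F K u T - koszul F K v T"
  by (simp add: koszul_def right_diff_distrib sum_subtractf)

lemma koszul_scale: "koszul F K (\<lambda>T. a * u T) T = a * koszul F K u T"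
  unfolding koszul_def sum_distrib_left by (intro sum.cong) (simp_all add: mult_ac)

text \<open>Exactness in exterior degree \<open>p\<close> of the Koszul complex with coefficients
  modulo \<open>A\<close>. For \<open>p = 0\<close> the cycle condition is vacuous, as it should be
  at the end of the complex.\<close>

definition koszul_exact :: "(nat \<Rightarrow> 'a) \<Rightarrow> nat set \<Rightarrow> nat \<Rightarrow> 'a::comm_ring_1 set \<Rightarrow> bool" where
  "koszul_exact F K p A \<longleftrightarrow>
     (\<forall>z. (\<forall>T\<subseteq>K. card T + 1 = p \<longrightarrow> koszul F K z T \<in> A) \<longrightarrow>
        (\<exists>w. \<forall>T\<subseteq>K. card T = p \<longrightarrow> z T - koszul F K w T \<in> A))"

text \<open>Writing \<open>a\<close> in terms of \<open>F\<close>, the homotopies combine to a chain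
  \<open>w\<close> whose differential is \<open>a * z\<close> modulo \<open>A\<close>; so
  \<open>w\<close> is a cycle modulo A + (a). Exactness there makes \<open>w\<close> a boundary plus
  \<open>a * u\<close> modulo \<open>A\<close>. Applying the differential and cancelling
  \<open>a\<close> shows that \<open>z\<close> is the boundary of \<open>u\<close>.\<close>

lemma koszul_exact_descend:
  assumes K: "finite K" and A: "is_ideal A"
    and nzd: "\<And>x. a * x \<in> A \<Longrightarrow> x \<in> A" and a: "a \<in> gen (F ` K)"
    and ex: "koszul_exact F K (Suc p) {x. \<exists>y. x - a * y \<in> A}"
  shows "koszul_exact F K p A"
  unfolding koszul_exact_def
proof (intro allI impI)
  fix z assume z: "\<forall>T\<subseteq>K. card T + 1 = p \<longrightarrow> koszul F K z T \<in> A"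
  obtain r where r: "a = (\<Sum>i\<in>K. r i * F i)" using a gen_image_iff[OF K] by blast
  define w where "w T = (\<Sum>i\<in>K. r i * wedge i z T)" for T
  have w: "koszul F K w T - a * z T \<in> A" if T: "T \<subseteq> K" "card T = p" for T
  proof -
    have "koszul F K w T = (\<Sum>i\<in>K. r i * koszul F K (wedge i z) T)"
      unfolding w_def by (rule koszul_lincomb)
    also have "\<dots> = (\<Sum>i\<in>K. r i * (F i * z T - wedge i (koszul F K z) T))"
      by (intro sum.cong refl) (simp add: koszul_wedge[OF K T(1)])
    also have "\<dots> = a * z T - (\<Sum>i\<in>K. r i * wedge i (koszul F K z) T)"
      unfolding r by (simp add: right_diff_distrib sum_subtractf sum_distrib_right mult.assoc)
    finally have "koszul F K w T - a * z T = - (\<Sum>i\<in>K. r i * wedge i (koszul F K z) T)" by simp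
    moreover have "wedge i (koszul F K z) T \<in> A" for i
    proof (cases "i \<in> T")
      case True
      have "finite T" using T K finite_subset by blast
      then have "T - {i} \<subseteq> K" "card (T - {i}) + 1 = p" using T True card_Suc_Diff1[of T i] by auto
      then show ?thesis using z True by (auto simp: wedge_def intro: ideal_mult[OF A])
    qed (simp add: wedge_def ideal_0[OF A])
    ultimately show ?thesis by (auto intro!: ideal_neg[OF A] ideal_sum[OF A] ideal_mult[OF A])
  qed
  have cyc: "\<forall>T\<subseteq>K. card T + 1 = Suc p \<longrightarrow> koszul F K w T \<in> {x. \<exists>y. x - a * y \<in> A}" using w by auto
  obtain v where "\<forall>T\<subseteq>K. card T = Suc p \<longrightarrow> w T - koszul F K v T \<in> {x. \<exists>y. x - a * y \<in> A}"
    using mp[OF spec[OF ex[unfolded koszul_exact_def], of w] cyc] by (rule exE)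
  then have "\<forall>T. \<exists>y. T \<subseteq> K \<longrightarrow> card T = Suc p \<longrightarrow> w T - koszul F K v T - a * y \<in> A" by simp
  then obtain u where u: "\<And>T. T \<subseteq> K \<Longrightarrow> card T = Suc p \<Longrightarrow> w T - koszul F K v T - a * u T \<in> A" by metis
  show "\<exists>u. \<forall>T\<subseteq>K. card T = p \<longrightarrow> z T - koszul F K u T \<in> A"
  proof (intro exI[of _ u] allI impI)
    fix T assume T: "T \<subseteq> K" "card T = p"
    have fT: "finite T" using T K finite_subset by blast
    have "koszul F K (\<lambda>T. w T - koszul F K v T - a * u T) T \<in> A"
      unfolding koszul_def[of F K "\<lambda>T. w T - koszul F K v T - a * u T"]
      using T fT by (intro ideal_sum[OF A] ideal_mult[OF A] u) auto
    moreover have "koszul F K (\<lambda>T. w T - koszul F K v T - a * u T) T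
        = koszul F K w T - koszul F K (koszul F K v) T - a * koszul F K u T"
      by (simp only: koszul_diff koszul_scale)
    ultimately have 1: "koszul F K w T - a * koszul F K u T \<in> A"
      by (simp add: koszul_koszul[OF K T(1)])
    have "(koszul F K w T - a * koszul F K u T) - (koszul F K w T - a * z T) \<in> A"
      by (rule ideal_diff[OF A 1 w[OF T]])
    then have "a * (z T - koszul F K u T) \<in> A" by (simp add: right_diff_distrib)
    then show "z T - koszul F K u T \<in> A" by (rule nzd)
  qed
qed

text \<open>Downward induction on the length \<open>j\<close> of the initial segment: at
  \<open>j = m\<close> exactness in degree m + 1 is vacuous, since \<open>K\<close> has no subset of
  that size, and at \<open>j = 0\<close> the ideal is zero.\<close>

lemma koszul_exact_of_regular_sequence:
  fixes F a :: "nat \<Rightarrow> 'a::comm_ring_1"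
  assumes K: "finite K" and m: "card K \<le> m"
    and a: "\<And>j. j < m \<Longrightarrow> a j \<in> gen (F ` K)"
    and nzd: "\<And>j x. j < m \<Longrightarrow> a j * x \<in> gen (a ` {..<j}) \<Longrightarrow> x \<in> gen (a ` {..<j})"
  shows "koszul_exact F K 1 {0}"
proof -
  have "koszul_exact F K (Suc j) (gen (a ` {..<j}))" if "j \<le> m" for j
    using that
  proof (induction j rule: inc_induct)
    case base
    have "card T \<noteq> Suc m" if "T \<subseteq> K" for T using card_mono[OF K that] m by simp
    then show ?case unfolding koszul_exact_def by blast
  next
    case (step j)
    show ?case
    proof (rule koszul_exact_descend[OF K is_ideal_gen])
      show "koszul_exact F K (Suc (Suc j)) {x. \<exists>y. x - a j * y \<in> gen (a ` {..<j})}"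
        using step.IH by (simp add: lessThan_Suc gen_insert)
    qed (use step a nzd in auto)
  qed
  from this[of 0] have "koszul_exact F K 1 (gen {})" by simp
  moreover have "gen {} = {0 :: 'a}"
    using gen_least[of "{0 :: 'a}" "{}"] ideal_0[OF is_ideal_gen, of "{}"] by (auto simp: is_ideal_def)
  ultimately show ?thesis by simp
qed

text \<open>The relation that expresses \<open>F k * g\<close> by the other \<open>F i\<close> is a
  cycle of degree one with entry \<open>g\<close> at \<open>{k}\<close>. It is a boundary, and the
  differential at \<open>{k}\<close> inserts only indices different from \<open>k\<close>, so
  \<open>g\<close> is a combination of the other \<open>F i\<close>.\<close>

theorem nonzerodivisor_of_regular_sequence:
  fixes F a :: "nat \<Rightarrow> 'a::comm_ring_1"
  assumes K: "finite K" and m: "card K \<le> m"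
    and a: "\<And>j. j < m \<Longrightarrow> a j \<in> gen (F ` K)"
    and nzd: "\<And>j x. j < m \<Longrightarrow> a j * x \<in> gen (a ` {..<j}) \<Longrightarrow> x \<in> gen (a ` {..<j})"
    and k: "k \<in> K" and g: "F k * g \<in> gen (F ` (K - {k}))"
  shows "g \<in> gen (F ` (K - {k}))"
proof -
  obtain c where c: "F k * g = (\<Sum>i\<in>K - {k}. c i * F i)"
    using g gen_image_iff[of "K - {k}"] K by blast
  define z where "z T = (if T = {k} then g else - c (the_elem T))" for T
  have "koszul F K z {} = (\<Sum>i\<in>K. F i * z {i})" by (simp add: koszul_def ksign_def)
  also have "\<dots> = F k * g + (\<Sum>i\<in>K - {k}. F i * z {i})"
    using K k by (subst sum.remove[of _ k]) (auto simp: z_def)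
  also have "(\<Sum>i\<in>K - {k}. F i * z {i}) = - (\<Sum>i\<in>K - {k}. c i * F i)"
    unfolding sum_negf[symmetric] by (intro sum.cong) (auto simp: z_def mult.commute)
  finally have z0: "koszul F K z {} = 0" using c by simp
  have "\<forall>T\<subseteq>K. card T + 1 = 1 \<longrightarrow> koszul F K z T \<in> {0}"
    using z0 K finite_subset by fastforce
  then obtain w where w: "\<forall>T\<subseteq>K. card T = 1 \<longrightarrow> z T - koszul F K w T \<in> {0}"
    using koszul_exact_of_regular_sequence[OF K m a nzd] unfolding koszul_exact_def by blast
  have "z {k} = koszul F K w {k}" using w[rule_format, of "{k}"] k by simp
  then have "g = (\<Sum>i\<in>K - {k}. ksign i {k} * F i * w (insert i {k}))"
    by (simp add: z_def koszul_def)
  then show ?thesis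
    by (subst gen_image_iff) (use K in \<open>auto intro!: exI[of _ "\<lambda>i. ksign i {k} * w (insert i {k})"] simp: mult_ac\<close>)
qed


section \<open>The graded polynomial ring\<close>

abbreviation keys where "keys \<equiv> Poly_Mapping.keys"
abbreviation lookup where "lookup \<equiv> Poly_Mapping.lookup"


lemma keys_add_nat: "keys (k + m) = keys k \<union> keys (m :: 'a \<Rightarrow>\<^sub>0 nat)"
  by (auto simp: in_keys_iff lookup_add)

definition meval :: "(nat \<Rightarrow> complex) \<Rightarrow> (nat \<Rightarrow>\<^sub>0 nat) \<Rightarrow> complex" where
  "meval z m = (\<Prod>i\<in>keys m. z i ^ lookup m i)"

lemma meval_superset: "finite A \<Longrightarrow> keys m \<subseteq> A \<Longrightarrow> meval z m = (\<Prod>i\<in>A. z i ^ lookup m i)"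
  unfolding meval_def by (rule prod.mono_neutral_left) (auto simp: in_keys_iff)

lemma meval_add: "meval z (k + m) = meval z k * meval z m"
proof -
  let ?A = "keys k \<union> keys m"
  have "meval z (k + m) = (\<Prod>i\<in>?A. z i ^ lookup (k + m) i)"
    by (rule meval_superset) (auto simp: keys_add_nat)
  also have "\<dots> = (\<Prod>i\<in>?A. z i ^ lookup k i) * (\<Prod>i\<in>?A. z i ^ lookup m i)"
    by (simp add: lookup_add power_add prod.distrib)
  also have "\<dots> = meval z k * meval z m"
    by (subst (1 2) meval_superset[of ?A]) auto
  finally show ?thesis .
qed

lemma meval_0 [simp]: "meval z 0 = 1"
  by (simp add: meval_def)

lemma meval_single [simp]: "meval z (Poly_Mapping.single i k) = z i ^ k"
  by (cases "k = 0") (simp_all add: meval_def)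

lemma wdegree_superset: "finite A \<Longrightarrow> keys m \<subseteq> A \<Longrightarrow> wdegree q m = (\<Sum>i\<in>A. q i * lookup m i)"
  unfolding wdegree_def by (rule sum.mono_neutral_left) (auto simp: in_keys_iff)

lemma wdegree_add: "wdegree q (k + m) = wdegree q k + wdegree q m"
proof -
  let ?A = "keys k \<union> keys m"
  have "wdegree q (k + m) = (\<Sum>i\<in>?A. q i * lookup (k + m) i)"
    by (rule wdegree_superset) (auto simp: keys_add_nat)
  also have "\<dots> = (\<Sum>i\<in>?A. q i * lookup k i) + (\<Sum>i\<in>?A. q i * lookup m i)"
    by (simp add: lookup_add distrib_left sum.distrib)
  also have "\<dots> = wdegree q k + wdegree q m"
    by (subst (1 2) wdegree_superset[of ?A]) auto
  finally show ?thesis .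
qed

lemma wdegree_0 [simp]: "wdegree q 0 = 0"
  by (simp add: wdegree_def)

lemma wdegree_single [simp]: "wdegree q (Poly_Mapping.single i k) = q i * k"
  by (cases "k = 0") (simp_all add: wdegree_def)

lemma meval_weighted: "keys m \<subseteq> {..n} \<Longrightarrow> (\<And>i. i \<le> n \<Longrightarrow> w i = t ^ q i * z i) \<Longrightarrow>
    meval w m = t ^ wdegree q m * meval z m"
  unfolding meval_def wdegree_def power_sum prod.distrib[symmetric]
  by (intro prod.cong) (auto simp: power_mult_distrib power_mult)

lemma poly_expand: "f = (\<Sum>m\<in>keys f. Poly_Mapping.single m (lookup f m))"
proof (rule poly_mapping_eqI)
  fix k
  have "lookup (\<Sum>m\<in>keys f. Poly_Mapping.single m (lookup f m)) k
      = (\<Sum>m\<in>keys f. if m = k then lookup f m else 0)"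
    unfolding lookup_sum by (intro sum.cong) (auto simp: lookup_single when_def)
  then show "lookup f k = lookup (\<Sum>m\<in>keys f. Poly_Mapping.single m (lookup f m)) k"
    by (simp add: in_keys_iff)
qed

lemma poly_additive_induct [case_names single add]:
  assumes "\<And>m c. P (Poly_Mapping.single m c)" "\<And>f g. P f \<Longrightarrow> P g \<Longrightarrow> P (f + g)"
  shows "P (f :: 'a \<Rightarrow>\<^sub>0 'b::comm_monoid_add)"
proof -
  have "P (\<Sum>m\<in>A. Poly_Mapping.single m (lookup f m))" if "finite A" for A
    using that
  proof (induction A rule: finite_induct)
    case empty
    then show ?case using assms(1)[of undefined 0] by simp
  qed (simp add: assms)
  from this[OF finite_keys[of f]] show ?thesis by (simp only: poly_expand[of f, symmetric])
qed

lemma peval_superset: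
  assumes "finite A" "keys f \<subseteq> A"
  shows "peval z f = (\<Sum>m\<in>A. lookup f m * meval z m)"
  unfolding peval_def meval_def[symmetric]
  by (rule sum.mono_neutral_left) (use assms in \<open>auto simp: in_keys_iff\<close>)

lemma peval_0 [simp]: "peval z 0 = 0"
  by (simp add: peval_def)

lemma peval_add: "peval z (f + g) = peval z f + peval z g"
  by (subst (1 2 3) peval_superset[of "keys f \<union> keys g"])
     (use keys_add[of f g] in \<open>auto simp: lookup_add distrib_right sum.distrib\<close>)

lemma peval_single [simp]: "peval z (Poly_Mapping.single m c) = c * meval z m"
  by (cases "c = 0") (simp_all add: peval_def meval_def)

lemma peval_mult: "peval z (f * g) = peval z f * peval z g"
proof (induction f rule: poly_additive_induct)
  case (single m c)
  show ?case
    by (induction g rule: poly_additive_induct)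
       (simp_all add: mult_single meval_add distrib_left peval_add)
qed (simp add: distrib_right peval_add)

lemma peval_1 [simp]: "peval z 1 = 1"
  using peval_single[of z 0 1] by simp

lemma peval_minus: "peval z (- f) = - peval z f"
  using peval_add[of z f "- f"] by (simp add: eq_neg_iff_add_eq_0 add.commute)

lemma peval_diff: "peval z (f - g) = peval z f - peval z g"
  using peval_add[of z f "- g"] by (simp add: peval_minus)

lemma peval_sum: "peval z (sum f A) = (\<Sum>x\<in>A. peval z (f x))"
  by (induction A rule: infinite_finite_induct) (simp_all add: peval_add)

lemma peval_prod: "peval z (prod f A) = (\<Prod>x\<in>A. peval z (f x))"
  by (induction A rule: infinite_finite_induct) (simp_all add: peval_mult)

lemma peval_power: "peval z (f ^ k) = peval z f ^ k"
  by (induction k) (simp_all add: peval_mult)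

lemma peval_const [simp]: "peval z (const c) = c"
  by (simp add: const_def)

lemma peval_var [simp]: "peval z (var i) = z i"
  by (simp add: var_def)

lemma const_mult_single: "const c * Poly_Mapping.single m a = Poly_Mapping.single m (c * a)"
  by (simp add: const_def mult_single)

lemma lookup_const_mult: "lookup (const c * f) m = c * lookup f m"
proof (induction f rule: poly_additive_induct)
  case (single k a)
  show ?case by (simp add: const_mult_single lookup_single when_def)
qed (simp add: distrib_left lookup_add)

lemma var_power: "var i ^ k = Poly_Mapping.single (Poly_Mapping.single i k) 1"
  by (induction k) (simp_all add: var_def mult_single flip: single_add)

interpretation const: complex_algebra const
  by unfold_locales (simp_all add: const_def single_add mult_single)

section \<open>Restriction to sets of monomials and homogeneous components\<close>

definition filter_keys :: "('a \<Rightarrow> bool) \<Rightarrow> ('a \<Rightarrow>\<^sub>0 'b::comm_monoid_add) \<Rightarrow> 'a \<Rightarrow>\<^sub>0 'b" where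
  "filter_keys Q f = (\<Sum>m\<in>{m\<in>keys f. Q m}. Poly_Mapping.single m (lookup f m))"

lemma lookup_filter_keys: "lookup (filter_keys Q f) m = (if Q m then lookup f m else 0)"
proof -
  have "lookup (filter_keys Q f) m = (\<Sum>k\<in>{m\<in>keys f. Q m}. if k = m then lookup f k else 0)"
    unfolding filter_keys_def lookup_sum by (intro sum.cong) (auto simp: lookup_single when_def)
  then show ?thesis by (simp add: in_keys_iff)
qed

lemma keys_filter_keys: "keys (filter_keys Q f) = {m\<in>keys f. Q m}"
  by (auto simp: in_keys_iff lookup_filter_keys split: if_splits)

lemma filter_keys_add: "filter_keys Q (f + g) = filter_keys Q f + filter_keys Q g"
  by (rule poly_mapping_eqI) (simp add: lookup_filter_keys lookup_add)

lemma filter_keys_0 [simp]: "filter_keys Q 0 = 0"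
  by (rule poly_mapping_eqI) (simp add: lookup_filter_keys)

lemma filter_keys_sum: "filter_keys Q (sum g A) = (\<Sum>x\<in>A. filter_keys Q (g x))"
  by (induction A rule: infinite_finite_induct) (simp_all add: filter_keys_add)

lemma filter_keys_single: "filter_keys Q (Poly_Mapping.single m c) = (if Q m then Poly_Mapping.single m c else 0)"
  by (rule poly_mapping_eqI) (auto simp: lookup_filter_keys lookup_single when_def)

lemma filter_keys_id: "(\<And>m. m \<in> keys f \<Longrightarrow> Q m) \<Longrightarrow> filter_keys Q f = f"
  by (rule poly_mapping_eqI) (auto simp: lookup_filter_keys in_keys_iff)

text \<open>Meant for homogeneous \<open>g\<close>: all its monomials shift the degree alike, so
  selecting a degree in the product amounts to selecting one in the cofactor.\<close>

lemma filter_keys_mult: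
  fixes c g :: "'a::monoid_add \<Rightarrow>\<^sub>0 'b::semiring_0"
  assumes "\<And>k m. m \<in> keys g \<Longrightarrow> Q (k + m) \<longleftrightarrow> Q' k"
  shows "filter_keys Q (c * g) = filter_keys Q' c * g"
proof (induction c rule: poly_additive_induct)
  case (single k a)
  let ?g = "\<lambda>m. Poly_Mapping.single m (lookup g m)"
  have "filter_keys Q (Poly_Mapping.single k a * (\<Sum>m\<in>keys g. ?g m))
      = filter_keys Q' (Poly_Mapping.single k a) * (\<Sum>m\<in>keys g. ?g m)"
    unfolding sum_distrib_left filter_keys_sum mult_single filter_keys_single
    by (cases "Q' k") (auto simp: assms mult_single intro!: sum.neutral)
  then show ?case by (simp flip: poly_expand)
qed (simp add: distrib_right filter_keys_add)

lemma cox_ring_simps [simp]: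
  "monoid.mult (cox_ring n) = (*)" "ring.add (cox_ring n) = (+)"
  "monoid.one (cox_ring n) = 1" "ring.zero (cox_ring n) = 0"
  by (simp_all add: cox_ring_def)

lemma carrier_cox_ring: "f \<in> carrier (cox_ring n) \<longleftrightarrow> (\<forall>m\<in>keys f. keys m \<subseteq> {..n})"
  by (simp add: cox_ring_def)

lemma graded_piece_iff:
  "f \<in> graded_piece n q \<alpha> \<longleftrightarrow> (\<forall>m\<in>keys f. keys m \<subseteq> {..n} \<and> int (wdegree q m) = \<alpha>)"
  by (auto simp: graded_piece_def carrier_cox_ring)

lemma graded_piece_carrier: "f \<in> graded_piece n q \<alpha> \<Longrightarrow> f \<in> carrier (cox_ring n)"
  by (simp add: graded_piece_def)

lemma graded_piece_0 [simp]: "0 \<in> graded_piece n q \<alpha>"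
  by (simp add: graded_piece_iff)

lemma graded_piece_add: "f \<in> graded_piece n q \<alpha> \<Longrightarrow> g \<in> graded_piece n q \<alpha> \<Longrightarrow> f + g \<in> graded_piece n q \<alpha>"
  using keys_add[of f g] by (auto simp: graded_piece_iff)

lemma graded_piece_uminus: "f \<in> graded_piece n q \<alpha> \<Longrightarrow> - f \<in> graded_piece n q \<alpha>"
  by (simp add: graded_piece_iff)

lemma graded_piece_diff: "f \<in> graded_piece n q \<alpha> \<Longrightarrow> g \<in> graded_piece n q \<alpha> \<Longrightarrow> f - g \<in> graded_piece n q \<alpha>"
  using graded_piece_add[of f n q \<alpha> "- g"] by (simp add: graded_piece_uminus)

lemma graded_piece_sum: "(\<And>x. x \<in> A \<Longrightarrow> g x \<in> graded_piece n q \<alpha>) \<Longrightarrow> sum g A \<in> graded_piece n q \<alpha>"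
  by (induction A rule: infinite_finite_induct) (simp_all add: graded_piece_add)

lemma graded_piece_mult:
  assumes "f \<in> graded_piece n q \<alpha>" "g \<in> graded_piece n q \<beta>"
  shows "f * g \<in> graded_piece n q (\<alpha> + \<beta>)"
  unfolding graded_piece_iff
proof
  fix m assume "m \<in> keys (f * g)"
  then obtain a b where "m = a + b" "a \<in> keys f" "b \<in> keys g" using keys_mult[of f g] by blast
  with assms show "keys m \<subseteq> {..n} \<and> int (wdegree q m) = \<alpha> + \<beta>"
    by (auto simp: graded_piece_iff keys_add_nat wdegree_add)
qed

lemma graded_piece_1: "1 \<in> graded_piece n q 0"
  by (simp add: graded_piece_iff)

lemma graded_piece_const: "const c \<in> graded_piece n q 0"
  by (cases "c = 0") (simp_all add: graded_piece_iff const_def)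

lemma graded_piece_const_mult: "f \<in> graded_piece n q \<alpha> \<Longrightarrow> const c * f \<in> graded_piece n q \<alpha>"
  using graded_piece_mult[OF graded_piece_const, of f n q \<alpha> c] by simp

lemma graded_piece_power: "f \<in> graded_piece n q \<alpha> \<Longrightarrow> f ^ k \<in> graded_piece n q (int k * \<alpha>)"
  by (induction k) (auto simp: graded_piece_1 algebra_simps dest: graded_piece_mult)

lemma graded_piece_single:
  "keys m \<subseteq> {..n} \<Longrightarrow> Poly_Mapping.single m c \<in> graded_piece n q (int (wdegree q m))"
  by (simp add: graded_piece_iff)

lemma graded_piece_var: "i \<le> n \<Longrightarrow> var i \<in> graded_piece n q (int (q i))"
  using graded_piece_single[of "Poly_Mapping.single i 1" n 1 q] by (simp add: var_def)

lemma graded_piece_negative: "f \<in> graded_piece n q \<alpha> \<Longrightarrow> \<alpha> < 0 \<Longrightarrow> f = 0"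
  by (rule ccontr) (auto simp: graded_piece_iff dest: subsetD)

lemma graded_piece_subspace: "const.subspace (graded_piece n q \<alpha>)"
  unfolding const.subspace_def by (auto simp: graded_piece_add graded_piece_const_mult)

lemma ideal_subspace: "is_ideal A \<Longrightarrow> const.subspace A"
  unfolding const.subspace_def by (auto simp: is_ideal_def)

definition hproj :: "nat \<Rightarrow> (nat \<Rightarrow> nat) \<Rightarrow> int \<Rightarrow> poly_cox \<Rightarrow> poly_cox" where
  "hproj n q t = filter_keys (\<lambda>m. keys m \<subseteq> {..n} \<and> int (wdegree q m) = t)"

lemma hproj_in_graded_piece: "hproj n q t f \<in> graded_piece n q t"
  by (auto simp: hproj_def graded_piece_iff keys_filter_keys)

lemma hproj_id: "f \<in> graded_piece n q t \<Longrightarrow> hproj n q t f = f"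
  unfolding hproj_def by (rule filter_keys_id) (auto simp: graded_piece_iff)

lemma hproj_sum: "hproj n q t (sum g A) = (\<Sum>x\<in>A. hproj n q t (g x))"
  by (simp add: hproj_def filter_keys_sum)

lemma hproj_mult: "g \<in> graded_piece n q D \<Longrightarrow> hproj n q t (c * g) = hproj n q (t - D) c * g"
  unfolding hproj_def
  by (rule filter_keys_mult) (auto simp: graded_piece_iff keys_add_nat wdegree_add)

text \<open>The ideals \<open>gen G\<close> live in the polynomial ring in infinitely many variables. The projection onto a
  graded piece of the Cox ring discards the superfluous variables, too, so that in each degree
  nothing changes.\<close>

lemma graded_gen_coefficients:
  assumes K: "finite K" and F: "\<And>i. i \<in> K \<Longrightarrow> F i \<in> graded_piece n q (D i)"
    and g: "g \<in> graded_piece n q t" "g \<in> gen (F ` K)"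
  shows "\<exists>c. (\<forall>i. c i \<in> graded_piece n q (t - D i)) \<and> g = (\<Sum>i\<in>K. c i * F i)"
proof -
  obtain c where c: "g = (\<Sum>i\<in>K. c i * F i)" using g(2) gen_image_iff[OF K] by blast
  have "g = hproj n q t g" using g(1) by (simp add: hproj_id)
  also have "\<dots> = (\<Sum>i\<in>K. hproj n q (t - D i) (c i) * F i)"
    unfolding c hproj_sum by (intro sum.cong refl hproj_mult F)
  finally show ?thesis using hproj_in_graded_piece
    by (intro exI[of _ "\<lambda>i. hproj n q (t - D i) (c i)"]) blast
qed

lemma peval_cong: "f \<in> carrier (cox_ring n) \<Longrightarrow> (\<And>i. i \<le> n \<Longrightarrow> z i = w i) \<Longrightarrow> peval z f = peval w f"
  unfolding peval_def carrier_cox_ring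
  by (intro sum.cong refl arg_cong2[of _ _ _ _ "(*)"] prod.cong) (auto simp: subset_iff)

lemma peval_weighted:
  assumes f: "f \<in> graded_piece n q (int d)" and w: "\<And>i. i \<le> n \<Longrightarrow> w i = t ^ q i * z i"
  shows "peval w f = t ^ d * peval z f"
  unfolding peval_def meval_def[symmetric] sum_distrib_left
proof (intro sum.cong refl)
  fix m assume "m \<in> keys f"
  then have "keys m \<subseteq> {..n}" "wdegree q m = d" using f by (auto simp: graded_piece_iff)
  then show "lookup f m * meval w m = t ^ d * (lookup f m * meval z m)"
    using meval_weighted[of m n w t q z] w by simp
qed

lemma finite_monomials:
  assumes "\<And>i. i \<le> n \<Longrightarrow> q i > 0"
  shows "finite {m. keys m \<subseteq> {..n} \<and> int (wdegree q m) = t}" (is "finite ?M")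
proof -
  let ?\<phi> = "\<lambda>m. restrict (lookup m) {..n}"
  have "inj_on ?\<phi> ?M"
  proof (rule inj_onI, rule poly_mapping_eqI)
    fix m k :: "nat \<Rightarrow>\<^sub>0 nat" and i assume m: "m \<in> ?M" "k \<in> ?M" and eq: "?\<phi> m = ?\<phi> k"
    show "lookup m i = lookup k i"
    proof (cases "i \<le> n")
      case True
      with fun_cong[OF eq, of i] show ?thesis by simp
    next
      case False
      with m have "i \<notin> keys m" "i \<notin> keys k" by auto
      then show ?thesis by (simp add: in_keys_iff)
    qed
  qed
  moreover have "?\<phi> ` ?M \<subseteq> {..n} \<rightarrow>\<^sub>E {..nat t}"
  proof clarify
    fix m assume m: "keys m \<subseteq> {..n}" "t = int (wdegree q m)"
    have "lookup m i \<le> wdegree q m" if "i \<le> n" for i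
    proof -
      have "lookup m i \<le> q i * lookup m i" using assms[OF that] by simp
      also have "\<dots> \<le> (\<Sum>i\<in>{..n}. q i * lookup m i)" using that by (intro member_le_sum) auto
      finally show ?thesis using m(1) wdegree_superset[of "{..n}" m q] by simp
    qed
    then show "restrict (lookup m) {..n} \<in> {..n} \<rightarrow>\<^sub>E {..nat (int (wdegree q m))}" by auto
  qed
  then have "finite (?\<phi> ` ?M)" by (rule finite_subset) (auto intro: finite_PiE)
  ultimately show ?thesis by (rule finite_imageD[rotated])
qed

lemma graded_piece_spanned:
  assumes "g \<in> graded_piece n q t" "\<And>i. i \<le> n \<Longrightarrow> q i > 0"
  defines "M \<equiv> {m. keys m \<subseteq> {..n} \<and> int (wdegree q m) = t}"
  shows "g = (\<Sum>m\<in>M. const (lookup g m) * Poly_Mapping.single m 1)"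
proof -
  have "g = (\<Sum>m\<in>keys g. Poly_Mapping.single m (lookup g m))" by (rule poly_expand)
  also have "\<dots> = (\<Sum>m\<in>M. Poly_Mapping.single m (lookup g m))"
    using assms finite_monomials[of n q t]
    by (intro sum.mono_neutral_left) (auto simp: graded_piece_iff in_keys_iff)
  finally show ?thesis by (simp add: const_mult_single)
qed


section \<open>The Nullstellensatz\<close>

text \<open>Zorn's lemma. Used twice: with \<open>W\<close> the powers of a polynomial for the
  Nullstellensatz, and with \<open>W\<close> the polynomials having few zeros on an infinite set of
  points for the finiteness of zero-dimensional sets.\<close>

lemma exists_maximal_avoiding_ideal:
  assumes "is_ideal J" "J \<inter> W = {}"
  shows "\<exists>p. is_ideal p \<and> J \<subseteq> p \<and> p \<inter> W = {} \<and> (\<forall>A. is_ideal A \<longrightarrow> p \<subseteq> A \<longrightarrow> A \<inter> W = {} \<longrightarrow> A = p)"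
proof -
  let ?\<A> = "{A. is_ideal A \<and> J \<subseteq> A \<and> A \<inter> W = {}}"
  have "\<exists>M\<in>?\<A>. \<forall>X\<in>?\<A>. M \<subseteq> X \<longrightarrow> X = M"
  proof (rule subset_Zorn_nonempty)
    show "?\<A> \<noteq> {}" using assms by blast
  next
    fix \<C> assume ne: "\<C> \<noteq> {}" and ch: "subset.chain ?\<A> \<C>"
    have sub: "A \<in> ?\<A>" if "A \<in> \<C>" for A using ch that by (auto simp: subset.chain_def)
    have tot: "A \<subseteq> B \<or> B \<subseteq> A" if "A \<in> \<C>" "B \<in> \<C>" for A B
      using ch that unfolding subset.chain_def by blast
    have "is_ideal (\<Union>\<C>)" unfolding is_ideal_def
    proof (intro conjI ballI allI)
      obtain A where "A \<in> \<C>" using ne by blast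
      then show "0 \<in> \<Union>\<C>" using sub[of A] ideal_0[of A] by blast
    next
      fix x y assume "x \<in> \<Union>\<C>" "y \<in> \<Union>\<C>"
      then obtain A B where AB: "A \<in> \<C>" "B \<in> \<C>" "x \<in> A" "y \<in> B" by blast
      with tot[of A B] obtain C where "C \<in> \<C>" "x \<in> C" "y \<in> C" by blast
      then show "x + y \<in> \<Union>\<C>" using sub[of C] ideal_add[of C x y] by blast
    next
      fix r x assume "x \<in> \<Union>\<C>"
      then obtain A where "A \<in> \<C>" "x \<in> A" by blast
      then show "r * x \<in> \<Union>\<C>" using sub[of A] ideal_mult[of A x r] by blast
    qed
    moreover have "J \<subseteq> \<Union>\<C>"
    proof -
      obtain A where "A \<in> \<C>" using ne by blast
      then show ?thesis using sub[of A] by blast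
    qed
    moreover have "\<Union>\<C> \<inter> W = {}" using sub by fast
    ultimately show "\<Union>\<C> \<in> ?\<A>" by blast
  qed
  then obtain p where p: "p \<in> ?\<A>" "\<forall>X\<in>?\<A>. p \<subseteq> X \<longrightarrow> X = p" by (rule bexE)
  have "A = p" if "is_ideal A" "p \<subseteq> A" "A \<inter> W = {}" for A
  proof -
    have "A \<in> ?\<A>" using that p(1) by auto
    then show ?thesis using p(2) that(2) by (simp only: Ball_def)
  qed
  then show ?thesis using p(1) by (intro exI[of _ p]) simp
qed

lemma maximal_avoiding_adjoin:
  assumes p: "is_ideal p" "\<And>A. is_ideal A \<Longrightarrow> p \<subseteq> A \<Longrightarrow> A \<inter> W = {} \<Longrightarrow> A = p" and x: "x \<notin> p"
  shows "\<exists>w\<in>W. \<exists>r. w - x * r \<in> p"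
proof (rule ccontr)
  assume *: "\<not> ?thesis"
  let ?A = "{v. \<exists>r. v - x * r \<in> p}"
  have "?A = p"
  proof (rule p(2)[OF is_ideal_adjoin[OF p(1)]])
    show "p \<subseteq> ?A" by (auto intro: exI[of _ 0])
    show "?A \<inter> W = {}" using * by blast
  qed
  moreover have "x - x * 1 \<in> p" using ideal_0[OF p(1)] by simp
  then have "x \<in> ?A" by blast
  ultimately show False using x by simp
qed

text \<open>Otherwise p + (x) and p + (y) both meet \<open>W\<close>; the product of the two
  elements lies in \<open>W\<close> and is a multiple of \<open>x * y\<close> modulo
  \<open>p\<close>.\<close>

lemma maximal_avoiding_prime:
  assumes p: "is_ideal p" "\<And>A. is_ideal A \<Longrightarrow> p \<subseteq> A \<Longrightarrow> A \<inter> W = {} \<Longrightarrow> A = p" "p \<inter> W = {}"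
    and W: "\<And>v w. v \<in> W \<Longrightarrow> w \<in> W \<Longrightarrow> v * w \<in> W" and xy: "x * y \<in> p"
  shows "x \<in> p \<or> y \<in> p"
proof (rule ccontr)
  assume *: "\<not> ?thesis"
  obtain v r where v: "v \<in> W" "v - x * r \<in> p" using maximal_avoiding_adjoin[where x = x, OF p(1,2)] * by blast
  obtain w s where w: "w \<in> W" "w - y * s \<in> p" using maximal_avoiding_adjoin[where x = y, OF p(1,2)] * by blast
  have "(v - x * r) * w + (x * r) * (w - y * s) + (r * s) * (x * y) \<in> p"
    by (intro ideal_add[OF p(1)] ideal_mult_right[OF p(1) v(2)] ideal_mult[OF p(1) w(2)] ideal_mult[OF p(1) xy])
  also have "(v - x * r) * w + (x * r) * (w - y * s) + (r * s) * (x * y) = v * w"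
    by (simp add: algebra_simps)
  finally show False using W[OF v(1) w(1)] p(3) by blast
qed

section \<open>Residue classes modulo maximal avoiding ideals, by countability\<close>

lemma countable_monomials: "countable (UNIV :: (nat \<Rightarrow>\<^sub>0 nat) set)"
proof -
  let ?\<phi> = "\<lambda>m :: nat \<Rightarrow>\<^sub>0 nat. (\<lambda>i. (i, lookup m i)) ` keys m"
  have "inj ?\<phi>"
  proof (rule injI, rule poly_mapping_eqI)
    fix m k i assume eq: "?\<phi> m = ?\<phi> k"
    have iff: "(i, v) \<in> ?\<phi> m \<longleftrightarrow> v \<noteq> 0 \<and> v = lookup m i" for m :: "nat \<Rightarrow>\<^sub>0 nat" and v
      by (auto simp: in_keys_iff)
    have "\<And>v. v \<noteq> 0 \<and> v = lookup m i \<longleftrightarrow> v \<noteq> 0 \<and> v = lookup k i"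
      unfolding iff[symmetric] eq ..
    then show "lookup m i = lookup k i" by metis
  qed
  moreover have "countable (range ?\<phi>)"
    by (rule countable_subset[OF _ countable_Collect_finite]) auto
  ultimately show ?thesis by (rule countable_image_inj_on[rotated])
qed

lemma uncountable_fibre:
  assumes "uncountable A" "countable (h ` A)"
  shows "\<exists>y. infinite {x\<in>A. h x = y}"
proof (rule ccontr)
  assume "\<not> ?thesis"
  then have "countable (\<Union>y\<in>h ` A. {x\<in>A. h x = y})"
    using assms(2) by (intro countable_UN) (auto intro: countable_finite)
  moreover have "(\<Union>y\<in>h ` A. {x\<in>A. h x = y}) = A" by auto
  ultimately show False using assms(1) by simp
qed

definition evalp :: "poly_cox \<Rightarrow> complex poly \<Rightarrow> poly_cox" where
  "evalp x Q = poly (map_poly const Q) x"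

lemma const_0 [simp]: "const 0 = 0"
  by (simp add: const_def)

lemma const_1 [simp]: "const 1 = 1"
  by (simp add: const_def)

lemma evalp_pCons: "evalp x (pCons a Q) = const a + x * evalp x Q"
  by (simp add: evalp_def map_poly_pCons)

lemma evalp_0 [simp]: "evalp x 0 = 0"
  by (simp add: evalp_def)

lemma evalp_add: "evalp x (P + Q) = evalp x P + evalp x Q"
  by (induction P Q rule: poly_induct2) (simp_all add: evalp_pCons const.iota_add distrib_left)

lemma evalp_smult: "evalp x (smult c P) = const c * evalp x P"
  by (induction P) (simp_all add: evalp_pCons const.iota_mult distrib_left mult.left_commute)

lemma evalp_sum: "evalp x (sum g A) = (\<Sum>a\<in>A. evalp x (g a))"
  by (induction A rule: infinite_finite_induct) (simp_all add: evalp_add)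

lemma evalp_linear_mult: "evalp x ([:- a, 1:] * Q) = (x - const a) * evalp x Q"
proof -
  have "const (- a) = - const a" using const.iota_diff[of 0 a] by simp
  moreover have "[:- a, 1:] * Q = smult (- a) Q + pCons 0 Q" by simp
  ultimately show ?thesis by (simp only: evalp_add evalp_smult evalp_pCons) (simp add: left_diff_distrib)
qed

lemma evalp_prod_linear: "evalp x (\<Prod>v\<in>S. [:- v, 1:]) = (\<Prod>v\<in>S. x - const v)"
proof (induction S rule: infinite_finite_induct)
  case (insert a S)
  then show ?case by (simp only: prod.insert[OF insert.hyps] evalp_linear_mult)
qed (simp_all add: one_pCons evalp_pCons)

text \<open>The fundamental theorem of algebra splits off linear factors, and primality puts either
  the linear factor or the cofactor into \<open>p\<close>. The process cannot end with a nonzero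
  constant, which would bring 1 into \<open>p\<close>.\<close>

lemma prime_ideal_root:
  assumes p: "is_ideal p" "1 \<notin> p" and prime: "\<And>x y. x * y \<in> p \<Longrightarrow> x \<in> p \<or> y \<in> p"
    and Q: "Q \<noteq> 0" "evalp x Q \<in> p"
  shows "\<exists>c. x - const c \<in> p"
  using Q
proof (induction "degree Q" arbitrary: Q rule: less_induct)
  case less
  show ?case
  proof (cases "degree Q = 0")
    case True
    then obtain a where a: "Q = [:a:]" by (metis degree_eq_zeroE)
    then have "const (inverse a) * const a \<in> p" using less.prems by (intro ideal_mult[OF p(1)]) (simp add: evalp_pCons)
    then have "1 \<in> p" using a less.prems by (simp flip: const.iota_mult)
    then show ?thesis using p by simp
  next
    case False
    then obtain a where "poly Q a = 0"
      using fundamental_theorem_of_algebra[of Q] by (auto simp: constant_degree)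
    then obtain R where R: "Q = [:- a, 1:] * R" by (auto simp: poly_eq_0_iff_dvd dvd_def)
    have "R \<noteq> 0" using R less.prems(1) by auto
    then have "degree R < degree Q" unfolding R by (subst degree_mult_eq) auto
    moreover have "x - const a \<in> p \<or> evalp x R \<in> p"
      using less.prems(2) unfolding R evalp_linear_mult by (rule prime)
    ultimately show ?thesis using less.hyps[of R] \<open>R \<noteq> 0\<close> by blast
  qed
qed

text \<open>A family \<open>r\<^sub>c\<close> of inverses of \<open>x - c\<close> modulo \<open>p\<close>, up to a power of \<open>g\<close>, for all complex \<open>c\<close>
  would be uncountable, whereas the polynomials have countable dimension. A linear relation between
  finitely many \<open>r\<^sub>c\<close>, multiplied by the product of the \<open>x - c\<close>, is a polynomial in \<open>x\<close> over the
  complex numbers which lies in \<open>p\<close>, and one of its linear factors does, too.\<close>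

lemma maximal_avoiding_powers_residue:
  fixes p :: "poly_cox set" and g :: poly_cox
  defines "W \<equiv> range (\<lambda>k. g ^ k)"
  assumes p: "is_ideal p" "\<And>A. is_ideal A \<Longrightarrow> p \<subseteq> A \<Longrightarrow> A \<inter> W = {} \<Longrightarrow> A = p" "p \<inter> W = {}"
  shows "\<exists>c. x - const c \<in> p"
proof (rule ccontr)
  assume no: "\<not> ?thesis"
  have prime: "x \<in> p \<or> y \<in> p" if "x * y \<in> p" for x y
    by (rule maximal_avoiding_prime[OF p _ that]) (auto simp: W_def simp flip: power_add)
  have gk: "g ^ k \<notin> p" for k using p(3) by (auto simp: W_def)
  have "\<exists>k r. g ^ k - (x - const c) * r \<in> p" for c
    using maximal_avoiding_adjoin[where x = "x - const c", OF p(1,2)] no unfolding W_def by blast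
  then obtain k r where kr: "\<And>c. g ^ k c - (x - const c) * r c \<in> p" by metis
  \<comment> \<open>There are only countably many such pairs, so infinitely many \<open>c\<close>
    share the exponent and the monomials. Their \<open>r c\<close> lie in one space of dimension
    \<open>card K\<close>, and more than that many are dependent.\<close>
  let ?h = "\<lambda>c. (k c, keys (r c))"
  have "countable (UNIV \<times> {A. finite A \<and> A \<subseteq> (UNIV :: (nat \<Rightarrow>\<^sub>0 nat) set)} :: (nat \<times> _) set)"
    by (intro countable_SIGMA countable_Collect_finite_subset countable_monomials) auto
  then have "countable (range ?h)" by (rule countable_subset[rotated]) auto
  then obtain y where y: "infinite {c \<in> UNIV. ?h c = y}"
    using uncountable_fibre[OF uncountable_UNIV_complex] by blast
  obtain k0 K where kK: "y = (k0, K)" by (cases y)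
  obtain U where U: "U \<subseteq> {c \<in> UNIV. ?h c = y}" "finite U" "card U = Suc (card K)"
    using infinite_arbitrarily_large[OF y] by blast
  have UK: "k u = k0" "keys (r u) = K" if "u \<in> U" for u using U(1) that kK by auto
  have "U \<noteq> {}" using U(3) by auto
  then have finK: "finite K" using UK by (metis all_not_in_conv finite_keys)
  obtain l where l: "\<exists>u\<in>U. l u \<noteq> 0" "\<And>m. m \<in> K \<Longrightarrow> (\<Sum>u\<in>U. l u * lookup (r u) m) = 0"
    using homogeneous_system_nontrivial[OF finK U(2), of "\<lambda>u. lookup (r u)"] U(3) by auto
  have rel: "(\<Sum>u\<in>U. const (l u) * r u) = 0"
  proof (rule poly_mapping_eqI)
    fix m
    have "lookup (\<Sum>u\<in>U. const (l u) * r u) m = (\<Sum>u\<in>U. l u * lookup (r u) m)"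
      by (simp add: lookup_sum lookup_const_mult)
    also have "\<dots> = 0"
    proof (cases "m \<in> K")
      case False
      then have "lookup (r u) m = 0" if "u \<in> U" for u
        using UK(2)[OF that] by (metis in_keys_iff)
      then show ?thesis by simp
    qed (rule l)
    finally show "lookup (\<Sum>u\<in>U. const (l u) * r u) m = lookup 0 m" by simp
  qed
  \<comment> \<open>The numerator of \<Sum> l u / (X - u). Modulo \<open>p\<close> each 1 / (x - u)
    is \<open>r u\<close> up to the common power of \<open>g\<close>, so the relation between the
    \<open>r u\<close> makes this sum vanish.\<close>
  define Q where "Q = (\<Sum>u\<in>U. smult (l u) (\<Prod>v\<in>U - {u}. [:- v, 1:]))"
  have evQ: "evalp x Q = (\<Sum>u\<in>U. const (l u) * (\<Prod>v\<in>U - {u}. x - const v))"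
    by (simp add: Q_def evalp_sum evalp_smult evalp_prod_linear)
  obtain u0 where u0: "u0 \<in> U" "l u0 \<noteq> 0" using l(1) by blast
  \<comment> \<open>At \<open>u0\<close> every other summand contains the factor
    \<open>u0 - u0\<close>; hence \<open>Q\<close> is not the zero polynomial.\<close>
  have "poly Q u0 = (\<Sum>u\<in>U. if u = u0 then l u0 * (\<Prod>v\<in>U - {u0}. u0 - v) else 0)"
    unfolding Q_def poly_sum
  proof (intro sum.cong refl)
    fix u assume "u \<in> U"
    then show "poly (smult (l u) (\<Prod>v\<in>U - {u}. [:- v, 1:])) u0
        = (if u = u0 then l u0 * (\<Prod>v\<in>U - {u0}. u0 - v) else 0)"
      using u0(1) U(2) by (auto simp: poly_prod)
  qed
  also have "\<dots> = l u0 * (\<Prod>v\<in>U - {u0}. u0 - v)" using u0(1) U(2) by simp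
  finally have "poly Q u0 \<noteq> 0" using u0 U(2) by auto
  then have Q0: "Q \<noteq> 0" by auto
  let ?c = "\<lambda>u. const (l u) * (\<Prod>v\<in>U - {u}. x - const v)"
  have "(\<Sum>u\<in>U. ?c u * (g ^ k0 - (x - const u) * r u)) \<in> p"
    using kr UK by (intro ideal_sum[OF p(1)] ideal_mult[OF p(1)]) metis
  also have "(\<Sum>u\<in>U. ?c u * (g ^ k0 - (x - const u) * r u))
      = evalp x Q * g ^ k0 - (\<Sum>u\<in>U. ?c u * ((x - const u) * r u))"
    by (simp add: evQ right_diff_distrib sum_subtractf sum_distrib_right)
  also have "(\<Sum>u\<in>U. ?c u * ((x - const u) * r u)) = (\<Sum>u\<in>U. (\<Prod>v\<in>U. x - const v) * (const (l u) * r u))"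
    using U(2) by (intro sum.cong refl) (simp add: prod.remove[of U] mult_ac)
  also have "\<dots> = 0" unfolding sum_distrib_left[symmetric] rel by simp
  finally have "evalp x Q \<in> p" using prime gk by auto
  from prime_ideal_root[OF p(1) _ prime Q0 this] gk[of 0] no show False by auto
qed

text \<open>Modulo a maximal ideal \<open>p\<close> above \<open>J\<close> avoiding the powers of
  \<open>g\<close>, every variable is congruent to a complex number. These numbers form the point
  \<open>z\<close>, and every polynomial is congruent to its value there. As 1 and \<open>g\<close>
  are not in \<open>p\<close>, the elements of \<open>J\<close> vanish at \<open>z\<close> and
  \<open>g\<close> does not.\<close>

theorem nullstellensatz:
  fixes J :: "poly_cox set"
  assumes J: "is_ideal J" and g: "\<And>k. g ^ k \<notin> J"
  shows "\<exists>z. (\<forall>f\<in>J. peval z f = 0) \<and> peval z g \<noteq> 0"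
proof -
  let ?W = "range (\<lambda>k. g ^ k)"
  obtain p where p: "is_ideal p" "J \<subseteq> p" "p \<inter> ?W = {}"
    "\<And>A. is_ideal A \<Longrightarrow> p \<subseteq> A \<Longrightarrow> A \<inter> ?W = {} \<Longrightarrow> A = p"
    using exists_maximal_avoiding_ideal[OF J, of ?W] g by blast
  have "\<forall>i. \<exists>c. var i - const c \<in> p"
    using maximal_avoiding_powers_residue[OF p(1,4,3)] by blast
  then obtain z where z: "\<And>i. var i - const (z i) \<in> p" by metis
  let ?R = "\<lambda>f. f - const (peval z f) \<in> p"
  have mult: "?R (f * h)" if "?R f" "?R h" for f h
  proof -
    have "(f - const (peval z f)) * h + const (peval z f) * (h - const (peval z h)) \<in> p"
      by (intro ideal_add[OF p(1)] ideal_mult_right[OF p(1) that(1)] ideal_mult[OF p(1) that(2)])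
    then show ?thesis by (simp add: peval_mult const.iota_mult algebra_simps)
  qed
  have pow: "?R (f ^ k)" if "?R f" for f k
    by (induction k) (simp_all add: mult that ideal_0[OF p(1)])
  have mon: "?R (Poly_Mapping.single m 1)" for m
  proof (induction m rule: poly_additive_induct)
    case (single i k)
    show ?case using pow[of "var i" k] z by (simp add: var_power)
  next
    case (add a b)
    from mult[OF add] show ?case by (simp add: mult_single)
  qed
  have R: "?R f" for f
  proof (induction f rule: poly_additive_induct)
    case (single m c)
    show ?case using mult[OF _ mon[of m], of "const c"] ideal_0[OF p(1)]
      by (simp add: const_mult_single)
  next
    case (add f h)
    from ideal_add[OF p(1) add] show ?case by (simp add: peval_add const.iota_add algebra_simps)
  qed
  have "g ^ k \<notin> p" for k using p(3) by blast
  from this[of 0] this[of 1] have "1 \<notin> p" "g \<notin> p" by simp_all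
  have "peval z f = 0" if "f \<in> J" for f
  proof (rule ccontr)
    assume nz: "peval z f \<noteq> 0"
    have "const (peval z f) \<in> p"
      using ideal_diff[OF p(1) subsetD[OF p(2) that] R[of f]] by simp
    then have "const (inverse (peval z f)) * const (peval z f) \<in> p" by (rule ideal_mult[OF p(1)])
    then show False using nz \<open>1 \<notin> p\<close> by (simp flip: const.iota_mult)
  qed
  moreover have "peval z g \<noteq> 0" using R[of g] \<open>g \<notin> p\<close> by auto
  ultimately show ?thesis by blast
qed

text \<open>The point found has infinitely many coordinates; setting those beyond \<open>n\<close>
  to 0 does not change the values of elements of the Cox ring.\<close>

corollary nullstellensatz_radical:
  assumes G: "G \<subseteq> carrier (cox_ring n)" and g: "g \<in> carrier (cox_ring n)"
    and zero: "\<And>z. (\<forall>i>n. z i = 0) \<Longrightarrow> (\<forall>f\<in>G. peval z f = 0) \<Longrightarrow> peval z g = 0"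
  shows "\<exists>k. g ^ k \<in> gen G"
proof (rule ccontr)
  assume "\<not> ?thesis"
  then obtain z where z: "\<forall>f\<in>gen G. peval z f = 0" "peval z g \<noteq> 0"
    using nullstellensatz[OF is_ideal_gen] by blast
  let ?z = "\<lambda>i. if i \<le> n then z i else 0"
  have eq: "peval ?z f = peval z f" if "f \<in> carrier (cox_ring n)" for f
    using that by (rule peval_cong) simp
  have "peval ?z g = 0"
  proof (rule zero)
    show "\<forall>f\<in>G. peval ?z f = 0"
    proof
      fix f assume "f \<in> G"
      then have "peval z f = 0" "f \<in> carrier (cox_ring n)" using G z(1) gen_superset[of G] by blast+
      then show "peval ?z f = 0" using eq by simp
    qed
  qed simp
  then show False using z(2) eq[OF g] by simp
qed


section \<open>Regular sequences and Hilbert functions\<close>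

lemma var_power_carrier: "i \<le> n \<Longrightarrow> var i ^ k \<in> carrier (cox_ring n)"
  by (cases "k = 0") (simp_all add: var_power carrier_cox_ring)

lemma lookup_single_mult: "lookup (Poly_Mapping.single s 1 * f) (s + m) = lookup f m"
  for s m :: "nat \<Rightarrow>\<^sub>0 nat" and f :: poly_cox
  by (induction f rule: poly_additive_induct)
     (simp_all add: mult_single lookup_single distrib_left lookup_add)

lemma gen_var_powers_iff:
  assumes J: "finite J"
  shows "f \<in> gen ((\<lambda>i. var i ^ e i) ` J) \<longleftrightarrow> (\<forall>m\<in>keys f. \<exists>i\<in>J. e i \<le> lookup m i)"
proof
  let ?A = "{f :: poly_cox. \<forall>m\<in>keys f. \<exists>i\<in>J. e i \<le> lookup m i}"
  have "is_ideal ?A" unfolding is_ideal_def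
  proof (intro conjI ballI allI)
    fix f g assume "f \<in> ?A" "g \<in> ?A"
    then show "f + g \<in> ?A" using keys_add[of f g] by blast
  next
    fix r f assume f: "f \<in> ?A"
    show "r * f \<in> ?A"
    proof clarify
      fix m assume "m \<in> keys (r * f)"
      then obtain a b where m: "m = a + b" "b \<in> keys f" using keys_mult[of r f] by blast
      then obtain i where "i \<in> J" "e i \<le> lookup b i" using f by blast
      then show "\<exists>i\<in>J. e i \<le> lookup m i" unfolding m lookup_add by (intro bexI[of _ i]) auto
    qed
  qed simp
  moreover have "var i ^ e i \<in> ?A" if "i \<in> J" for i
    using that by (auto simp: var_power intro: bexI[of _ i])
  then have "(\<lambda>i. var i ^ e i) ` J \<subseteq> ?A" by blast
  ultimately show "f \<in> gen ((\<lambda>i. var i ^ e i) ` J) \<Longrightarrow> \<forall>m\<in>keys f. \<exists>i\<in>J. e i \<le> lookup m i"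
    using gen_least by blast
next
  assume f: "\<forall>m\<in>keys f. \<exists>i\<in>J. e i \<le> lookup m i"
  have "Poly_Mapping.single m (lookup f m) \<in> gen ((\<lambda>i. var i ^ e i) ` J)" if m: "m \<in> keys f" for m
  proof -
    obtain i where i: "i \<in> J" "e i \<le> lookup m i" using f m by blast
    let ?s = "Poly_Mapping.single i (e i)"
    have "m = (m - ?s) + ?s"
      using i(2) by (intro poly_mapping_eqI) (auto simp: lookup_add lookup_minus lookup_single when_def)
    then have "Poly_Mapping.single m (lookup f m) = Poly_Mapping.single (m - ?s) (lookup f m) * var i ^ e i"
      by (simp add: var_power mult_single)
    moreover have "var i ^ e i \<in> gen ((\<lambda>i. var i ^ e i) ` J)"
      by (rule subsetD[OF gen_superset]) (use i(1) in auto)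
    ultimately show ?thesis by (simp add: ideal_mult is_ideal_gen)
  qed
  then have "(\<Sum>m\<in>keys f. Poly_Mapping.single m (lookup f m)) \<in> gen ((\<lambda>i. var i ^ e i) ` J)"
    by (intro ideal_sum is_ideal_gen)
  then show "f \<in> gen ((\<lambda>i. var i ^ e i) ` J)" by (simp only: poly_expand[of f, symmetric])
qed

text \<open>Membership in this monomial ideal only tests exponents of variables below
  \<open>j\<close>, which multiplication by a power of \<open>var j\<close> leaves alone.\<close>

lemma var_power_nonzerodivisor:
  assumes "var j ^ N * f \<in> gen ((\<lambda>i. var i ^ N) ` {..<j})"
  shows "f \<in> gen ((\<lambda>i. var i ^ N) ` {..<j})"
proof -
  have "\<exists>i\<in>{..<j}. N \<le> lookup m i" if m: "m \<in> keys f" for m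
  proof -
    let ?s = "Poly_Mapping.single j N"
    have "?s + m \<in> keys (var j ^ N * f)"
      using m by (simp add: in_keys_iff var_power lookup_single_mult)
    with assms obtain i where "i < j" "N \<le> lookup (?s + m) i"
      unfolding gen_var_powers_iff[OF finite_lessThan, of f] gen_var_powers_iff[OF finite_lessThan, of "var j ^ N * f"]
      by blast
    then show ?thesis by (auto simp: lookup_add lookup_single when_def)
  qed
  then show ?thesis by (simp add: gen_var_powers_iff)
qed

text \<open>For n + 1 forms of positive degree, the geometric description of a homogeneous system of
  parameters.\<close>

definition only_trivial_zero :: "nat \<Rightarrow> (nat \<Rightarrow> poly_cox) \<Rightarrow> bool" where
  "only_trivial_zero n F \<longleftrightarrow>
     (\<forall>z. (\<forall>i>n. z i = 0) \<longrightarrow> (\<forall>i\<le>n. peval z (F i) = 0) \<longrightarrow> (\<forall>i\<le>n. z i = 0))"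

text \<open>By the Nullstellensatz the ideal of all \<open>F i\<close> contains a power of each
  variable; with a common exponent these form a regular sequence of length n + 1, which is as many
  as there are \<open>F i\<close>.\<close>

lemma nonzerodivisor_of_only_trivial_zero:
  assumes F: "\<And>i. i \<le> n \<Longrightarrow> F i \<in> carrier (cox_ring n)" and zero: "only_trivial_zero n F"
    and k: "k \<le> n" and g: "F k * g \<in> gen (F ` ({..n} - {k}))"
  shows "g \<in> gen (F ` ({..n} - {k}))"
proof -
  have "\<exists>N. var j ^ N \<in> gen (F ` {..n})" if j: "j \<le> n" for j
  proof (rule nullstellensatz_radical[where n = n])
    show "var j \<in> carrier (cox_ring n)" using var_power_carrier[OF j, of 1] by simp
    show "peval z (var j) = 0" if "\<forall>i>n. z i = 0" "\<forall>f\<in>F ` {..n}. peval z f = 0" for z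
      using zero that j unfolding only_trivial_zero_def by auto
  qed (use F in auto)
  then obtain N where N: "\<And>j. j \<le> n \<Longrightarrow> var j ^ N j \<in> gen (F ` {..n})" by metis
  define M where "M = Max (N ` {..n})"
  have M: "var j ^ M \<in> gen (F ` {..n})" if "j \<le> n" for j
  proof -
    have "N j \<le> M" using that by (auto simp: M_def)
    then have "var j ^ M = var j ^ (M - N j) * var j ^ N j" by (simp flip: power_add)
    then show ?thesis using ideal_mult[OF is_ideal_gen N[OF that]] by simp
  qed
  show ?thesis
    by (rule nonzerodivisor_of_regular_sequence[where m = "Suc n" and a = "\<lambda>j. var j ^ M" and F = F])
       (use M k g var_power_nonzerodivisor in auto)
qed

text \<open>The order of the sequence does not matter because the later elements may be replaced by powers
  of degree greater than \<open>t\<close>, which do not contribute in degree \<open>t\<close>.\<close>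

lemma regular_sequence_of_only_trivial_zero:
  assumes F: "\<And>i. i \<le> n \<Longrightarrow> F i \<in> graded_piece n q (int (D i))" "\<And>i. i \<le> n \<Longrightarrow> D i > 0"
    and zero: "only_trivial_zero n F"
    and k: "k \<le> n" and g: "g \<in> graded_piece n q t" "F k * g \<in> gen (F ` {..<k})"
  shows "g \<in> gen (F ` {..<k})"
proof -
  define r where "r = Suc (nat t)"
  define F' where "F' i = (if i \<le> k then F i else F i ^ r)" for i
  define D' where "D' i = (if i \<le> k then int (D i) else int r * int (D i))" for i
  have F': "F' i \<in> graded_piece n q (D' i)" if "i \<le> n" for i
    using F(1)[OF that] by (simp add: F'_def D'_def graded_piece_power)
  have zero': "only_trivial_zero n F'"
  proof -
    have "peval z (F' i) = 0 \<longleftrightarrow> peval z (F i) = 0" for z i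
      by (simp add: F'_def peval_power r_def del: power_Suc)
    then show ?thesis using zero by (simp add: only_trivial_zero_def)
  qed
  have sub: "F ` {..<k} \<subseteq> F' ` ({..n} - {k})"
    using k by (auto simp: F'_def intro!: image_eqI)
  have "F' k * g \<in> gen (F' ` ({..n} - {k}))"
    using g(2) gen_mono[OF sub] by (auto simp: F'_def)
  then have "g \<in> gen (F' ` ({..n} - {k}))"
    using nonzerodivisor_of_only_trivial_zero[of n F', OF graded_piece_carrier[OF F'] zero' k] by blast
  then obtain c where c: "\<And>i. c i \<in> graded_piece n q (t - D' i)" "g = (\<Sum>i\<in>{..n} - {k}. c i * F' i)"
    using graded_gen_coefficients[of "{..n} - {k}" F' n q D' g t] F' g(1) by auto
  have "c i * F' i \<in> gen (F ` {..<k})" if i: "i \<in> {..n} - {k}" for i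
  proof (cases "i < k")
    case True
    then have "F' i \<in> gen (F ` {..<k})"
      by (intro subsetD[OF gen_superset]) (auto simp: F'_def)
    then show ?thesis by (rule ideal_mult[OF is_ideal_gen])
  next
    case False
    have "int r * 1 \<le> int r * int (D i)" using F(2)[of i] i by (intro mult_left_mono) auto
    moreover have "t < int r" by (simp add: r_def)
    moreover have "D' i = int r * int (D i)" using False i by (auto simp: D'_def)
    ultimately have "t - D' i < 0" by simp
    then have "c i = 0" using c(1) graded_piece_negative by blast
    then show ?thesis by (simp add: ideal_0 is_ideal_gen)
  qed
  then show ?thesis unfolding c(2) by (intro ideal_sum is_ideal_gen)
qed

section \<open>Hilbert functions\<close>

abbreviation graded_gen :: "nat \<Rightarrow> (nat \<Rightarrow> nat) \<Rightarrow> poly_cox set \<Rightarrow> int \<Rightarrow> poly_cox set" where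
  "graded_gen n q G t \<equiv> graded_piece n q t \<inter> gen G"

lemma graded_gen_subspace: "const.subspace (graded_gen n q G t)"
  by (intro const.subspace_inter graded_piece_subspace ideal_subspace is_ideal_gen)

lemma quotient_basis_graded_piece_exists:
  assumes "\<And>i. i \<le> n \<Longrightarrow> q i > 0" "const.subspace W"
  shows "\<exists>B. quotient_basis const (graded_piece n q t) W B"
proof -
  let ?M = "{m. keys m \<subseteq> {..n} \<and> int (wdegree q m) = t}"
  let ?g = "\<lambda>m. Poly_Mapping.single m 1 :: poly_cox"
  have inj: "inj_on ?g ?M" by (rule inj_onI) (metis keys_single one_neq_zero singleton_inject)
  show ?thesis
  proof (rule const.quotient_basis_exists[OF graded_piece_subspace assms(2), of "?g ` ?M"])
    show "finite (?g ` ?M)" using finite_monomials[of n q t] assms(1) by blast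
    show "?g ` ?M \<subseteq> graded_piece n q t" by (auto simp: graded_piece_iff)
    fix v assume "v \<in> graded_piece n q t"
    from graded_piece_spanned[OF this assms(1)]
    have "v - (\<Sum>b\<in>?g ` ?M. const (lookup v (the_inv_into ?M ?g b)) * b) = 0"
      by (subst sum.reindex[OF inj]) (simp add: the_inv_into_f_f[OF inj])
    then show "\<exists>c. v - (\<Sum>b\<in>?g ` ?M. const (c b) * b) \<in> W"
      using const.subspace_0[OF assms(2)] by (intro exI[of _ "\<lambda>b. lookup v (the_inv_into ?M ?g b)"]) simp
  qed
qed

lemma (in complex_algebra) quotient_basis_card_unique:
  assumes "subspace V" "subspace W" "quotient_basis \<iota> V W B" "quotient_basis \<iota> V W B'"
  shows "card B = card B'"
  using assms quotient_basis_card_le by (meson antisym)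

text \<open>With A the ideal of the earlier forms, \<open>reg\<close> makes multiplication by
  \<open>F k\<close> injective from S/A in degree \<open>t - D k\<close> to S/A in degree
  \<open>t\<close>, and the cokernel is the quotient by one more form.\<close>

lemma hilbert_function_step:
  assumes q: "\<And>i. i \<le> n \<Longrightarrow> q i > 0"
    and F: "\<And>i. i \<le> k \<Longrightarrow> F i \<in> graded_piece n q (D i)"
    and reg: "\<And>g. g \<in> graded_piece n q (t - D k) \<Longrightarrow> F k * g \<in> gen (F ` {..<k}) \<Longrightarrow> g \<in> gen (F ` {..<k})"
    and B: "quotient_basis const (graded_piece n q t) (graded_gen n q (F ` {..<k}) t) B"
    and B': "quotient_basis const (graded_piece n q t) (graded_gen n q (F ` {..<Suc k}) t) B'"
    and C: "quotient_basis const (graded_piece n q (t - D k)) (graded_gen n q (F ` {..<k}) (t - D k)) C"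
  shows "card B = card B' + card C"
proof -
  let ?S = "graded_piece n q" and ?V = "graded_gen n q (F ` {..<Suc k}) t" and ?W = "graded_gen n q (F ` {..<k}) t"
  have "F ` {..<k} \<subseteq> F ` {..<Suc k}" by auto
  then have sub: "?W \<subseteq> ?V" using gen_mono by blast
  have Fk: "F k * v \<in> ?V" if "v \<in> ?S (t - D k)" for v
  proof -
    have "F k \<in> gen (F ` {..<Suc k})" by (rule subsetD[OF gen_superset]) auto
    then show ?thesis
      using graded_piece_mult[OF F[of k] that] ideal_mult_right[OF is_ideal_gen, of "F k" "F ` {..<Suc k}" v]
      by simp
  qed
  have onto: "\<exists>v\<in>?S (t - D k). F k * v - u \<in> ?W" if u: "u \<in> ?V" for u
  proof -
    obtain c where c: "\<And>i. c i \<in> ?S (t - D i)" "u = (\<Sum>i<Suc k. c i * F i)"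
      using graded_gen_coefficients[of "{..<Suc k}" F n q D u t] F u by auto
    have "F k * c k - u = - (\<Sum>i<k. c i * F i)" unfolding c(2) by (simp add: mult.commute)
    moreover have "c i * F i \<in> ?W" if "i < k" for i
    proof
      show "c i * F i \<in> ?S t" using graded_piece_mult[OF c(1)[of i] F[of i]] that by simp
      show "c i * F i \<in> gen (F ` {..<k})" using that by (intro ideal_mult is_ideal_gen subsetD[OF gen_superset]) auto
    qed
    then have "- (\<Sum>i<k. c i * F i) \<in> ?W"
      by (intro const.subspace_neg const.subspace_sum graded_gen_subspace) auto
    ultimately show ?thesis using c(1) by (intro bexI[of _ "c k"]) auto
  qed
  have "\<exists>A. quotient_basis const ?V ?W A"
  proof (rule const.quotient_basis_exists[OF graded_gen_subspace graded_gen_subspace, of "(*) (F k) ` C"])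
    note C = C[unfolded const.quotient_basis_iff[OF graded_piece_subspace graded_gen_subspace]]
    show "finite ((*) (F k) ` C)" "(*) (F k) ` C \<subseteq> ?V" using C Fk by auto
    fix u assume "u \<in> ?V"
    then obtain v where v: "v \<in> ?S (t - D k)" "F k * v - u \<in> ?W" using onto by blast
    obtain c where c: "v - (\<Sum>b\<in>C. const (c b) * b) \<in> graded_gen n q (F ` {..<k}) (t - D k)"
      using C v(1) by blast
    have "F k * (v - (\<Sum>b\<in>C. const (c b) * b)) \<in> ?W"
      using c graded_piece_mult[OF F[of k], of "v - (\<Sum>b\<in>C. const (c b) * b)" "t - D k"] ideal_mult[OF is_ideal_gen] by auto
    from const.subspace_diff[OF graded_gen_subspace this v(2)]
    have w: "u - (\<Sum>b\<in>C. const (c b) * (F k * b)) \<in> ?W"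
      by (simp add: algebra_simps sum_distrib_left)
    show "\<exists>c. u - (\<Sum>a\<in>(*) (F k) ` C. const (c a) * a) \<in> ?W"
    proof (cases "F k = 0")
      \<comment> \<open>All images of \<open>C\<close> collapse to 0, but then \<open>u\<close>
        itself already lies in the smaller space.\<close>
      case True
      then show ?thesis using w by (intro exI[of _ "\<lambda>_. 0"]) simp
    next
      case False
      then have inj: "inj_on ((*) (F k)) C" by (auto intro: inj_onI)
      show ?thesis
        using w by (intro exI[of _ "\<lambda>a. c (the_inv_into C ((*) (F k)) a)"])
          (simp add: sum.reindex[OF inj] the_inv_into_f_f[OF inj])
    qed
  qed
  then obtain A where A: "quotient_basis const ?V ?W A" ..
  \<comment> \<open>A product over one index: multiplication by \<open>F k\<close> is an isomorphism
    onto \<open>?V\<close> modulo \<open>?W\<close>, injective by \<open>reg\<close> and surjective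
    by \<open>onto\<close>.\<close>
  have "\<exists>E. quotient_basis const (?S (t - D k)) (graded_gen n q (F ` {..<k}) (t - D k)) E \<and>
      card E = (\<Sum>z\<in>{()}. card A)"
  proof (rule quotient_basis_product[where V' = "\<lambda>_. ?V" and W' = "\<lambda>_. ?W" and \<phi> = "(*) (F k)"])
    show "v \<in> graded_gen n q (F ` {..<k}) (t - D k) \<longleftrightarrow> (\<forall>z\<in>{()}. F k * v \<in> ?W)"
      if v: "v \<in> ?S (t - D k)" for v
      using v reg[OF v] Fk[OF v] ideal_mult[OF is_ideal_gen] by auto
    show "\<exists>v\<in>?S (t - D k). \<forall>z\<in>{()}. F k * v - u z \<in> ?W" if "\<And>z. z \<in> {()} \<Longrightarrow> u z \<in> ?V" for u
      using onto[of "u ()"] that by simp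
  qed (use A Fk in \<open>auto simp: graded_piece_subspace graded_gen_subspace const.complex_algebra_axioms distrib_left mult.left_commute\<close>)
  then obtain E where E: "quotient_basis const (?S (t - D k)) (graded_gen n q (F ` {..<k}) (t - D k)) E" "card E = card A"
    by auto
  then have "card C = card A"
    using const.quotient_basis_card_unique[OF graded_piece_subspace graded_gen_subspace C E(1)] by simp
  moreover obtain E' where E': "quotient_basis const (?S t) ?W E'" "card E' = card B' + card A"
    using const.quotient_basis_tower[OF graded_piece_subspace graded_gen_subspace graded_gen_subspace sub _ B' A]
    by auto
  moreover have "card B = card E'"
    by (rule const.quotient_basis_card_unique[OF graded_piece_subspace graded_gen_subspace B E'(1)])
  ultimately show ?thesis by simp
qed

text \<open>Both families are regular in the given order, so their dimensions obey the same
  recursion in the number of forms. The induction covers all degrees \<open>t\<close> at once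
  because the recursion also refers to degree \<open>t - D k\<close>.\<close>

lemma hilbert_functions_agree:
  assumes q: "\<And>i. i \<le> n \<Longrightarrow> q i > 0"
    and F: "\<And>i. i \<le> n \<Longrightarrow> F i \<in> graded_piece n q (int (D i))" "only_trivial_zero n F"
    and G: "\<And>i. i \<le> n \<Longrightarrow> G i \<in> graded_piece n q (int (D i))" "only_trivial_zero n G"
    and D: "\<And>i. i \<le> n \<Longrightarrow> D i > 0" and k: "k \<le> Suc n"
    and B: "quotient_basis const (graded_piece n q t) (graded_gen n q (F ` {..<k}) t) B"
    and C: "quotient_basis const (graded_piece n q t) (graded_gen n q (G ` {..<k}) t) C"
  shows "card B = card C"
  using k B C
proof (induction k arbitrary: t B C)
  case 0
  have "quotient_basis const (graded_piece n q t) (graded_gen n q (F ` {..<0}) t) C"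
    using 0(3) by simp
  then show ?case
    by (rule const.quotient_basis_card_unique[OF graded_piece_subspace graded_gen_subspace 0(2)])
next
  case (Suc k)
  then have k: "k \<le> n" by simp
  have ex: "\<exists>B. quotient_basis const (graded_piece n q t) (graded_gen n q A t) B" for A t
    by (rule quotient_basis_graded_piece_exists[OF q graded_gen_subspace])
  obtain B1 where B1: "quotient_basis const (graded_piece n q t) (graded_gen n q (F ` {..<k}) t) B1"
    using ex by blast
  obtain C1 where C1: "quotient_basis const (graded_piece n q t) (graded_gen n q (G ` {..<k}) t) C1"
    using ex by blast
  let ?t = "t - int (D k)"
  obtain B2 where B2: "quotient_basis const (graded_piece n q ?t) (graded_gen n q (F ` {..<k}) ?t) B2"
    using ex by blast
  obtain C2 where C2: "quotient_basis const (graded_piece n q ?t) (graded_gen n q (G ` {..<k}) ?t) C2"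
    using ex by blast
  have "card B1 = card B + card B2"
    by (rule hilbert_function_step[where D = "\<lambda>i. int (D i)", OF q _ _ B1 Suc.prems(2) B2])
       (use F D k regular_sequence_of_only_trivial_zero[of n F q D k] in auto)
  moreover have "card C1 = card C + card C2"
    by (rule hilbert_function_step[where D = "\<lambda>i. int (D i)", OF q _ _ C1 Suc.prems(3) C2])
       (use G D k regular_sequence_of_only_trivial_zero[of n G q D k] in auto)
  moreover have "card B1 = card C1" "card B2 = card C2"
    using Suc.IH[OF _ B1 C1] Suc.IH[OF _ B2 C2] k by auto
  ultimately show ?case by simp
qed

text \<open>Compare with the powers of the variables of the same degrees: a monomial m outside their
  ideal satisfies q_i m_i <= D_i - q_i for every i, so its degree does not exceed the bound.\<close>

theorem graded_piece_subset_gen_of_only_trivial_zero: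
  assumes q: "\<And>i. i \<le> n \<Longrightarrow> q i > 0"
    and F: "\<And>i. i \<le> n \<Longrightarrow> F i \<in> graded_piece n q (int (D i))" "only_trivial_zero n F"
    and D: "\<And>i. i \<le> n \<Longrightarrow> D i > 0" "\<And>i. i \<le> n \<Longrightarrow> q i dvd D i"
    and t: "t > (\<Sum>i\<le>n. int (D i)) - (\<Sum>i\<le>n. int (q i))"
  shows "graded_piece n q t \<subseteq> gen (F ` {..n})"
proof -
  define e where "e i = D i div q i" for i
  have e: "q i * e i = D i" "e i > 0" if "i \<le> n" for i
    using D[OF that] by (auto simp: e_def intro: dvd_pos_nat elim!: dvdE)
  let ?G = "\<lambda>i. var i ^ e i"
  have G: "?G i \<in> graded_piece n q (int (D i))" if "i \<le> n" for i
    using graded_piece_power[OF graded_piece_var[OF that, of q], of "e i"] e(1)[OF that]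
    by (simp add: mult.commute flip: of_nat_mult)
  have G0: "only_trivial_zero n ?G"
    unfolding only_trivial_zero_def using e(2) by (auto simp: peval_power)
  have "graded_piece n q t \<subseteq> gen (?G ` {..n})"
  proof
    fix f assume f: "f \<in> graded_piece n q t"
    show "f \<in> gen (?G ` {..n})"
      unfolding gen_var_powers_iff[OF finite_atMost]
    proof (rule ballI, rule ccontr)
      fix m assume m: "m \<in> keys f" "\<not> (\<exists>i\<in>{..n}. e i \<le> lookup m i)"
      have km: "keys m \<subseteq> {..n}" "int (wdegree q m) = t" using f m(1) by (auto simp: graded_piece_iff)
      have "int (q i) * int (lookup m i) \<le> int (D i) - int (q i)" if "i \<le> n" for i
      proof -
        have "\<not> e i \<le> lookup m i" using m(2) that by blast
        then have "int (lookup m i) \<le> int (e i) - 1" by simp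
        then have "int (q i) * int (lookup m i) \<le> int (q i) * (int (e i) - 1)"
          by (intro mult_left_mono) auto
        also have "\<dots> = int (q i * e i) - int (q i)" by (simp add: algebra_simps)
        finally show ?thesis using e(1)[OF that] by simp
      qed
      then have "(\<Sum>i\<le>n. int (q i) * int (lookup m i)) \<le> (\<Sum>i\<le>n. int (D i) - int (q i))"
        by (intro sum_mono) auto
      moreover have "int (wdegree q m) = (\<Sum>i\<le>n. int (q i) * int (lookup m i))"
        using km(1) by (simp add: wdegree_superset[of "{..n}"])
      ultimately show False using t km(2) by (simp add: sum_subtractf)
    qed
  qed
  then have Geq: "graded_gen n q (?G ` {..<Suc n}) t = graded_piece n q t"
    by (auto simp: lessThan_Suc_atMost)
  have ex: "\<exists>B. quotient_basis const (graded_piece n q t) (graded_gen n q A t) B" for A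
    by (rule quotient_basis_graded_piece_exists[OF q graded_gen_subspace])
  obtain B where B: "quotient_basis const (graded_piece n q t) (graded_gen n q (F ` {..<Suc n}) t) B"
    using ex by blast
  obtain C where C: "quotient_basis const (graded_piece n q t) (graded_gen n q (?G ` {..<Suc n}) t) C"
    using ex by blast
  note B' = B[unfolded const.quotient_basis_iff[OF graded_piece_subspace graded_gen_subspace]]
  note C' = C[unfolded const.quotient_basis_iff[OF graded_piece_subspace graded_gen_subspace]]
  \<comment> \<open>The quotient is zero, so even the sum of all basis vectors is a relation;
    independence then leaves no basis vector at all.\<close>
  have "(\<Sum>b\<in>C. const 1 * b) \<in> graded_gen n q (?G ` {..<Suc n}) t"
    unfolding Geq using C' by (intro const.subspace_lincomb[OF graded_piece_subspace]) auto
  then have "\<forall>b\<in>C. (1::complex) = 0" using C' by meson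
  then have "C = {}" by auto
  moreover have "card B = card C"
    by (rule hilbert_functions_agree[OF q F G G0 D(1) _ B C]) auto
  ultimately have "B = {}" using B' by simp
  then show ?thesis using B' by (auto simp: lessThan_Suc_atMost)
qed


section \<open>Points of the weighted projective space\<close>

lemma ring_cox_ring: "ring (cox_ring n)"
  using cox_ring_cring by (rule cring.axioms(1))

lemma carrier_add: "f \<in> carrier (cox_ring n) \<Longrightarrow> g \<in> carrier (cox_ring n) \<Longrightarrow> f + g \<in> carrier (cox_ring n)"
  using ring.ring_simprules(1)[OF ring_cox_ring, of f n g] by simp

lemma carrier_mult: "f \<in> carrier (cox_ring n) \<Longrightarrow> g \<in> carrier (cox_ring n) \<Longrightarrow> f * g \<in> carrier (cox_ring n)"
  using ring.ring_simprules(5)[OF ring_cox_ring, of f n g] by simp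

lemma carrier_const: "const c \<in> carrier (cox_ring n)"
  using graded_piece_const by (rule graded_piece_carrier)

lemma carrier_var: "i \<le> n \<Longrightarrow> var i \<in> carrier (cox_ring n)"
  using var_power_carrier[of i n 1] by simp

lemma carrier_diff: "f \<in> carrier (cox_ring n) \<Longrightarrow> g \<in> carrier (cox_ring n) \<Longrightarrow> f - g \<in> carrier (cox_ring n)"
  using carrier_add[of f n "const (- 1) * g"] carrier_mult[OF carrier_const, of g n "- 1"]
    const.iota_diff[of 0 1] by simp

lemma carrier_prod: "(\<And>x. x \<in> A \<Longrightarrow> g x \<in> carrier (cox_ring n)) \<Longrightarrow> prod g A \<in> carrier (cox_ring n)"
  by (induction A rule: infinite_finite_induct)
     (simp_all add: carrier_mult carrier_const[of 1, simplified])

lemma ideal_gen_carrier: "Ideal.ideal (gen G \<inter> carrier (cox_ring n)) (cox_ring n)"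
proof (rule idealI[OF ring_cox_ring])
  interpret ring "cox_ring n" by (rule ring_cox_ring)
  show "subgroup (gen G \<inter> carrier (cox_ring n)) (add_monoid (cox_ring n))"
  proof (rule add.subgroupI)
    show "gen G \<inter> carrier (cox_ring n) \<noteq> {}"
      using zero_closed ideal_0[OF is_ideal_gen, of G] by auto
    fix a assume a: "a \<in> gen G \<inter> carrier (cox_ring n)"
    then have "\<ominus>\<^bsub>cox_ring n\<^esub> a + a = 0" using l_neg[of a] by simp
    then have "\<ominus>\<^bsub>cox_ring n\<^esub> a = - a" by (simp add: eq_neg_iff_add_eq_0)
    moreover have "- a \<in> gen G" using a by (intro ideal_neg is_ideal_gen) simp
    ultimately show "\<ominus>\<^bsub>cox_ring n\<^esub> a \<in> gen G \<inter> carrier (cox_ring n)"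
      using a a_inv_closed[of a] by simp
  next
    fix a b assume "a \<in> gen G \<inter> carrier (cox_ring n)" "b \<in> gen G \<inter> carrier (cox_ring n)"
    then show "a \<oplus>\<^bsub>cox_ring n\<^esub> b \<in> gen G \<inter> carrier (cox_ring n)"
      using ideal_add[OF is_ideal_gen, of a G b] by (simp add: carrier_add)
  qed auto
qed (auto simp: carrier_mult intro: ideal_mult ideal_mult_right is_ideal_gen)

lemma genideal_subset_gen: "G \<subseteq> carrier (cox_ring n) \<Longrightarrow> Idl\<^bsub>cox_ring n\<^esub> G \<subseteq> gen G"
  using ring.genideal_minimal[OF ring_cox_ring ideal_gen_carrier, of G G n] gen_superset[of G] by auto

lemma genideal_superset: "G \<subseteq> carrier (cox_ring n) \<Longrightarrow> G \<subseteq> Idl\<^bsub>cox_ring n\<^esub> G"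
  by (rule ring.genideal_self[OF ring_cox_ring])

text \<open>In each degree the coefficients may be chosen homogeneous and inside the Cox ring, so
  that generating in finitely or infinitely many variables gives the same graded pieces.\<close>

lemma graded_piece_genideal:
  assumes K: "finite K" and F: "\<And>i. i \<in> K \<Longrightarrow> F i \<in> graded_piece n q (D i)"
  shows "Idl\<^bsub>cox_ring n\<^esub> (F ` K) \<inter> graded_piece n q t = graded_gen n q (F ` K) t"
proof -
  have FK: "F ` K \<subseteq> carrier (cox_ring n)" using F graded_piece_carrier by blast
  let ?I = "Idl\<^bsub>cox_ring n\<^esub> (F ` K)"
  have idl: "Ideal.ideal ?I (cox_ring n)" by (rule ring.genideal_ideal[OF ring_cox_ring FK])
  note sg = ideal.axioms(1)[OF idl]
  have "g \<in> ?I" if g: "g \<in> graded_gen n q (F ` K) t" for g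
  proof -
    obtain c where c: "\<And>i. c i \<in> graded_piece n q (t - D i)" "g = (\<Sum>i\<in>K. c i * F i)"
      using graded_gen_coefficients[where F = F and D = D, OF K F, of g t] g by auto
    have "(\<Sum>i\<in>A. c i * F i) \<in> ?I" if "finite A" "A \<subseteq> K" for A
      using that
    proof (induction A rule: finite_induct)
      case empty
      show ?case using additive_subgroup.zero_closed[OF sg] by simp
    next
      case (insert i A)
      have "F i \<in> ?I" using genideal_superset[OF FK] insert.prems by blast
      then have "c i * F i \<in> ?I"
        using ideal.I_l_closed[OF idl, of "F i" "c i"] graded_piece_carrier[OF c(1)] by simp
      then have "c i * F i + (\<Sum>i\<in>A. c i * F i) \<in> ?I"
        using additive_subgroup.a_closed[OF sg, of "c i * F i" "\<Sum>i\<in>A. c i * F i"] insert by simp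
      then show ?case using insert by simp
    qed
    then show ?thesis using K c(2) by blast
  qed
  then show ?thesis using genideal_subset_gen[OF FK] by blast
qed

section \<open>Orbits and the vanishing of forms\<close>

lemma orbit_rel_equiv: "equiv (punctured_space n) (orbit_rel n q)"
proof (rule equivI)
  show "orbit_rel n q \<subseteq> punctured_space n \<times> punctured_space n" by (auto simp: orbit_rel_def)
  show "refl_on (punctured_space n) (orbit_rel n q)"
    by (auto simp: refl_on_def orbit_rel_def intro: exI[of _ 1])
  show "sym (orbit_rel n q)"
  proof (rule symI)
    fix z w assume "(z, w) \<in> orbit_rel n q"
    then obtain t where t: "z \<in> punctured_space n" "w \<in> punctured_space n" "t \<noteq> 0"
      "\<forall>i\<le>n. w i = t ^ q i * z i" by (auto simp: orbit_rel_def)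
    then have "\<forall>i\<le>n. z i = inverse t ^ q i * w i" by (simp add: power_inverse)
    then show "(w, z) \<in> orbit_rel n q" using t by (auto simp: orbit_rel_def intro: exI[of _ "inverse t"])
  qed
  show "trans (orbit_rel n q)"
  proof (rule transI)
    fix x y z assume "(x, y) \<in> orbit_rel n q" "(y, z) \<in> orbit_rel n q"
    then obtain s t where st: "x \<in> punctured_space n" "z \<in> punctured_space n" "s \<noteq> 0" "t \<noteq> 0"
      "\<forall>i\<le>n. y i = s ^ q i * x i" "\<forall>i\<le>n. z i = t ^ q i * y i" by (auto simp: orbit_rel_def)
    then have "\<forall>i\<le>n. z i = (t * s) ^ q i * x i" by (simp add: power_mult_distrib)
    then show "(x, z) \<in> orbit_rel n q" using st by (auto simp: orbit_rel_def intro: exI[of _ "t * s"])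
  qed
qed

abbreviation orbit :: "nat \<Rightarrow> (nat \<Rightarrow> nat) \<Rightarrow> (nat \<Rightarrow> complex) \<Rightarrow> (nat \<Rightarrow> complex) set" where
  "orbit n q z \<equiv> orbit_rel n q `` {z}"

lemma orbit_in_wproj: "z \<in> punctured_space n \<Longrightarrow> orbit n q z \<in> wproj n q"
  unfolding wproj_def by (rule quotientI)

lemma orbit_self: "z \<in> punctured_space n \<Longrightarrow> z \<in> orbit n q z"
  by (rule equiv_class_self[OF orbit_rel_equiv])

lemma wproj_cases:
  assumes "\<zeta> \<in> wproj n q"
  obtains z where "z \<in> punctured_space n" "\<zeta> = orbit n q z"
  using assms unfolding wproj_def by (rule quotientE) blast

lemma orbit_eq_iff:
  "z \<in> punctured_space n \<Longrightarrow> w \<in> punctured_space n \<Longrightarrow> orbit n q z = orbit n q w \<longleftrightarrow> (z, w) \<in> orbit_rel n q"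
  by (rule eq_equiv_class_iff[OF orbit_rel_equiv])

lemma peval_orbit_rel:
  assumes f: "f \<in> graded_piece n q \<alpha>" and zw: "(z, w) \<in> orbit_rel n q"
  shows "peval w f = 0 \<longleftrightarrow> peval z f = 0"
proof (cases "\<alpha> < 0")
  case True
  then show ?thesis using graded_piece_negative[OF f] by simp
next
  case False
  then have f': "f \<in> graded_piece n q (int (nat \<alpha>))" using f by simp
  obtain t where t: "t \<noteq> 0" "\<And>i. i \<le> n \<Longrightarrow> w i = t ^ q i * z i" using zw by (auto simp: orbit_rel_def)
  from peval_weighted[OF f' t(2)] show ?thesis using t(1) by simp
qed

lemma vanishes_at_orbit:
  assumes "f \<in> graded_piece n q \<alpha>" "z \<in> punctured_space n"
  shows "vanishes_at f (orbit n q z) \<longleftrightarrow> peval z f = 0"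
  unfolding vanishes_at_def using peval_orbit_rel[OF assms(1)] orbit_self[OF assms(2)] by auto

lemma vanishes_at_mult:
  assumes "f \<in> graded_piece n q \<alpha>" "g \<in> graded_piece n q \<beta>" "\<zeta> \<in> wproj n q"
  shows "vanishes_at (f * g) \<zeta> \<longleftrightarrow> vanishes_at f \<zeta> \<or> vanishes_at g \<zeta>"
proof -
  obtain z where z: "z \<in> punctured_space n" "\<zeta> = orbit n q z" using assms(3) by (rule wproj_cases)
  show ?thesis unfolding z(2)
    using vanishes_at_orbit[OF assms(1) z(1)] vanishes_at_orbit[OF assms(2) z(1)]
      vanishes_at_orbit[OF graded_piece_mult[OF assms(1,2)] z(1)] by (simp add: peval_mult)
qed

lemma vanishes_at_power:
  assumes "f \<in> graded_piece n q \<alpha>" "\<zeta> \<in> wproj n q" "k > 0"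
  shows "vanishes_at (f ^ k) \<zeta> \<longleftrightarrow> vanishes_at f \<zeta>"
proof -
  obtain z where z: "z \<in> punctured_space n" "\<zeta> = orbit n q z" using assms(2) by (rule wproj_cases)
  show ?thesis unfolding z(2)
    using vanishes_at_orbit[OF assms(1) z(1)] vanishes_at_orbit[OF graded_piece_power[OF assms(1)] z(1)] assms(3)
    by (simp add: peval_power)
qed

lemma not_vanishes_at_1: "\<zeta> \<in> wproj n q \<Longrightarrow> \<not> vanishes_at 1 \<zeta>"
  by (erule wproj_cases) (use orbit_self in \<open>auto simp: vanishes_at_def\<close>)

lemma not_vanishes_at_power: "f \<in> graded_piece n q \<alpha> \<Longrightarrow> \<zeta> \<in> wproj n q \<Longrightarrow> \<not> vanishes_at f \<zeta> \<Longrightarrow>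
    \<not> vanishes_at (f ^ k) \<zeta>"
  using vanishes_at_power[of f n q \<alpha> \<zeta> k] not_vanishes_at_1[of \<zeta> n q] by (cases "k = 0") auto

lemma vanishes_at_gen:
  assumes "\<And>g. g \<in> G \<Longrightarrow> vanishes_at g \<zeta>" "f \<in> gen G"
  shows "vanishes_at f \<zeta>"
proof -
  have "is_ideal {f. vanishes_at f \<zeta>}"
    by (auto simp: is_ideal_def vanishes_at_def peval_add peval_mult)
  from gen_least[OF this, of G] assms show ?thesis by blast
qed

lemma Var_genideal:
  assumes "G \<subseteq> carrier (cox_ring n)"
  shows "Var n q (Idl\<^bsub>cox_ring n\<^esub> G) = {\<zeta> \<in> wproj n q. \<forall>g\<in>G. vanishes_at g \<zeta>}"
  using genideal_superset[OF assms] genideal_subset_gen[OF assms] vanishes_at_gen[of G]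
  unfolding Var_def by blast

section \<open>Separating points by forms\<close>

lemma complex_root_exists:
  assumes "k > 0"
  shows "\<exists>s :: complex. s ^ k = c"
proof (cases "c = 0")
  case False
  have "1 \<in> {z :: complex. z ^ k = 1}" by simp
  with bij_betw_nth_root_unity[OF False assms] show ?thesis unfolding bij_betw_def by blast
qed (use assms in auto)

lemma normalize_coordinate:
  assumes z: "z \<in> punctured_space n" and i: "i \<le> n" "q i > 0" "z i \<noteq> 0"
  shows "\<exists>w. w \<in> punctured_space n \<and> (z, w) \<in> orbit_rel n q \<and> w i = 1"
proof -
  obtain s where s: "s ^ q i = inverse (z i)" using complex_root_exists[OF i(2)] by blast
  then have s0: "s \<noteq> 0" using i by (auto simp: power_0_left)
  define w where "w j = (if j \<le> n then s ^ q j * z j else 0)" for j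
  have wi: "w i = 1" using i s by (simp add: w_def)
  have "w \<in> punctured_space n"
  proof -
    have "\<forall>j>n. w j = 0" by (simp add: w_def)
    then show ?thesis using wi i(1) by (auto simp: punctured_space_def intro!: exI[of _ i])
  qed
  moreover have "(z, w) \<in> orbit_rel n q"
    unfolding orbit_rel_def using z calculation s0 by (auto simp: w_def intro!: exI[of _ s])
  ultimately show ?thesis using wi by blast
qed

text \<open>Decompose a polynomial vanishing on the orbit of \<open>w\<close> under the roots of unity of order \<open>q i\<close>,
  but not at \<open>z\<close>, by the residue of the weight modulo \<open>q i\<close>: every component vanishes at \<open>w\<close>, and
  powers of \<open>x\<^sub>i\<close> make it homogeneous.\<close>

lemma separating_form_normalized:
  assumes i: "i \<le> n" "q i > 0" and zw: "z i = 1" "w i = 1"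
    and ne: "\<And>t. t ^ q i = 1 \<Longrightarrow> \<exists>j\<le>n. z j \<noteq> t ^ q j * w j"
  shows "\<exists>d f. f \<in> graded_piece n q d \<and> peval w f = 0 \<and> peval z f \<noteq> 0"
proof -
  define Q where "Q = q i"
  define R where "R = {t :: complex. t ^ Q = 1}"
  have Q: "Q > 0" using i by (simp add: Q_def)
  have cardR: "card R = Q" "finite R"
    using card_roots_unity_eq[OF Q] finite_roots_unity[of Q] Q by (auto simp: R_def)
  have "\<forall>t\<in>R. \<exists>j. j \<le> n \<and> z j \<noteq> t ^ q j * w j"
    using ne by (simp add: R_def Q_def)
  from bchoice[OF this] obtain j where j: "\<And>t. t \<in> R \<Longrightarrow> j t \<le> n \<and> z (j t) \<noteq> t ^ q (j t) * w (j t)"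
    by blast
  \<comment> \<open>One factor for each root of unity \<open>t\<close>, vanishing at the translate
    of \<open>w\<close> by \<open>t\<close> but not at \<open>z\<close>.\<close>
  define F where "F = (\<Prod>t\<in>R. var (j t) - const (t ^ q (j t) * w (j t)))"
  have Fc: "F \<in> carrier (cox_ring n)"
    unfolding F_def using j by (intro carrier_prod carrier_diff carrier_const carrier_var) auto
  have Fz: "peval z F \<noteq> 0"
    using j cardR by (simp add: F_def peval_prod peval_diff)
  have Fw: "peval (\<lambda>j. t ^ q j * w j) F = 0" if "t \<in> R" for t
    using that cardR by (auto simp: F_def peval_prod peval_diff)
  define F' where "F' r = filter_keys (\<lambda>m. wdegree q m mod Q = r) F" for r
  have split: "F = (\<Sum>r<Q. F' r)"
    by (rule poly_mapping_eqI) (simp add: F'_def lookup_sum lookup_filter_keys Q)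
  have F'c: "F' r \<in> carrier (cox_ring n)" for r
    using Fc by (auto simp: F'_def carrier_cox_ring keys_filter_keys)
  have scale: "peval (\<lambda>j. t ^ q j * w j) (F' r) = t ^ r * peval w (F' r)" if "t \<in> R" for t r
    unfolding peval_def meval_def[symmetric] sum_distrib_left
  proof (intro sum.cong refl)
    fix m assume m: "m \<in> keys (F' r)"
    then have m': "keys m \<subseteq> {..n}" "wdegree q m mod Q = r"
      using F'c by (auto simp: carrier_cox_ring F'_def keys_filter_keys)
    have "t ^ wdegree q m = t ^ (Q * (wdegree q m div Q) + wdegree q m mod Q)" by simp
    also have "\<dots> = t ^ r" unfolding power_add power_mult using that m'(2) by (simp add: R_def)
    finally have "t ^ wdegree q m = t ^ r" .
    then show "lookup (F' r) m * meval (\<lambda>j. t ^ q j * w j) m = t ^ r * (lookup (F' r) m * meval w m)"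
      using meval_weighted[of m n "\<lambda>j. t ^ q j * w j" t q w] m'(1) by simp
  qed
  \<comment> \<open>Its coefficients are the values of the components at \<open>w\<close>, and its
    value at a root of unity is that of \<open>F\<close> at the corresponding translate, hence 0.
    With \<open>Q\<close> roots and degree below \<open>Q\<close>, it vanishes.\<close>
  define P where "P = (\<Sum>r<Q. monom (peval w (F' r)) r)"
  have coeffP: "poly.coeff P r = (if r < Q then peval w (F' r) else 0)" for r
    by (simp add: P_def coeff_sum if_distrib[of "\<lambda>x. x = _"] cong: if_cong)
  have "P = 0"
  proof (rule ccontr)
    assume P: "P \<noteq> 0"
    have "R \<subseteq> {x. poly P x = 0}"
    proof clarify
      fix t assume t: "t \<in> R"
      have "poly P t = (\<Sum>r<Q. t ^ r * peval w (F' r))" by (simp add: P_def poly_sum poly_monom mult.commute)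
      also have "\<dots> = peval (\<lambda>j. t ^ q j * w j) (\<Sum>r<Q. F' r)" by (simp add: peval_sum scale[OF t])
      also have "\<dots> = 0" using Fw[OF t] split by simp
      finally show "poly P t = 0" .
    qed
    then have "Q \<le> card {x. poly P x = 0}"
      using card_mono[OF poly_roots_finite[OF P]] cardR by metis
    also have "\<dots> \<le> degree P" by (rule card_poly_roots_bound[OF P])
    finally have "Q \<le> degree P" .
    then have "poly.coeff P (degree P) = 0" by (simp add: coeffP)
    then show False using P by simp
  qed
  then have F'w: "peval w (F' r) = 0" if "r < Q" for r using coeffP[of r] that by simp
  have "\<exists>r<Q. peval z (F' r) \<noteq> 0"
    using Fz unfolding split peval_sum by (metis (no_types, lifting) lessThan_iff sum.neutral)
  then obtain r where r: "r < Q" "peval z (F' r) \<noteq> 0" by blast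
  \<comment> \<open>The weights of the monomials of one component agree modulo \<open>q i\<close>,
    so powers of x_i raise them all to the largest one. Values at \<open>z\<close> and
    \<open>w\<close> are unchanged, since both have i-th coordinate 1.\<close>
  define T where "T = Max (wdegree q ` keys (F' r))"
  define h where "h m = m + Poly_Mapping.single i ((T - wdegree q m) div Q)" for m
  define H where "H = (\<Sum>m\<in>keys (F' r). Poly_Mapping.single (h m) (lookup (F' r) m))"
  have kne: "keys (F' r) \<noteq> {}" using r(2) by auto
  have wd: "keys (h m) \<subseteq> {..n} \<and> wdegree q (h m) = T" if m: "m \<in> keys (F' r)" for m
  proof -
    have "T \<in> wdegree q ` keys (F' r)" unfolding T_def using kne by (intro Max_in) auto
    then have "T mod Q = r" by (auto simp: F'_def keys_filter_keys)
    moreover have "wdegree q m mod Q = r" using m by (auto simp: F'_def keys_filter_keys)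
    moreover have le: "wdegree q m \<le> T" using m by (auto simp: T_def)
    ultimately have "Q dvd T - wdegree q m" using mod_eq_dvd_iff_nat[of "wdegree q m" T Q] by simp
    then have "wdegree q (h m) = T" using le by (simp add: h_def wdegree_add flip: Q_def)
    moreover have "keys m \<subseteq> {..n}" using m F'c by (auto simp: carrier_cox_ring)
    ultimately show ?thesis using i(1) by (auto simp: h_def keys_add_nat)
  qed
  have "H \<in> graded_piece n q (int T)"
    unfolding H_def by (intro graded_piece_sum) (use wd in \<open>auto simp: graded_piece_iff\<close>)
  moreover have "peval y H = peval y (F' r)" if "y i = 1" for y
    using that unfolding H_def peval_sum peval_def[of y "F' r"] meval_def[symmetric]
    by (simp add: h_def meval_add)
  ultimately show ?thesis using F'w[OF r(1)] r(2) zw by metis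
qed

text \<open>For a coordinate with z_i \<noteq> 0, either w_i = 0 and \<open>var i\<close> separates,
  or both points can be moved within their orbits to x_i = 1. The scalars preserving this
  normalization are the roots of unity of order \<open>q i\<close>.\<close>

lemma separating_form:
  assumes q: "\<And>i. i \<le> n \<Longrightarrow> q i > 0"
    and z: "z \<in> punctured_space n" and w: "w \<in> punctured_space n" and ne: "(z, w) \<notin> orbit_rel n q"
  shows "\<exists>d f. f \<in> graded_piece n q d \<and> peval w f = 0 \<and> peval z f \<noteq> 0"
proof -
  obtain i where i: "i \<le> n" "z i \<noteq> 0" using z by (auto simp: punctured_space_def)
  show ?thesis
  proof (cases "w i = 0")
    case True
    then show ?thesis using graded_piece_var[OF i(1), of q] i(2)
      by (intro exI[of _ "int (q i)"] exI[of _ "var i"]) simp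
  next
    case False
    obtain z' where z': "z' \<in> punctured_space n" "(z, z') \<in> orbit_rel n q" "z' i = 1"
      using normalize_coordinate[where q = q, OF z i(1) q[OF i(1)] i(2)] by blast
    obtain w' where w': "w' \<in> punctured_space n" "(w, w') \<in> orbit_rel n q" "w' i = 1"
      using normalize_coordinate[where q = q, OF w i(1) q[OF i(1)] False] by blast
    have sym: "sym (orbit_rel n q)" and trans: "trans (orbit_rel n q)"
      using orbit_rel_equiv by (auto simp: equiv_def)
    have "(w', z') \<notin> orbit_rel n q"
    proof
      assume "(w', z') \<in> orbit_rel n q"
      then have "(w, z') \<in> orbit_rel n q" using w'(2) transD[OF trans] by blast
      then have "(z', w) \<in> orbit_rel n q" using symD[OF sym] by blast
      then show False using ne z'(2) transD[OF trans] by blast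
    qed
    then have "\<exists>j\<le>n. z' j \<noteq> t ^ q j * w' j" if "t ^ q i = 1" for t
    proof -
      have "t \<noteq> 0" using that q[OF i(1)] by (metis power_0_left not_gr_zero zero_neq_one)
      then show ?thesis using \<open>(w', z') \<notin> orbit_rel n q\<close> z'(1) w'(1) unfolding orbit_rel_def by blast
    qed
    then obtain d f where f: "f \<in> graded_piece n q d" "peval w' f = 0" "peval z' f \<noteq> 0"
      using separating_form_normalized[where q = q and z = z' and w = w', OF i(1) q[OF i(1)] z'(3) w'(3)] by blast
    then show ?thesis using peval_orbit_rel[OF f(1) z'(2)] peval_orbit_rel[OF f(1) w'(2)] by blast
  qed
qed


section \<open>Zero-dimensional closed subsets are finite\<close>

lemma homogeneous_carrier: "homogeneous n q f \<Longrightarrow> f \<in> carrier (cox_ring n)"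
  unfolding homogeneous_def using graded_piece_carrier by blast

text \<open>The forms vanishing at \<open>\<zeta>\<close> have no other common zero because forms
  separate orbits.\<close>

lemma irreducible_closed_point:
  assumes q: "\<And>i. i \<le> n \<Longrightarrow> q i > 0" and \<zeta>: "\<zeta> \<in> wproj n q"
  shows "irreducible_closed n q {\<zeta>}"
proof -
  let ?G = "{f. homogeneous n q f \<and> vanishes_at f \<zeta>}"
  have G: "?G \<subseteq> carrier (cox_ring n)" using homogeneous_carrier by blast
  obtain w where w: "w \<in> punctured_space n" "\<zeta> = orbit n q w" using \<zeta> by (rule wproj_cases)
  have "\<eta> = \<zeta>" if \<eta>: "\<eta> \<in> wproj n q" "\<forall>f\<in>?G. vanishes_at f \<eta>" for \<eta>
  proof (rule ccontr)
    assume ne: "\<eta> \<noteq> \<zeta>"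
    obtain z where z: "z \<in> punctured_space n" "\<eta> = orbit n q z" using \<eta>(1) by (rule wproj_cases)
    have "(z, w) \<notin> orbit_rel n q" using ne orbit_eq_iff[OF z(1) w(1)] z(2) w(2) by blast
    then obtain d f where f: "f \<in> graded_piece n q d" "peval w f = 0" "peval z f \<noteq> 0"
      using separating_form[where q = q, OF q z(1) w(1)] by blast
    then have "f \<in> ?G" using vanishes_at_orbit[OF f(1) w(1)] w(2) by (auto simp: homogeneous_def)
    then show False using \<eta>(2) vanishes_at_orbit[OF f(1) z(1)] z(2) f(3) by blast
  qed
  then have "Var n q (Idl\<^bsub>cox_ring n\<^esub> ?G) = {\<zeta>}"
    unfolding Var_genideal[OF G] using \<zeta> by blast
  then have "zariski_closed n q {\<zeta>}"
    unfolding zariski_closed_def homogeneous_ideal_def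
    by (intro exI[of _ "Idl\<^bsub>cox_ring n\<^esub> ?G"] conjI exI[of _ ?G] refl) auto
  then show ?thesis unfolding irreducible_closed_def by blast
qed

section \<open>Varieties of prime ideals and dimension\<close>

lemma prime_power_mem:
  assumes "is_ideal p" "\<forall>x y. x * y \<in> p \<longrightarrow> x \<in> p \<or> y \<in> p" "x ^ k \<in> p" "1 \<notin> p"
  shows "x \<in> p"
  using assms(3) by (induction k) (use assms(2,4) in auto)

text \<open>A Nullstellensatz for forms. An ideal \<open>p\<close> obtained from Zorn's lemma may be
  inhomogeneous, so the variety is cut out by its homogeneous elements \<open>G\<close>. The factor
  \<open>var i\<close> makes the product vanish at affine zeros outside the chart, the origin
  included, and primality removes it again.\<close>

lemma form_vanishing_on_prime_variety:
  fixes p :: "poly_cox set" and n :: nat and q :: "nat \<Rightarrow> nat"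
  defines "G \<equiv> {f. homogeneous n q f \<and> f \<in> p}"
  assumes p: "is_ideal p" "\<forall>x y. x * y \<in> p \<longrightarrow> x \<in> p \<or> y \<in> p" and i: "i \<le> n" "var i \<notin> p"
    and f: "f \<in> graded_piece n q \<alpha>"
    and vanish: "\<And>\<zeta>. \<zeta> \<in> Var n q (Idl\<^bsub>cox_ring n\<^esub> G) \<Longrightarrow> vanishes_at f \<zeta>"
  shows "f \<in> p"
proof -
  have G: "G \<subseteq> carrier (cox_ring n)" using homogeneous_carrier by (auto simp: G_def)
  have "\<exists>k. (var i * f) ^ k \<in> gen G"
  proof (rule nullstellensatz_radical[OF G])
    show "var i * f \<in> carrier (cox_ring n)"
      by (rule carrier_mult[OF carrier_var[OF i(1)] graded_piece_carrier[OF f]])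
    fix z assume z: "\<forall>i>n. z i = 0" "\<forall>g\<in>G. peval z g = 0"
    show "peval z (var i * f) = 0"
    proof (cases "z i = 0")
      case False
      then have zp: "z \<in> punctured_space n" using z(1) i(1) by (auto simp: punctured_space_def)
      have "orbit n q z \<in> Var n q (Idl\<^bsub>cox_ring n\<^esub> G)"
        unfolding Var_genideal[OF G]
      proof (intro CollectI conjI ballI orbit_in_wproj zp)
        fix g assume g: "g \<in> G"
        then obtain \<beta> where "g \<in> graded_piece n q \<beta>" by (auto simp: G_def homogeneous_def)
        then show "vanishes_at g (orbit n q z)" using vanishes_at_orbit zp z(2) g by blast
      qed
      then show ?thesis using vanish vanishes_at_orbit[OF f zp] by (simp add: peval_mult)
    qed (simp add: peval_mult)
  qed
  then obtain k where "(var i * f) ^ k \<in> gen G" ..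
  moreover have "gen G \<subseteq> p" by (rule gen_least[OF p(1)]) (auto simp: G_def)
  moreover have "1 \<notin> p" using ideal_mult[OF p(1), of 1 "var i"] i(2) by auto
  ultimately have "var i * f \<in> p" using prime_power_mem[OF p] by blast
  then show ?thesis using p(2) i(2) by blast
qed

text \<open>If both pieces were proper, each would have a form vanishing on it but not on the whole.
  The product of the two forms vanishes on the whole, so it lies in \<open>p\<close>, and so does
  one factor, which then vanishes everywhere. An empty variety would put \<open>var i\<close> into
  \<open>p\<close>.\<close>

lemma irreducible_closed_prime_variety:
  fixes p :: "poly_cox set" and n :: nat and q :: "nat \<Rightarrow> nat"
  defines "G \<equiv> {f. homogeneous n q f \<and> f \<in> p}"
  assumes p: "is_ideal p" "\<forall>x y. x * y \<in> p \<longrightarrow> x \<in> p \<or> y \<in> p" and i: "i \<le> n" "var i \<notin> p"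
  shows "irreducible_closed n q (Var n q (Idl\<^bsub>cox_ring n\<^esub> G))" (is "irreducible_closed n q ?Z")
proof -
  note mem = form_vanishing_on_prime_variety[where q = q and n = n and p = p, folded G_def, OF p i]
  have G: "G \<subseteq> carrier (cox_ring n)" using homogeneous_carrier by (auto simp: G_def)
  have closed: "zariski_closed n q ?Z"
    unfolding zariski_closed_def homogeneous_ideal_def
    by (intro exI[of _ "Idl\<^bsub>cox_ring n\<^esub> G"] conjI exI[of _ G] refl) (simp add: G_def)
  have ne: "?Z \<noteq> {}"
  proof
    assume Z: "?Z = {}"
    have "var i \<in> p" by (rule mem[OF graded_piece_var[OF i(1)]]) (simp add: Z)
    then show False using i(2) by simp
  qed
  have "?Z = Z1 \<or> ?Z = Z2"
    if Z: "zariski_closed n q Z1" "zariski_closed n q Z2" "?Z = Z1 \<union> Z2" for Z1 Z2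
  proof (rule ccontr)
    assume not: "\<not> ?thesis"
    have form: "\<exists>\<alpha> g \<zeta>. g \<in> graded_piece n q \<alpha> \<and> (\<forall>\<eta>\<in>A. vanishes_at g \<eta>) \<and> \<zeta> \<in> ?Z \<and> \<not> vanishes_at g \<zeta>"
      if A: "zariski_closed n q A" "A \<subseteq> ?Z" "A \<noteq> ?Z" for A
    proof -
      obtain H where H: "\<And>h. h \<in> H \<Longrightarrow> homogeneous n q h" "A = Var n q (Idl\<^bsub>cox_ring n\<^esub> H)"
        using A(1) unfolding zariski_closed_def homogeneous_ideal_def by blast
      have HA: "A = {\<zeta> \<in> wproj n q. \<forall>g\<in>H. vanishes_at g \<zeta>}"
        unfolding H(2) by (rule Var_genideal) (use H(1) homogeneous_carrier in blast)
      obtain \<zeta> where \<zeta>: "\<zeta> \<in> ?Z" "\<zeta> \<notin> A" using A by blast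
      then have "\<zeta> \<in> wproj n q" by (simp add: Var_def)
      then obtain g where g: "g \<in> H" "\<not> vanishes_at g \<zeta>" using \<zeta>(2) HA by blast
      moreover have "\<forall>\<eta>\<in>A. vanishes_at g \<eta>" using HA g(1) by blast
      ultimately show ?thesis using H(1)[OF g(1)] \<zeta>(1) unfolding homogeneous_def by blast
    qed
    obtain \<alpha> g \<zeta> where g: "g \<in> graded_piece n q \<alpha>" "\<forall>\<eta>\<in>Z1. vanishes_at g \<eta>" "\<zeta> \<in> ?Z" "\<not> vanishes_at g \<zeta>"
      using form[OF Z(1)] Z(3) not by blast
    obtain \<beta> h \<xi> where h: "h \<in> graded_piece n q \<beta>" "\<forall>\<eta>\<in>Z2. vanishes_at h \<eta>" "\<xi> \<in> ?Z" "\<not> vanishes_at h \<xi>"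
      using form[OF Z(2)] Z(3) not by blast
    have "vanishes_at (g * h) \<eta>" if \<eta>: "\<eta> \<in> ?Z" for \<eta>
    proof -
      have "\<eta> \<in> wproj n q" using \<eta> by (simp add: Var_def)
      then show ?thesis using vanishes_at_mult[OF g(1) h(1)] g(2) h(2) \<eta> Z(3) by blast
    qed
    then have "g * h \<in> p" by (rule mem[OF graded_piece_mult[OF g(1) h(1)]])
    then have "g \<in> G \<or> h \<in> G" using p(2) g(1) h(1) by (auto simp: G_def homogeneous_def)
    then show False using g(3,4) h(3,4) unfolding Var_genideal[OF G] by blast
  qed
  with closed ne show ?thesis unfolding irreducible_closed_def by blast
qed

lemma zariski_dim_ge_1:
  assumes "irreducible_closed n q Z1" "irreducible_closed n q Z2" "Z1 \<subset> Z2" "Z2 \<subseteq> Z"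
  shows "zariski_dim n q Z \<ge> 1"
proof -
  have "\<exists>C :: nat \<Rightarrow> _. (\<forall>i\<le>1. irreducible_closed n q (C i) \<and> C i \<subseteq> Z) \<and> (\<forall>i<1. C i \<subset> C (Suc i))"
    using assms by (intro exI[of _ "\<lambda>i. if i = 0 then Z1 else Z2"]) auto
  then have "ereal (real 1) \<le> zariski_dim n q Z"
    unfolding zariski_dim_def by (intro Sup_upper) blast
  then show ?thesis by (simp add: one_ereal_def)
qed

text \<open>If infinitely many points lie in a chart \<open>x\<^sub>i \<noteq> 0\<close>, normalized to \<open>x\<^sub>i = 1\<close>, then some
  coordinate \<open>x\<^sub>j\<close> takes infinitely many values on them. A prime ideal which contains \<open>I\<close> and avoids
  all polynomials whose zeros on these points have finitely many values of \<open>x\<^sub>j\<close> defines an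
  irreducible subset with more than one point.\<close>

lemma finite_Var_of_zariski_dim_0:
  assumes q: "\<And>i. i \<le> n \<Longrightarrow> q i > 0" and G: "\<And>g. g \<in> G \<Longrightarrow> homogeneous n q g"
    and dim: "zariski_dim n q (Var n q (Idl\<^bsub>cox_ring n\<^esub> G)) = 0"
  shows "finite (Var n q (Idl\<^bsub>cox_ring n\<^esub> G))" (is "finite ?V")
proof (rule ccontr)
  assume inf: "infinite ?V"
  have Gc: "G \<subseteq> carrier (cox_ring n)" using G homogeneous_carrier by blast
  have V: "?V = {\<zeta> \<in> wproj n q. \<forall>g\<in>G. vanishes_at g \<zeta>}" by (rule Var_genideal[OF Gc])
  define Y where "Y i = {z \<in> punctured_space n. z i = 1 \<and> orbit n q z \<in> ?V}" for i
  have "?V \<subseteq> (\<Union>i\<le>n. orbit n q ` Y i)"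
  proof
    fix \<zeta> assume \<zeta>: "\<zeta> \<in> ?V"
    then have "\<zeta> \<in> wproj n q" by (simp add: V)
    then obtain z where z: "z \<in> punctured_space n" "\<zeta> = orbit n q z" by (rule wproj_cases)
    obtain i where i: "i \<le> n" "z i \<noteq> 0" using z(1) by (auto simp: punctured_space_def)
    obtain w where w: "w \<in> punctured_space n" "(z, w) \<in> orbit_rel n q" "w i = 1"
      using normalize_coordinate[where q = q, OF z(1) i(1) q[OF i(1)] i(2)] by blast
    have "\<zeta> = orbit n q w" using orbit_eq_iff[OF z(1) w(1)] w(2) z(2) by blast
    then show "\<zeta> \<in> (\<Union>i\<le>n. orbit n q ` Y i)" using w \<zeta> i(1) by (auto simp: Y_def)
  qed
  then have "\<exists>i\<le>n. infinite (Y i)"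
    using inf finite_subset by (metis (no_types, lifting) atMost_iff finite_UN finite_atMost finite_imageI)
  then obtain i where i: "i \<le> n" "infinite (Y i)" by blast
  have "\<exists>j\<le>n. infinite ((\<lambda>z. z j) ` Y i)"
  proof (rule ccontr)
    assume "\<not> ?thesis"
    then have "finite ({..n} \<rightarrow>\<^sub>E (\<Union>j\<le>n. (\<lambda>z. z j) ` Y i))" by (intro finite_PiE) auto
    moreover have "(\<lambda>z. restrict z {..n}) ` Y i \<subseteq> {..n} \<rightarrow>\<^sub>E (\<Union>j\<le>n. (\<lambda>z. z j) ` Y i)"
      by (auto simp: PiE_def)
    ultimately have "finite ((\<lambda>z. restrict z {..n}) ` Y i)" by (rule finite_subset[rotated])
    moreover have "inj_on (\<lambda>z. restrict z {..n}) (Y i)"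
    proof (rule inj_onI)
      fix z w assume zw: "z \<in> Y i" "w \<in> Y i" "restrict z {..n} = restrict w {..n}"
      show "z = w"
      proof
        fix j show "z j = w j"
        proof (cases "j \<le> n")
          case True
          with fun_cong[OF zw(3), of j] show ?thesis by simp
        qed (use zw in \<open>auto simp: Y_def punctured_space_def\<close>)
      qed
    qed
    ultimately show False using i(2) finite_imageD by blast
  qed
  then obtain j where j: "j \<le> n" "infinite ((\<lambda>z. z j) ` Y i)" by blast
  define W where "W = {w. finite ((\<lambda>z. z j) ` {z \<in> Y i. peval z w = 0})}"
  have GW: "gen G \<inter> W = {}"
  proof (rule ccontr)
    assume "\<not> ?thesis"
    then obtain w where w: "w \<in> gen G" "w \<in> W" by blast
    have "peval z w = 0" if z: "z \<in> Y i" for z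
    proof -
      have zp: "z \<in> punctured_space n" "\<And>g. g \<in> G \<Longrightarrow> vanishes_at g (orbit n q z)"
        using z by (auto simp: Y_def V)
      then have "vanishes_at w (orbit n q z)" using vanishes_at_gen w(1) by blast
      then show ?thesis using orbit_self[OF zp(1)] unfolding vanishes_at_def by blast
    qed
    then have "{z \<in> Y i. peval z w = 0} = Y i" by blast
    then show False using w(2) j(2) by (simp add: W_def)
  qed
  obtain p where p: "is_ideal p" "gen G \<subseteq> p" "p \<inter> W = {}"
    "\<And>A. is_ideal A \<Longrightarrow> p \<subseteq> A \<Longrightarrow> A \<inter> W = {} \<Longrightarrow> A = p"
    using exists_maximal_avoiding_ideal[OF is_ideal_gen GW] by metis
  have prime: "x \<in> p \<or> y \<in> p" if "x * y \<in> p" for x y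
  proof (rule maximal_avoiding_prime[OF p(1,4,3) _ that])
    fix v w assume "v \<in> W" "w \<in> W"
    moreover have "(\<lambda>z. z j) ` {z \<in> Y i. peval z (v * w) = 0}
        = (\<lambda>z. z j) ` {z \<in> Y i. peval z v = 0} \<union> (\<lambda>z. z j) ` {z \<in> Y i. peval z w = 0}"
      by (auto simp: peval_mult)
    ultimately show "v * w \<in> W" by (simp add: W_def)
  qed
  then have prime': "\<forall>x y. x * y \<in> p \<longrightarrow> x \<in> p \<or> y \<in> p" by blast
  have "{z \<in> Y i. peval z (var i) = 0} = {}" by (auto simp: Y_def)
  then have "var i \<in> W" unfolding W_def mem_Collect_eq by (simp only: image_empty finite.emptyI)
  then have vi: "var i \<notin> p" using p(3) by blast
  define H where "H = {f. homogeneous n q f \<and> f \<in> p}"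
  let ?Z = "Var n q (Idl\<^bsub>cox_ring n\<^esub> H)"
  have irr: "irreducible_closed n q ?Z"
    unfolding H_def by (rule irreducible_closed_prime_variety[OF p(1) prime' i(1) vi])
  note mem = form_vanishing_on_prime_variety[where q = q and n = n and p = p, folded H_def, OF p(1) prime' i(1) vi]
  have Hc: "H \<subseteq> carrier (cox_ring n)" using homogeneous_carrier by (auto simp: H_def)
  have "G \<subseteq> p" using p(2) gen_superset[of G] by (rule order_trans[rotated])
  then have "G \<subseteq> H" using G by (auto simp: H_def)
  then have ZV: "?Z \<subseteq> ?V" unfolding V Var_genideal[OF Hc] by blast
  obtain \<zeta> where \<zeta>: "\<zeta> \<in> ?Z" using irr unfolding irreducible_closed_def by blast
  then have \<zeta>w: "\<zeta> \<in> wproj n q" by (simp add: Var_def)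
  have "?Z \<noteq> {\<zeta>}"
  proof
    assume Z: "?Z = {\<zeta>}"
    obtain z where z: "z \<in> punctured_space n" "\<zeta> = orbit n q z" using \<zeta>w by (rule wproj_cases)
    show False
    proof (cases "z i = 0")
      case True
      have "var i \<in> p"
        by (rule mem[OF graded_piece_var[OF i(1)]])
           (use Z z(2) True vanishes_at_orbit[OF graded_piece_var[OF i(1)] z(1)] in auto)
      then show False using vi by blast
    next
      case False
      \<comment> \<open>The binomial x_j^(q i) - c x_i^(q j) is homogeneous and vanishes at the only
        point, so it lies in \<open>p\<close>. On the chart it says x_j^(q i) = c, which leaves
        finitely many values of x_j, so it also lies in \<open>W\<close>.\<close>
      define c where "c = z j ^ q i / z i ^ q j"
      define w where "w = var j ^ q i - const c * var i ^ q j"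
      have "var j ^ q i \<in> graded_piece n q (int (q i) * int (q j))"
        by (rule graded_piece_power[OF graded_piece_var[OF j(1)]])
      moreover have "var i ^ q j \<in> graded_piece n q (int (q i) * int (q j))"
        using graded_piece_power[OF graded_piece_var[OF i(1), of q], of "q j"] by (simp add: mult.commute)
      ultimately have wg: "w \<in> graded_piece n q (int (q i) * int (q j))"
        unfolding w_def by (intro graded_piece_diff graded_piece_const_mult)
      have "peval z w = 0" using False by (simp add: w_def c_def peval_diff peval_mult peval_power)
      then have "w \<in> p"
        by (intro mem[OF wg]) (use Z z(2) vanishes_at_orbit[OF wg z(1)] in auto)
      moreover have "w \<in> W"
      proof -
        have "(\<lambda>z. z j) ` {z \<in> Y i. peval z w = 0} \<subseteq> {x. x ^ q i = c}"
          by (auto simp: Y_def w_def peval_diff peval_mult peval_power)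
        moreover have "finite {x :: complex. x ^ q i = c}"
          using finite_nth_roots[OF q[OF i(1)]] by blast
        ultimately show ?thesis unfolding W_def by (blast intro: finite_subset)
      qed
      ultimately show False using p(3) by blast
    qed
  qed
  then have "{\<zeta>} \<subset> ?Z" using \<zeta> by blast
  from zariski_dim_ge_1[OF irreducible_closed_point[OF q \<zeta>w] irr this ZV]
  show False using dim by simp
qed

text \<open>The empty set admits no chain, and the empty supremum in \<open>ereal\<close> is
  -\<infinity>, not 0.\<close>

lemma Var_nonempty_of_zariski_dim_0:
  assumes "zariski_dim n q Z = 0"
  shows "Z \<noteq> {}"
proof
  assume "Z = {}"
  then have no: "\<not> (irreducible_closed n q C \<and> C \<subseteq> Z)" for C by (auto simp: irreducible_closed_def)
  have "{ereal (real k) | k. \<exists>C :: nat \<Rightarrow> _. (\<forall>i\<le>k. irreducible_closed n q (C i) \<and> C i \<subseteq> Z) \<and>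
      (\<forall>i<k. C i \<subset> C (Suc i))} = {}"
    using no by blast
  then have "zariski_dim n q Z = Sup {}" unfolding zariski_dim_def by (rule arg_cong)
  then show False using assms by (simp add: bot_ereal_def)
qed


section \<open>Complete intersections of points\<close>

text \<open>Points are added one by one: of the combinations g + t g' of a form good at the old
  points and one good at the new point, only finitely many vanish somewhere.\<close>

lemma common_nonvanishing_form:
  assumes V: "V \<subseteq> wproj n q" "finite V"
    and bpf: "\<And>\<zeta>. \<zeta> \<in> V \<Longrightarrow> \<exists>g\<in>graded_piece n q \<alpha>. \<not> vanishes_at g \<zeta>"
  shows "\<exists>g\<in>graded_piece n q \<alpha>. \<forall>\<zeta>\<in>V. \<not> vanishes_at g \<zeta>"
  using V(2,1) bpf
proof (induction V rule: finite_induct)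
  case empty
  show ?case using graded_piece_0 by blast
next
  case (insert \<zeta> A)
  obtain g where g: "g \<in> graded_piece n q \<alpha>" "\<forall>\<eta>\<in>A. \<not> vanishes_at g \<eta>"
    using insert.IH insert.prems by auto
  obtain g' where g': "g' \<in> graded_piece n q \<alpha>" "\<not> vanishes_at g' \<zeta>"
    using insert.prems(2)[of \<zeta>] by auto
  have "\<forall>\<eta>\<in>insert \<zeta> A. \<exists>z. z \<in> punctured_space n \<and> \<eta> = orbit n q z"
  proof
    fix \<eta> assume "\<eta> \<in> insert \<zeta> A"
    then have "\<eta> \<in> wproj n q" using insert.prems(1) by blast
    then show "\<exists>z. z \<in> punctured_space n \<and> \<eta> = orbit n q z" by (rule wproj_cases) blast
  qed
  from bchoice[OF this] obtain z where
    "\<forall>\<eta>\<in>insert \<zeta> A. z \<eta> \<in> punctured_space n \<and> \<eta> = orbit n q (z \<eta>)" by (rule exE)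
  note z = bspec[OF this]
  have van: "vanishes_at x \<eta> \<longleftrightarrow> peval (z \<eta>) x = 0" if "x \<in> graded_piece n q \<alpha>" "\<eta> \<in> insert \<zeta> A" for x \<eta>
    using vanishes_at_orbit[OF that(1), of "z \<eta>"] z[OF that(2)] by simp
  \<comment> \<open>Where \<open>g'\<close> vanishes the quotient is 0 by convention. This only
    excludes \<open>t = 0\<close> and is harmless: such a point is an old one, where
    \<open>g\<close> does not vanish.\<close>
  let ?bad = "(\<lambda>\<eta>. - peval (z \<eta>) g / peval (z \<eta>) g') ` insert \<zeta> A"
  obtain t :: complex where t: "t \<notin> ?bad"
    using ex_new_if_finite[OF infinite_UNIV_char_0, of ?bad] insert.hyps(1) by blast
  have mem: "g + const t * g' \<in> graded_piece n q \<alpha>"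
    by (intro graded_piece_add graded_piece_const_mult g g')
  have "\<not> vanishes_at (g + const t * g') \<eta>" if \<eta>: "\<eta> \<in> insert \<zeta> A" for \<eta>
  proof
    assume "vanishes_at (g + const t * g') \<eta>"
    then have eq: "peval (z \<eta>) g + t * peval (z \<eta>) g' = 0"
      using van[OF mem \<eta>] by (simp add: peval_add peval_mult)
    show False
    proof (cases "peval (z \<eta>) g' = 0")
      case True
      then have "vanishes_at g' \<eta>" "vanishes_at g \<eta>" using eq van[OF g'(1) \<eta>] van[OF g(1) \<eta>] by auto
      then show False using g(2) g'(2) \<eta> by blast
    next
      case False
      have "t * peval (z \<eta>) g' = - peval (z \<eta>) g"
        using eq by (simp add: eq_neg_iff_add_eq_0 add.commute)
      then have "t = - peval (z \<eta>) g / peval (z \<eta>) g'"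
        using False by (subst nonzero_eq_divide_eq) simp_all
      then show False using t \<eta> by blast
    qed
  qed
  then show ?case using mem by blast
qed

lemma peval_origin:
  assumes q: "\<And>i. i \<le> n \<Longrightarrow> q i > 0" and f: "f \<in> graded_piece n q (int d)" "d > 0"
    and z: "\<And>i. i \<le> n \<Longrightarrow> z i = 0"
  shows "peval z f = 0"
proof -
  have "peval z f = 0 ^ d * peval z f"
    by (rule peval_weighted[OF f(1)]) (use q z in \<open>simp add: power_0_left\<close>)
  then show ?thesis using f(2) by (simp add: power_0_left)
qed

lemma graded_piece_degree_0:
  assumes q: "\<And>i. i \<le> n \<Longrightarrow> q i > 0" and f: "f \<in> graded_piece n q 0"
  shows "\<exists>c. f = const c"
proof -
  have "m = 0" if m: "m \<in> keys f" for m
  proof (rule poly_mapping_eqI)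
    fix i
    have m': "keys m \<subseteq> {..n}" "wdegree q m = 0" using f m by (auto simp: graded_piece_iff)
    have "(\<Sum>i\<le>n. q i * lookup m i) = 0" using m' wdegree_superset[of "{..n}" m q] by simp
    then have "\<forall>i\<in>{..n}. q i * lookup m i = 0" by (simp only: sum_eq_0_iff finite_atMost)
    then have "lookup m i = 0" if "i \<le> n" using q[OF that] that by (metis atMost_iff mult_eq_0_iff not_less0)
    then show "lookup m i = lookup 0 i" using m'(1) by (cases "i \<le> n") (auto simp: in_keys_iff)
  qed
  then have "f = Poly_Mapping.single 0 (lookup f 0)"
    by (intro poly_mapping_eqI) (auto simp: lookup_single when_def in_keys_iff)
  then show ?thesis unfolding const_def by blast
qed

lemma graded_piece_prod:
  "(\<And>x. x \<in> A \<Longrightarrow> g x \<in> graded_piece n q (D x)) \<Longrightarrow> prod g A \<in> graded_piece n q (\<Sum>x\<in>A. D x)"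
  by (induction A rule: infinite_finite_induct) (auto intro: graded_piece_mult graded_piece_1)

lemma vanishes_at_prod:
  assumes "\<And>x. x \<in> A \<Longrightarrow> g x \<in> graded_piece n q (D x)" "\<zeta> \<in> wproj n q" "finite A"
  shows "vanishes_at (prod g A) \<zeta> \<longleftrightarrow> (\<exists>x\<in>A. vanishes_at (g x) \<zeta>)"
proof -
  obtain z where z: "z \<in> punctured_space n" "\<zeta> = orbit n q z" using assms(2) by (rule wproj_cases)
  have "vanishes_at (prod g A) \<zeta> \<longleftrightarrow> peval z (prod g A) = 0"
    unfolding z(2) by (rule vanishes_at_orbit[OF graded_piece_prod[OF assms(1)] z(1)])
  moreover have "vanishes_at (g x) \<zeta> \<longleftrightarrow> peval z (g x) = 0" if "x \<in> A" for x
    unfolding z(2) by (rule vanishes_at_orbit[OF assms(1)[OF that] z(1)])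
  ultimately show ?thesis using assms(3) by (simp add: peval_prod)
qed

lemma nonvanishing_degree: "g \<in> graded_piece n q d \<Longrightarrow> \<not> vanishes_at g \<zeta> \<Longrightarrow> d \<ge> 0"
  using graded_piece_negative[of g n q d] by (force simp: vanishes_at_def)

text \<open>The dimension hypothesis enters as finiteness and nonemptiness of the point set, the
  factor \<ell> in the degrees as divisibility by the weights. \<open>h\<close> is the auxiliary
  form without zeros on the points.\<close>

locale weighted_complete_intersection =
  fixes n :: nat and q D :: "nat \<Rightarrow> nat" and f :: "nat \<Rightarrow> poly_cox" and e :: nat and h :: poly_cox
  assumes q: "i \<le> n \<Longrightarrow> q i > 0"
    and f: "i \<in> {1..n} \<Longrightarrow> f i \<in> graded_piece n q (int (D i))"
    and D_dvd: "i \<in> {1..n} \<Longrightarrow> j \<le> n \<Longrightarrow> q j dvd D i"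
    and finite_Var: "finite (Var n q (Idl\<^bsub>cox_ring n\<^esub> (f ` {1..n})))"
    and Var_nonempty: "Var n q (Idl\<^bsub>cox_ring n\<^esub> (f ` {1..n})) \<noteq> {}"
    and h: "h \<in> graded_piece n q (int e)"
    and h_nonvanishing: "\<zeta> \<in> Var n q (Idl\<^bsub>cox_ring n\<^esub> (f ` {1..n})) \<Longrightarrow> \<not> vanishes_at h \<zeta>"
    and e: "e > 0" "j \<le> n \<Longrightarrow> q j dvd e"
begin

abbreviation "S \<equiv> graded_piece n q"
abbreviation "I \<equiv> Idl\<^bsub>cox_ring n\<^esub> (f ` {1..n})"
abbreviation "J \<equiv> gen (f ` {1..n})"
abbreviation "V \<equiv> Var n q I"

lemma f_carrier: "f ` {1..n} \<subseteq> carrier (cox_ring n)"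
  using f graded_piece_carrier by blast

lemma V_iff: "\<zeta> \<in> V \<longleftrightarrow> \<zeta> \<in> wproj n q \<and> (\<forall>i\<in>{1..n}. vanishes_at (f i) \<zeta>)"
  by (subst Var_genideal[OF f_carrier]) simp

lemma I_graded: "I \<inter> S t = graded_gen n q (f ` {1..n}) t"
  by (rule graded_piece_genideal[where D = "\<lambda>i. int (D i)"]) (use f in auto)

lemma zero_in_V:
  assumes z: "z \<in> punctured_space n" "\<And>i. i \<in> {1..n} \<Longrightarrow> peval z (f i) = 0"
  shows "orbit n q z \<in> V"
  unfolding V_iff using orbit_in_wproj[OF z(1)] vanishes_at_orbit[OF f z(1)] z(2) by simp

text \<open>The \<open>f i\<close> are numbered from 1, so index 0 is free for the form that
  completes them to n + 1 forms.\<close>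

definition adjoin :: "poly_cox \<Rightarrow> nat \<Rightarrow> poly_cox" where
  "adjoin b i = (if i = 0 then b else f i)"

lemma adjoin_only_trivial_zero:
  assumes b: "b \<in> S \<beta>" "\<And>\<zeta>. \<zeta> \<in> V \<Longrightarrow> \<not> vanishes_at b \<zeta>"
  shows "only_trivial_zero n (adjoin b)"
  unfolding only_trivial_zero_def
proof (rule ccontr, clarsimp)
  fix z i assume z: "\<forall>i>n. z i = 0" "\<forall>i\<le>n. peval z (adjoin b i) = 0" "i \<le> n" "z i \<noteq> 0"
  then have zp: "z \<in> punctured_space n" by (auto simp: punctured_space_def)
  have "peval z (f i) = 0" if "i \<in> {1..n}" for i
    using z(2)[rule_format, of i] that by (simp add: adjoin_def)
  then have "orbit n q z \<in> V" by (rule zero_in_V[OF zp])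
  moreover have "peval z b = 0" using z(2)[rule_format, of 0] by (simp add: adjoin_def)
  ultimately show False using b(2) vanishes_at_orbit[OF b(1) zp] by blast
qed

lemma adjoin_carrier: "b \<in> S \<beta> \<Longrightarrow> i \<le> n \<Longrightarrow> adjoin b i \<in> carrier (cox_ring n)"
  using f_carrier graded_piece_carrier[of b n q \<beta>] by (auto simp: adjoin_def image_subset_iff)

text \<open>A generator of degree 0 is constant, hence zero because \<open>V\<close> has a point.
  Then 0 would be a nonzerodivisor modulo \<open>h\<close> and the other generators, which would
  thus generate the unit ideal although all of them vanish at the origin.\<close>

lemma D_pos:
  assumes i: "i \<in> {1..n}"
  shows "D i > 0"
proof (rule ccontr)
  assume Di: "\<not> D i > 0"
  have zero: "f j = 0" if j: "j \<in> {1..n}" "D j = 0" for j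
  proof -
    obtain c where c: "f j = const c"
      using graded_piece_degree_0[where q = q and n = n and f = "f j", OF q] f[OF j(1)] j(2) by auto
    obtain \<zeta> where \<zeta>: "\<zeta> \<in> V" using Var_nonempty by blast
    then obtain z where z: "z \<in> punctured_space n" "\<zeta> = orbit n q z" using wproj_cases V_iff by metis
    then have "peval z (f j) = 0"
      using \<zeta> j(1) vanishes_at_orbit[OF f[OF j(1)] z(1)] V_iff by blast
    then show ?thesis using c by simp
  qed
  have "f i = 0" using zero i Di by simp
  then have "adjoin h i * 1 \<in> gen (adjoin h ` ({..n} - {i}))"
    using i by (simp add: adjoin_def ideal_0 is_ideal_gen)
  then have "1 \<in> gen (adjoin h ` ({..n} - {i}))"
    using i by (intro nonzerodivisor_of_only_trivial_zero[of n "adjoin h" i 1]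
        adjoin_carrier[OF h] adjoin_only_trivial_zero[OF h h_nonvanishing]) auto
  moreover have "peval (\<lambda>_. 0) (adjoin h j) = 0" if "j \<le> n" for j
  proof (cases "j = 0 \<or> D j > 0")
    case True
    then show ?thesis
      using peval_origin[where q = q and n = n, OF q h e(1), of "\<lambda>_. 0"]
        peval_origin[where q = q and n = n and f = "f j" and d = "D j" and z = "\<lambda>_. 0", OF q] f[of j] that
      by (auto simp: adjoin_def)
  next
    case False
    then show ?thesis using zero[of j] that by (auto simp: adjoin_def)
  qed
  then have "vanishes_at g {\<lambda>_. 0}" if "g \<in> adjoin h ` ({..n} - {i})" for g
    using that by (auto simp: vanishes_at_def)
  ultimately have "vanishes_at 1 {\<lambda>_. 0}" by (rule vanishes_at_gen[rotated])
  then show False by (simp add: vanishes_at_def)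
qed

lemma adjoin_image: "adjoin b ` ({..n} - {0}) = f ` {1..n}"
proof -
  have "{..n} - {0} = {1..n}" by auto
  then show ?thesis by (auto simp: adjoin_def)
qed

lemma nonvanishing_nonzerodivisor:
  assumes b: "b \<in> S \<beta>" "\<And>\<zeta>. \<zeta> \<in> V \<Longrightarrow> \<not> vanishes_at b \<zeta>" and g: "b * g \<in> J"
  shows "g \<in> J"
  using nonzerodivisor_of_only_trivial_zero[of n "adjoin b" 0 g,
      OF adjoin_carrier[OF b(1)] adjoin_only_trivial_zero[OF b]] g
  unfolding adjoin_image by (simp add: adjoin_def)

lemma h_power_nonzerodivisor: "h ^ k * g \<in> J \<Longrightarrow> g \<in> J"
proof (induction k)
  case (Suc k)
  then have "h * (h ^ k * g) \<in> J" by (simp add: mult.assoc)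
  then have "h ^ k * g \<in> J" by (rule nonvanishing_nonzerodivisor[OF h h_nonvanishing, rotated])
  then show ?case by (rule Suc.IH)
qed simp

text \<open>In its degree, \<open>u\<close> lies in the ideal of the \<open>f i\<close> and
  \<open>b\<close>, and the coefficient of \<open>b\<close> is the desired \<open>v\<close>. The
  bound on \<open>t\<close> is free of \<beta> because \<beta> enters both the sum of the degrees
  and the degree of \<open>u\<close>.\<close>

lemma nonvanishing_surjective:
  assumes b: "b \<in> S (int \<beta>)" "\<And>\<zeta>. \<zeta> \<in> V \<Longrightarrow> \<not> vanishes_at b \<zeta>" "\<beta> > 0" "\<And>j. j \<le> n \<Longrightarrow> q j dvd \<beta>"
    and t: "t > (\<Sum>i=1..n. int (D i)) - (\<Sum>i\<le>n. int (q i))" and u: "u \<in> S (t + int \<beta>)"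
  shows "\<exists>v\<in>S t. u - v * b \<in> J"
proof -
  define D' where "D' i = (if i = 0 then \<beta> else D i)" for i
  have split: "{..n} = insert 0 {1..n}" by auto
  have F: "adjoin b i \<in> S (int (D' i))" if "i \<le> n" for i
    using that f[of i] b(1) by (auto simp: adjoin_def D'_def)
  have D': "D' i > 0" "q i dvd D' i" if "i \<le> n" for i
    using that D_pos[of i] D_dvd[of i i] b(3,4) by (auto simp: D'_def)
  have "(\<Sum>i\<le>n. int (D' i)) = int \<beta> + (\<Sum>i=1..n. int (D i))"
    unfolding split by (simp add: D'_def)
  then have "t + int \<beta> > (\<Sum>i\<le>n. int (D' i)) - (\<Sum>i\<le>n. int (q i))" using t by simp
  from graded_piece_subset_gen_of_only_trivial_zero[where q = q, OF q F adjoin_only_trivial_zero[OF b(1,2)] D' this]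
  have "u \<in> gen (adjoin b ` {..n})" using u by blast
  then obtain c where c: "\<And>i. c i \<in> S (t + int \<beta> - int (D' i))" "u = (\<Sum>i\<le>n. c i * adjoin b i)"
    using graded_gen_coefficients[where F = "adjoin b" and K = "{..n}" and D = "\<lambda>i. int (D' i)", OF _ F u] by auto
  have "u = c 0 * b + (\<Sum>i=1..n. c i * f i)"
    unfolding c(2) split by (simp add: adjoin_def)
  then have "u - c 0 * b = (\<Sum>i=1..n. c i * f i)" by simp
  also have "\<dots> \<in> J"
    by (intro ideal_sum ideal_mult is_ideal_gen subsetD[OF gen_superset]) auto
  finally have "u - c 0 * b \<in> J" .
  moreover have "c 0 \<in> S t" using c(1)[of 0] by (simp add: D'_def)
  ultimately show ?thesis by blast
qed

text \<open>A common zero of the homogeneous elements of \<open>A\<close> other than the origin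
  would be a point of \<open>V\<close>, which \<open>s\<close> excludes. At the origin
  \<open>h\<close> vanishes, so the Nullstellensatz applies to \<open>h\<close>.\<close>

lemma J_subset_of_nonvanishing:
  assumes A: "is_ideal A" "J \<subseteq> A"
    and s: "\<And>\<zeta>. \<zeta> \<in> V \<Longrightarrow> \<exists>\<sigma>. \<exists>s\<in>S \<sigma>. s \<in> A \<and> \<not> vanishes_at s \<zeta>"
  shows "\<exists>k. h ^ k \<in> A"
proof -
  let ?G = "{s \<in> A. homogeneous n q s}"
  have "\<exists>k. h ^ k \<in> gen ?G"
  proof (rule nullstellensatz_radical)
    show "?G \<subseteq> carrier (cox_ring n)" using homogeneous_carrier by blast
    show "h \<in> carrier (cox_ring n)" using h by (rule graded_piece_carrier)
    fix z assume z: "\<forall>i>n. z i = 0" "\<forall>s\<in>?G. peval z s = 0"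
    show "peval z h = 0"
    proof (cases "z \<in> punctured_space n")
      case False
      then have z0: "z i = 0" if "i \<le> n" for i using z(1) that by (auto simp: punctured_space_def)
      show ?thesis by (rule peval_origin[of n q h e z, OF _ h e(1)]) (auto intro: q z0)
    next
      case True
      have "peval z (f i) = 0" if i: "i \<in> {1..n}" for i
      proof -
        have "f i \<in> J" using i gen_superset[of "f ` {1..n}"] by blast
        then show ?thesis using A(2) z(2) f[OF i] by (auto simp: homogeneous_def)
      qed
      then have "orbit n q z \<in> V" by (rule zero_in_V[OF True])
      then obtain \<sigma> s where s: "s \<in> S \<sigma>" "s \<in> A" "\<not> vanishes_at s (orbit n q z)" using s by blast
      then have "peval z s = 0" using z(2) by (auto simp: homogeneous_def)
      then show ?thesis using s vanishes_at_orbit[OF s(1) True] by blast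
    qed
  qed
  moreover have "gen ?G \<subseteq> A" by (rule gen_least[OF A(1)]) auto
  ultimately show ?thesis by blast
qed

text \<open>The multipliers of \<open>g\<close> into \<open>J\<close> form an ideal which contains a
  power of \<open>h\<close>, and powers of \<open>h\<close> can be cancelled modulo
  \<open>J\<close>.\<close>

lemma mem_J_of_local:
  assumes s: "\<And>\<zeta>. \<zeta> \<in> V \<Longrightarrow> \<exists>\<sigma>. \<exists>s\<in>S \<sigma>. s * g \<in> J \<and> \<not> vanishes_at s \<zeta>"
  shows "g \<in> J"
proof -
  let ?A = "{x. x * g \<in> J}"
  have "is_ideal ?A"
    unfolding is_ideal_def
    by (auto simp: ideal_0 is_ideal_gen distrib_right mult.assoc intro: ideal_add ideal_mult)
  moreover have "J \<subseteq> ?A" using ideal_mult_right[OF is_ideal_gen] by blast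
  ultimately obtain k where "h ^ k \<in> ?A"
    using J_subset_of_nonvanishing[of ?A] s by blast
  then show ?thesis using h_power_nonzerodivisor by blast
qed

text \<open>Having positive degree, \<open>h\<close> lies in the irrelevant ideal; whatever a power
  of that ideal multiplies into \<open>I\<close> is multiplied into it by a power of
  \<open>h\<close>, which can be cancelled.\<close>

lemma saturation_graded: "saturation n I \<inter> S t = I \<inter> S t"
proof
  have idl: "Ideal.ideal I (cox_ring n)" by (rule ring.genideal_ideal[OF ring_cox_ring f_carrier])
  show "I \<inter> S t \<subseteq> saturation n I \<inter> S t"
  proof
    fix g assume g: "g \<in> I \<inter> S t"
    have "b * g \<in> I" if "b \<in> carrier (cox_ring n)" for b
      using ideal.I_l_closed[OF idl, of g b] g that by simp
    then have "\<forall>b\<in>irrelevant_ideal n [^]\<^bsub>ideals_set (cox_ring n)\<^esub> (0::nat). b * g \<in> I"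
      by (simp add: nat_pow_def ideals_set_def)
    then show "g \<in> saturation n I \<inter> S t"
      using g graded_piece_carrier unfolding saturation_def by blast
  qed
  have hB: "h \<in> irrelevant_ideal n"
  proof -
    have "h \<in> gen ((\<lambda>i. var i ^ 1) ` {..n})"
      unfolding gen_var_powers_iff[OF finite_atMost]
    proof
      fix m assume "m \<in> keys h"
      then have m: "keys m \<subseteq> {..n}" "wdegree q m = e" using h by (auto simp: graded_piece_iff)
      then have "keys m \<noteq> {}" using e(1) by (auto simp: wdegree_def)
      then obtain i where i: "i \<in> keys m" by blast
      then have "i \<in> {..n}" using m(1) by blast
      then show "\<exists>i\<in>{..n}. 1 \<le> lookup m i" using i by (intro bexI[of _ i]) (auto simp: in_keys_iff)
    qed
    then have "h \<in> graded_gen n q (var ` {..n}) (int e)" using h by simp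
    then show ?thesis
      unfolding irrelevant_ideal_def
      using graded_piece_genideal[of "{..n}" var n q "\<lambda>i. int (q i)" "int e"] graded_piece_var by auto
  qed
  have pow: "h ^ k \<in> irrelevant_ideal n [^]\<^bsub>ideals_set (cox_ring n)\<^esub> k" for k :: nat
  proof (induction k)
    case 0
    show ?case using graded_piece_carrier[OF graded_piece_1] by (simp add: nat_pow_def ideals_set_def)
  next
    case (Suc k)
    from ideal_prod.prod[OF Suc hB, of "cox_ring n"] show ?case
      by (simp add: nat_pow_def ideals_set_def mult.commute)
  qed
  show "saturation n I \<inter> S t \<subseteq> I \<inter> S t"
  proof
    fix g assume g: "g \<in> saturation n I \<inter> S t"
    then obtain k :: nat where "\<forall>b \<in> irrelevant_ideal n [^]\<^bsub>ideals_set (cox_ring n)\<^esub> k. b * g \<in> I"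
      unfolding saturation_def by blast
    then have "h ^ k * g \<in> J" using pow genideal_subset_gen[OF f_carrier] by blast
    then have "g \<in> J" by (rule h_power_nonzerodivisor)
    then show "g \<in> I \<inter> S t" using g unfolding I_graded by blast
  qed
qed

end


section \<open>Local rings and the degree\<close>

abbreviation fr :: "poly_cox \<Rightarrow> poly_cox \<Rightarrow> poly_cox fract" where
  "fr \<equiv> Fraction_Field.Fract"

interpretation fract: complex_algebra "\<lambda>c. fr (const c) 1"
  by unfold_locales (simp_all add: const.iota_add const.iota_mult One_fract_def)

lemma fract_add_numerator: "k \<noteq> 0 \<Longrightarrow> fr (x + y) k = fr x k + fr y k"
  by (simp add: eq_fract algebra_simps)

lemma nonvanishing_nonzero: "\<not> vanishes_at g \<zeta> \<Longrightarrow> g \<noteq> 0"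
  by (auto simp: vanishes_at_def)

lemma local_ringI:
  "g \<in> graded_piece n q \<alpha> \<Longrightarrow> h \<in> graded_piece n q \<alpha> \<Longrightarrow> \<not> vanishes_at h \<zeta> \<Longrightarrow> fr g h \<in> local_ring n q \<zeta>"
  unfolding local_ring_def by blast

lemma local_ring_subspace:
  assumes \<zeta>: "\<zeta> \<in> wproj n q"
  shows "fract.subspace (local_ring n q \<zeta>)"
  unfolding fract.subspace_def
proof (intro conjI ballI allI)
  show "0 \<in> local_ring n q \<zeta>"
    using local_ringI[OF graded_piece_0 graded_piece_1 not_vanishes_at_1[OF \<zeta>]] by (simp add: Zero_fract_def)
next
  fix x y assume "x \<in> local_ring n q \<zeta>" "y \<in> local_ring n q \<zeta>"
  then obtain g h \<alpha> g' h' \<alpha>' where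
    x: "x = fr g h" "g \<in> graded_piece n q \<alpha>" "h \<in> graded_piece n q \<alpha>" "\<not> vanishes_at h \<zeta>" and
    y: "y = fr g' h'" "g' \<in> graded_piece n q \<alpha>'" "h' \<in> graded_piece n q \<alpha>'" "\<not> vanishes_at h' \<zeta>"
    unfolding local_ring_def by blast
  have "x + y = fr (g * h' + g' * h) (h * h')"
    using nonvanishing_nonzero[OF x(4)] nonvanishing_nonzero[OF y(4)] by (simp add: x(1) y(1))
  moreover have "g * h' + g' * h \<in> graded_piece n q (\<alpha> + \<alpha>')"
    using graded_piece_mult[OF x(2) y(3)] graded_piece_mult[OF y(2) x(3)]
    by (intro graded_piece_add) (simp_all add: add.commute)
  ultimately show "x + y \<in> local_ring n q \<zeta>"
    using local_ringI[OF _ graded_piece_mult[OF x(3) y(3)]] vanishes_at_mult[OF x(3) y(3) \<zeta>] x(4) y(4) by simp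
next
  fix c x assume "x \<in> local_ring n q \<zeta>"
  then obtain g h \<alpha> where
    x: "x = fr g h" "g \<in> graded_piece n q \<alpha>" "h \<in> graded_piece n q \<alpha>" "\<not> vanishes_at h \<zeta>"
    unfolding local_ring_def by blast
  then show "fr (const c) 1 * x \<in> local_ring n q \<zeta>"
    using local_ringI[OF graded_piece_const_mult[OF x(2)] x(3,4)] by simp
qed

context weighted_complete_intersection
begin

lemma V_wproj: "\<zeta> \<in> V \<Longrightarrow> \<zeta> \<in> wproj n q"
  by (simp add: Var_def)

text \<open>The definition allows any representation of the fraction. As polynomials form a domain,
  cross-multiplication turns this into a multiplier \<open>s\<close> for the given
  numerator.\<close>

lemma local_ideal_iff:
  assumes \<zeta>: "\<zeta> \<in> wproj n q" and g: "g \<in> S \<gamma>" and b: "b \<in> S \<gamma>" "\<not> vanishes_at b \<zeta>"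
  shows "fr g b \<in> local_ideal n q I \<zeta> \<longleftrightarrow> (\<exists>\<sigma>. \<exists>s\<in>S \<sigma>. s * g \<in> J \<and> \<not> vanishes_at s \<zeta>)"
proof
  assume "fr g b \<in> local_ideal n q I \<zeta>"
  then obtain a c \<sigma> where ac: "fr g b = fr a c" "a \<in> I \<inter> S \<sigma>" "c \<in> S \<sigma>" "\<not> vanishes_at c \<zeta>"
    unfolding local_ideal_def by blast
  then have "g * c = a * b"
    using nonvanishing_nonzero[OF b(2)] nonvanishing_nonzero[OF ac(4)] by (simp add: eq_fract)
  moreover have "a * b \<in> J" using ac(2) unfolding I_graded by (auto intro: ideal_mult_right is_ideal_gen)
  ultimately show "\<exists>\<sigma>. \<exists>s\<in>S \<sigma>. s * g \<in> J \<and> \<not> vanishes_at s \<zeta>" using ac(3,4) by (metis mult.commute)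
next
  assume "\<exists>\<sigma>. \<exists>s\<in>S \<sigma>. s * g \<in> J \<and> \<not> vanishes_at s \<zeta>"
  then obtain \<sigma> s where s: "s \<in> S \<sigma>" "s * g \<in> J" "\<not> vanishes_at s \<zeta>" by blast
  have "s * g \<in> I \<inter> S (\<sigma> + \<gamma>)" unfolding I_graded using s graded_piece_mult[OF s(1) g] by blast
  moreover have "s * b \<in> S (\<sigma> + \<gamma>)" "\<not> vanishes_at (s * b) \<zeta>"
    using graded_piece_mult[OF s(1) b(1)] vanishes_at_mult[OF s(1) b(1) \<zeta>] s(3) b(2) by auto
  moreover have "fr g b = fr (s * g) (s * b)"
    using nonvanishing_nonzero[OF b(2)] nonvanishing_nonzero[OF s(3)] by (simp add: eq_fract mult_ac)
  ultimately show "fr g b \<in> local_ideal n q I \<zeta>" unfolding local_ideal_def by blast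
qed

lemma local_ideal_subspace:
  assumes \<zeta>: "\<zeta> \<in> wproj n q"
  shows "fract.subspace (local_ideal n q I \<zeta>)"
  unfolding fract.subspace_def
proof (intro conjI ballI allI)
  have "1 * 0 \<in> J" by (simp add: ideal_0 is_ideal_gen)
  then have "fr 0 1 \<in> local_ideal n q I \<zeta>"
    using local_ideal_iff[OF \<zeta> graded_piece_0 graded_piece_1 not_vanishes_at_1[OF \<zeta>]]
      graded_piece_1 not_vanishes_at_1[OF \<zeta>] by blast
  then show "0 \<in> local_ideal n q I \<zeta>" by (simp add: Zero_fract_def)
next
  fix x y assume "x \<in> local_ideal n q I \<zeta>" "y \<in> local_ideal n q I \<zeta>"
  then obtain g h \<alpha> g' h' \<alpha>' where
    x: "x = fr g h" "g \<in> I \<inter> S \<alpha>" "h \<in> S \<alpha>" "\<not> vanishes_at h \<zeta>" and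
    y: "y = fr g' h'" "g' \<in> I \<inter> S \<alpha>'" "h' \<in> S \<alpha>'" "\<not> vanishes_at h' \<zeta>"
    unfolding local_ideal_def by blast
  have "x + y = fr (g * h' + g' * h) (h * h')"
    using nonvanishing_nonzero[OF x(4)] nonvanishing_nonzero[OF y(4)] by (simp add: x(1) y(1))
  moreover have "g * h' + g' * h \<in> I \<inter> S (\<alpha> + \<alpha>')"
    using graded_piece_mult[of g n q \<alpha>, OF _ y(3)] graded_piece_mult[of g' n q \<alpha>', OF _ x(3)] x(2) y(2)
    unfolding I_graded
    by (auto simp: add.commute[of \<alpha>' \<alpha>] intro!: graded_piece_add ideal_add ideal_mult_right is_ideal_gen)
  moreover have "h * h' \<in> S (\<alpha> + \<alpha>')" "\<not> vanishes_at (h * h') \<zeta>"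
    using graded_piece_mult[OF x(3) y(3)] vanishes_at_mult[OF x(3) y(3) \<zeta>] x(4) y(4) by auto
  ultimately show "x + y \<in> local_ideal n q I \<zeta>" unfolding local_ideal_def by blast
next
  fix c x assume "x \<in> local_ideal n q I \<zeta>"
  then obtain g h \<alpha> where x: "x = fr g h" "g \<in> I \<inter> S \<alpha>" "h \<in> S \<alpha>" "\<not> vanishes_at h \<zeta>"
    unfolding local_ideal_def by blast
  have "const c * g \<in> I \<inter> S \<alpha>"
    using x(2) unfolding I_graded by (auto intro: graded_piece_const_mult ideal_mult is_ideal_gen)
  moreover have "fr (const c) 1 * x = fr (const c * g) h" by (simp add: x(1))
  ultimately show "fr (const c) 1 * x \<in> local_ideal n q I \<zeta>" using x(3,4) unfolding local_ideal_def by blast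
qed

text \<open>Affine zeros of the generators are points of \<open>V\<close>, where \<open>x\<close>
  vanishes, or the origin, where \<open>h\<close> does.\<close>

lemma power_mem_J_of_vanishing:
  assumes x: "x \<in> S \<delta>" "\<And>\<zeta>. \<zeta> \<in> V \<Longrightarrow> vanishes_at x \<zeta>"
  shows "\<exists>k. (x * h) ^ k \<in> J"
proof (rule nullstellensatz_radical[OF f_carrier])
  show "x * h \<in> carrier (cox_ring n)"
    using graded_piece_mult[OF x(1) h] by (rule graded_piece_carrier)
  fix z assume z: "\<forall>i>n. z i = 0" "\<forall>g\<in>f ` {1..n}. peval z g = 0"
  show "peval z (x * h) = 0"
  proof (cases "z \<in> punctured_space n")
    case False
    then have z0: "z i = 0" if "i \<le> n" for i using z(1) that by (auto simp: punctured_space_def)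
    have "peval z h = 0" by (rule peval_origin[of n q h e z, OF _ h e(1)]) (auto intro: q z0)
    then show ?thesis by (simp add: peval_mult)
  next
    case True
    have "orbit n q z \<in> V" by (rule zero_in_V[OF True]) (use z(2) in blast)
    then show ?thesis using x(2) vanishes_at_orbit[OF x(1) True] by (simp add: peval_mult)
  qed
qed

text \<open>\<open>p \<zeta>\<close> is locally a unit at \<zeta> and locally in the ideal at every
  other point \<eta>, the latter witnessed by a multiplier \<open>s \<eta>\<close> common to all
  \<zeta> \<noteq> \<eta>. The equal degrees allow the \<open>p \<zeta>\<close> to be combined in
  sums.\<close>

lemma separators:
  "\<exists>X p s. X > 0 \<and>
     (\<forall>\<zeta>\<in>V. p \<zeta> \<in> S (int (e * X)) \<and> \<not> vanishes_at (p \<zeta>) \<zeta> \<and> (\<exists>\<sigma>. s \<zeta> \<in> S \<sigma>) \<and> \<not> vanishes_at (s \<zeta>) \<zeta>) \<and>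
     (\<forall>\<zeta>\<in>V. \<forall>\<eta>\<in>V. \<zeta> \<noteq> \<eta> \<longrightarrow> s \<eta> * p \<zeta> \<in> J \<and> vanishes_at (p \<zeta>) \<eta>)"
proof -
  have "\<exists>d r. r \<in> S d \<and> vanishes_at r \<eta> \<and> \<not> vanishes_at r \<zeta>" if \<zeta>\<eta>: "\<zeta> \<in> V" "\<eta> \<in> V" "\<zeta> \<noteq> \<eta>" for \<zeta> \<eta>
  proof -
    obtain z where z: "z \<in> punctured_space n" "\<zeta> = orbit n q z" using V_wproj[OF \<zeta>\<eta>(1)] by (rule wproj_cases)
    obtain w where w: "w \<in> punctured_space n" "\<eta> = orbit n q w" using V_wproj[OF \<zeta>\<eta>(2)] by (rule wproj_cases)
    have "(z, w) \<notin> orbit_rel n q" using \<zeta>\<eta>(3) orbit_eq_iff[OF z(1) w(1)] z(2) w(2) by simp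
    then obtain d r where r: "r \<in> S d" "peval w r = 0" "peval z r \<noteq> 0"
      using separating_form[where q = q, OF q z(1) w(1)] by blast
    then show ?thesis
      unfolding z(2) w(2) using vanishes_at_orbit[OF r(1) z(1)] vanishes_at_orbit[OF r(1) w(1)]
      by (intro exI[of _ d] exI[of _ r]) simp
  qed
  then obtain d r where r: "\<And>\<zeta> \<eta>. \<zeta> \<in> V \<Longrightarrow> \<eta> \<in> V \<Longrightarrow> \<zeta> \<noteq> \<eta> \<Longrightarrow>
      r \<zeta> \<eta> \<in> S (d \<zeta> \<eta>) \<and> vanishes_at (r \<zeta> \<eta>) \<eta> \<and> \<not> vanishes_at (r \<zeta> \<eta>) \<zeta>" by metis
  define p0 where "p0 \<zeta> = (\<Prod>\<eta>\<in>V - {\<zeta>}. r \<zeta> \<eta>)" for \<zeta>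
  have p0_deg: "p0 \<zeta> \<in> S (\<Sum>\<eta>\<in>V - {\<zeta>}. d \<zeta> \<eta>)" if "\<zeta> \<in> V" for \<zeta>
    unfolding p0_def using r[OF that] by (intro graded_piece_prod) auto
  have p0_van: "vanishes_at (p0 \<zeta>) \<xi> \<longleftrightarrow> (\<exists>\<eta>\<in>V - {\<zeta>}. vanishes_at (r \<zeta> \<eta>) \<xi>)" if "\<zeta> \<in> V" "\<xi> \<in> V" for \<zeta> \<xi>
    unfolding p0_def using r[OF that(1)] finite_Var V_wproj[OF that(2)]
    by (intro vanishes_at_prod[where D = "d \<zeta>" and n = n and q = q]) auto
  have p0_self: "\<not> vanishes_at (p0 \<zeta>) \<zeta>" if "\<zeta> \<in> V" for \<zeta>
    using p0_van[OF that that] r[OF that] by blast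
  have p0_other: "vanishes_at (p0 \<zeta>) \<eta>" if "\<zeta> \<in> V" "\<eta> \<in> V" "\<zeta> \<noteq> \<eta>" for \<zeta> \<eta>
    using p0_van[OF that(1,2)] r[OF that] that(2,3) by blast
  define g where "g \<zeta> = nat (\<Sum>\<eta>\<in>V - {\<zeta>}. d \<zeta> \<eta>)" for \<zeta>
  have p0: "p0 \<zeta> \<in> S (int (g \<zeta>))" if "\<zeta> \<in> V" for \<zeta>
    using p0_deg[OF that] nonvanishing_degree[OF p0_deg[OF that] p0_self[OF that]] by (simp add: g_def)
  have "\<exists>k. (p0 \<zeta> * p0 \<eta> * h) ^ k \<in> J" if "\<zeta> \<in> V" "\<eta> \<in> V" "\<zeta> \<noteq> \<eta>" for \<zeta> \<eta>
  proof (rule power_mem_J_of_vanishing)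
    show "p0 \<zeta> * p0 \<eta> \<in> S (int (g \<zeta>) + int (g \<eta>))" by (rule graded_piece_mult[OF p0[OF that(1)] p0[OF that(2)]])
    fix \<xi> assume \<xi>: "\<xi> \<in> V"
    have "\<zeta> \<noteq> \<xi> \<or> \<eta> \<noteq> \<xi>" using that(3) by blast
    then show "vanishes_at (p0 \<zeta> * p0 \<eta>) \<xi>"
      using vanishes_at_mult[OF p0[OF that(1)] p0[OF that(2)] V_wproj[OF \<xi>]] p0_other \<xi> that by blast
  qed
  then obtain k where k: "\<And>\<zeta> \<eta>. \<zeta> \<in> V \<Longrightarrow> \<eta> \<in> V \<Longrightarrow> \<zeta> \<noteq> \<eta> \<Longrightarrow> (p0 \<zeta> * p0 \<eta> * h) ^ k \<zeta> \<eta> \<in> J"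
    by metis
  \<comment> \<open>\<open>e * N\<close> bounds every exponent \<open>k\<close>. The factor
    \<open>e\<close> makes the degree of \<open>p0 \<zeta> ^ (e * N)\<close> a multiple of
    \<open>e\<close>, so that powers of \<open>h\<close> can fill it up to
    \<open>e * X\<close>.\<close>
  define N where "N = Suc (\<Sum>\<zeta>\<in>V. \<Sum>\<eta>\<in>V. k \<zeta> \<eta>)"
  have kN: "k \<zeta> \<eta> \<le> e * N" if "\<zeta> \<in> V" "\<eta> \<in> V" for \<zeta> \<eta>
  proof -
    have "k \<zeta> \<eta> \<le> (\<Sum>\<eta>\<in>V. k \<zeta> \<eta>)" using that finite_Var by (intro member_le_sum) auto
    also have "\<dots> \<le> (\<Sum>\<zeta>\<in>V. \<Sum>\<eta>\<in>V. k \<zeta> \<eta>)"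
      using that finite_Var by (intro member_le_sum[of _ _ "\<lambda>\<zeta>. \<Sum>\<eta>\<in>V. k \<zeta> \<eta>"]) auto
    also have "\<dots> \<le> e * N" using e(1) by (cases e) (auto simp: N_def)
    finally show ?thesis .
  qed
  have mem: "(p0 \<zeta> * p0 \<eta> * h) ^ (e * N) \<in> J" if "\<zeta> \<in> V" "\<eta> \<in> V" "\<zeta> \<noteq> \<eta>" for \<zeta> \<eta>
  proof -
    have "(p0 \<zeta> * p0 \<eta> * h) ^ (e * N)
        = (p0 \<zeta> * p0 \<eta> * h) ^ (e * N - k \<zeta> \<eta>) * (p0 \<zeta> * p0 \<eta> * h) ^ k \<zeta> \<eta>"
      using kN[OF that(1,2)] by (simp flip: power_add)
    then show ?thesis using ideal_mult[OF is_ideal_gen k[OF that]] by simp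
  qed
  define X where "X = Suc (\<Sum>\<zeta>\<in>V. N * g \<zeta>)"
  define p where "p \<zeta> = p0 \<zeta> ^ (e * N) * h ^ (X - N * g \<zeta>)" for \<zeta>
  define s where "s \<eta> = (p0 \<eta> * h) ^ (e * N)" for \<eta>
  have eN: "e * N > 0" using e(1) by (simp add: N_def)
  have pS: "p \<zeta> \<in> S (int (e * X))" if "\<zeta> \<in> V" for \<zeta>
  proof -
    have "N * g \<zeta> \<le> (\<Sum>\<zeta>\<in>V. N * g \<zeta>)" using that finite_Var by (intro member_le_sum) auto
    then have le: "N * g \<zeta> \<le> X" by (simp add: X_def)
    have "p \<zeta> \<in> S (int (e * N) * int (g \<zeta>) + int (X - N * g \<zeta>) * int e)"
      unfolding p_def by (intro graded_piece_mult graded_piece_power p0[OF that] h)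
    also have "int (e * N) * int (g \<zeta>) + int (X - N * g \<zeta>) * int e = int (e * X)"
      using le by (simp add: of_nat_diff algebra_simps)
    finally show ?thesis .
  qed
  have pself: "\<not> vanishes_at (p \<zeta>) \<zeta>" if "\<zeta> \<in> V" for \<zeta>
    unfolding p_def
    using vanishes_at_mult[OF graded_piece_power[OF p0[OF that]] graded_piece_power[OF h] V_wproj[OF that]]
      not_vanishes_at_power[OF p0[OF that] V_wproj[OF that] p0_self[OF that]]
      not_vanishes_at_power[OF h V_wproj[OF that] h_nonvanishing[OF that]] by simp
  have sS: "s \<eta> \<in> S (int (e * N) * (int (g \<eta>) + int e))" if "\<eta> \<in> V" for \<eta>
    unfolding s_def by (intro graded_piece_power graded_piece_mult p0[OF that] h)
  have sself: "\<not> vanishes_at (s \<eta>) \<eta>" if "\<eta> \<in> V" for \<eta>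
    unfolding s_def
    using not_vanishes_at_power[OF graded_piece_mult[OF p0[OF that] h] V_wproj[OF that]]
      vanishes_at_mult[OF p0[OF that] h V_wproj[OF that]] p0_self[OF that] h_nonvanishing[OF that] by blast
  have sp: "s \<eta> * p \<zeta> \<in> J" if "\<zeta> \<in> V" "\<eta> \<in> V" "\<zeta> \<noteq> \<eta>" for \<zeta> \<eta>
  proof -
    have "s \<eta> * p \<zeta> = h ^ (X - N * g \<zeta>) * (p0 \<zeta> * p0 \<eta> * h) ^ (e * N)"
      by (simp add: s_def p_def power_mult_distrib mult_ac)
    then show ?thesis using ideal_mult[OF is_ideal_gen mem[OF that]] by simp
  qed
  have pother: "vanishes_at (p \<zeta>) \<eta>" if "\<zeta> \<in> V" "\<eta> \<in> V" "\<zeta> \<noteq> \<eta>" for \<zeta> \<eta>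
    unfolding p_def
    using vanishes_at_mult[OF graded_piece_power[OF p0[OF that(1)]] graded_piece_power[OF h] V_wproj[OF that(2)]]
      vanishes_at_power[OF p0[OF that(1)] V_wproj[OF that(2)] eN] p0_other[OF that] by blast
  have "X > 0" by (simp add: X_def)
  with pS pself sS sself sp pother show ?thesis by blast
qed

text \<open>With \<open>p \<zeta>\<close> as separators, the fractions \<open>a \<zeta> / b \<zeta>\<close>, brought to a common degree, are all
  congruent to \<open>A / B\<close> with \<open>A = \<Sum> a \<zeta> * p \<zeta>\<close> and \<open>B = \<Sum> b \<zeta> * p \<zeta>\<close>, and \<open>B\<close> vanishes at no point.\<close>

lemma local_surjective:
  assumes \<alpha>: "\<alpha> > (\<Sum>i=1..n. int (D i)) - (\<Sum>i\<le>n. int (q i))"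
    and k: "k \<in> S \<alpha>" "\<And>\<zeta>. \<zeta> \<in> V \<Longrightarrow> \<not> vanishes_at k \<zeta>"
    and u: "\<And>\<zeta>. \<zeta> \<in> V \<Longrightarrow> u \<zeta> \<in> local_ring n q \<zeta>"
  shows "\<exists>v\<in>S \<alpha>. \<forall>\<zeta>\<in>V. fr v k - u \<zeta> \<in> local_ideal n q I \<zeta>"
proof -
  have "\<exists>a b \<gamma>. u \<zeta> = fr a b \<and> a \<in> S \<gamma> \<and> b \<in> S \<gamma> \<and> \<not> vanishes_at b \<zeta>" if "\<zeta> \<in> V" for \<zeta>
    using u[OF that] unfolding local_ring_def by blast
  then obtain a b \<gamma> where ab: "\<And>\<zeta>. \<zeta> \<in> V \<Longrightarrow>
      u \<zeta> = fr (a \<zeta>) (b \<zeta>) \<and> a \<zeta> \<in> S (\<gamma> \<zeta>) \<and> b \<zeta> \<in> S (\<gamma> \<zeta>) \<and> \<not> vanishes_at (b \<zeta>) \<zeta>" by metis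
  obtain X p s where X: "X > 0"
    and ps: "\<forall>\<zeta>\<in>V. p \<zeta> \<in> S (int (e * X)) \<and> \<not> vanishes_at (p \<zeta>) \<zeta> \<and>
        (\<exists>\<sigma>. s \<zeta> \<in> S \<sigma>) \<and> \<not> vanishes_at (s \<zeta>) \<zeta>"
      "\<forall>\<zeta>\<in>V. \<forall>\<eta>\<in>V. \<zeta> \<noteq> \<eta> \<longrightarrow> s \<eta> * p \<zeta> \<in> J \<and> vanishes_at (p \<zeta>) \<eta>"
    using separators by (elim exE conjE) (rule that)
  have p: "p \<zeta> \<in> S (int (e * X))" "\<not> vanishes_at (p \<zeta>) \<zeta>"
    and s: "\<exists>\<sigma>. s \<zeta> \<in> S \<sigma>" "\<not> vanishes_at (s \<zeta>) \<zeta>" if "\<zeta> \<in> V" for \<zeta>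
    using bspec[OF ps(1) that] by blast+
  have sp: "s \<eta> * p \<zeta> \<in> J" and p_other: "vanishes_at (p \<zeta>) \<eta>"
    if "\<zeta> \<in> V" "\<eta> \<in> V" "\<zeta> \<noteq> \<eta>" for \<zeta> \<eta>
    using ps(2) that by blast+
  define g where "g \<zeta> = nat (\<gamma> \<zeta>)" for \<zeta>
  have abS: "a \<zeta> \<in> S (int (g \<zeta>))" "b \<zeta> \<in> S (int (g \<zeta>))" if "\<zeta> \<in> V" for \<zeta>
    using ab[OF that] nonvanishing_degree[of "b \<zeta>" n q "\<gamma> \<zeta>" \<zeta>] by (auto simp: g_def)
  define M where "M = (\<Sum>\<zeta>\<in>V. g \<zeta>)"
  have gM: "g \<zeta> \<le> M" if "\<zeta> \<in> V" for \<zeta>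
    unfolding M_def using that finite_Var by (intro member_le_sum) auto
  \<comment> \<open>Multiplying \<open>b \<zeta>\<close> by the first factor raises its degree from
    \<open>g \<zeta>\<close> to \<open>e * g \<zeta>\<close>, and the power of \<open>h\<close>
    brings it to the common value \<open>e * M\<close>.\<close>
  define c where "c \<zeta> = b \<zeta> ^ (e - 1) * h ^ (M - g \<zeta>)" for \<zeta>
  have cS: "c \<zeta> \<in> S (int (e * M) - int (g \<zeta>))" if "\<zeta> \<in> V" for \<zeta>
  proof -
    have "c \<zeta> \<in> S (int (e - 1) * int (g \<zeta>) + int (M - g \<zeta>) * int e)"
      unfolding c_def by (intro graded_piece_mult graded_piece_power abS(2)[OF that] h)
    also have "int (e - 1) * int (g \<zeta>) + int (M - g \<zeta>) * int e = int (e * M) - int (g \<zeta>)"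
      using gM[OF that] e(1) by (simp add: of_nat_diff algebra_simps)
    finally show ?thesis .
  qed
  have c_nonvan: "\<not> vanishes_at (c \<zeta>) \<zeta>" if "\<zeta> \<in> V" for \<zeta>
    unfolding c_def
    using vanishes_at_mult[OF graded_piece_power[OF abS(2)[OF that]] graded_piece_power[OF h] V_wproj[OF that]]
      not_vanishes_at_power[OF abS(2)[OF that] V_wproj[OF that]] ab[OF that]
      not_vanishes_at_power[OF h V_wproj[OF that] h_nonvanishing[OF that]] by blast
  define a' where "a' \<zeta> = a \<zeta> * c \<zeta>" for \<zeta>
  define b' where "b' \<zeta> = b \<zeta> * c \<zeta>" for \<zeta>
  have ab'S: "a' \<zeta> \<in> S (int (e * M))" "b' \<zeta> \<in> S (int (e * M))" if "\<zeta> \<in> V" for \<zeta>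
    using graded_piece_mult[OF abS(1)[OF that] cS[OF that]] graded_piece_mult[OF abS(2)[OF that] cS[OF that]]
    by (simp_all add: a'_def b'_def)
  have b'_nonvan: "\<not> vanishes_at (b' \<zeta>) \<zeta>" if "\<zeta> \<in> V" for \<zeta>
    unfolding b'_def using vanishes_at_mult[OF abS(2)[OF that] cS[OF that] V_wproj[OF that]]
      c_nonvan[OF that] ab[OF that] by blast
  have u': "u \<zeta> = fr (a' \<zeta>) (b' \<zeta>)" if "\<zeta> \<in> V" for \<zeta>
    using ab[OF that] nonvanishing_nonzero[OF c_nonvan[OF that]] nonvanishing_nonzero[of "b \<zeta>" \<zeta>]
    by (simp add: a'_def b'_def eq_fract mult_ac)
  define A where "A = (\<Sum>\<zeta>\<in>V. a' \<zeta> * p \<zeta>)"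
  define B where "B = (\<Sum>\<zeta>\<in>V. b' \<zeta> * p \<zeta>)"
  let ?E = "e * M + e * X"
  have AS: "A \<in> S (int ?E)" and BS: "B \<in> S (int ?E)"
    unfolding A_def B_def of_nat_add by (intro graded_piece_sum graded_piece_mult ab'S p; assumption)+
  have B_nonvan: "\<not> vanishes_at B \<eta>" if \<eta>: "\<eta> \<in> V" for \<eta>
  proof
    assume B: "vanishes_at B \<eta>"
    obtain z where z: "z \<in> punctured_space n" "\<eta> = orbit n q z" using V_wproj[OF \<eta>] by (rule wproj_cases)
    have "peval z (b' \<zeta> * p \<zeta>) = 0" if "\<zeta> \<in> V - {\<eta>}" for \<zeta>
      using p_other[of \<zeta> \<eta>] that \<eta> vanishes_at_orbit[OF p(1)[of \<zeta>] z(1)] z(2) by (auto simp: peval_mult)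
    then have "peval z B = peval z (b' \<eta> * p \<eta>)"
      unfolding B_def peval_sum using finite_Var \<eta> by (subst sum.remove[of _ \<eta>]) auto
    moreover have "peval z B = 0" using B vanishes_at_orbit[OF BS z(1)] z(2) by simp
    ultimately have "vanishes_at (b' \<eta> * p \<eta>) \<eta>"
      using vanishes_at_orbit[OF graded_piece_mult[OF ab'S(2)[OF \<eta>] p(1)[OF \<eta>]] z(1)] z(2) by simp
    then show False
      using vanishes_at_mult[OF ab'S(2)[OF \<eta>] p(1)[OF \<eta>] V_wproj[OF \<eta>]] b'_nonvan[OF \<eta>] p(2)[OF \<eta>] by blast
  qed
  have AkS: "A * k \<in> S (\<alpha> + int ?E)" using graded_piece_mult[OF AS k(1)] by (simp add: add.commute)
  \<comment> \<open>This solves v / k = A / B modulo \<open>J\<close>; the division succeeds because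
    the degree of \<open>B\<close> is a positive multiple of \<open>e\<close>, hence of every
    weight.\<close>
  have "\<exists>v\<in>S \<alpha>. A * k - v * B \<in> J"
    by (rule nonvanishing_surjective[OF BS B_nonvan _ _ \<alpha> AkS]) (use e X in auto)
  then obtain v where v: "v \<in> S \<alpha>" "A * k - v * B \<in> J" by blast
  have "fr v k - u \<eta> \<in> local_ideal n q I \<eta>" if \<eta>: "\<eta> \<in> V" for \<eta>
  proof -
    let ?g = "v * b' \<eta> - a' \<eta> * k"
    have eq: "fr v k - u \<eta> = fr ?g (k * b' \<eta>)"
      using u'[OF \<eta>] nonvanishing_nonzero[OF k(2)[OF \<eta>]] nonvanishing_nonzero[OF b'_nonvan[OF \<eta>]] by simp
    have gS: "?g \<in> S (\<alpha> + int (e * M))"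
      using graded_piece_mult[OF v(1) ab'S(2)[OF \<eta>]] graded_piece_mult[OF ab'S(1)[OF \<eta>] k(1)]
      by (intro graded_piece_diff) (simp_all add: add.commute)
    have dS: "k * b' \<eta> \<in> S (\<alpha> + int (e * M))" by (rule graded_piece_mult[OF k(1) ab'S(2)[OF \<eta>]])
    have dn: "\<not> vanishes_at (k * b' \<eta>) \<eta>"
      using vanishes_at_mult[OF k(1) ab'S(2)[OF \<eta>] V_wproj[OF \<eta>]] k(2)[OF \<eta>] b'_nonvan[OF \<eta>] by blast
    obtain \<sigma> where s\<sigma>: "s \<eta> \<in> S \<sigma>" using s(1)[OF \<eta>] by blast
    \<comment> \<open>The term of \<eta> itself cancels, and every other one contains a
      \<open>p \<zeta>\<close>, which \<open>s \<eta>\<close> multiplies into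
      \<open>J\<close>.\<close>
    have summand: "s \<eta> * (p \<zeta> * (a' \<zeta> * b' \<eta> - a' \<eta> * b' \<zeta>)) \<in> J" if "\<zeta> \<in> V" for \<zeta>
    proof (cases "\<zeta> = \<eta>")
      case True
      then show ?thesis by (simp add: mult.commute ideal_0 is_ideal_gen)
    next
      case False
      from ideal_mult_right[OF is_ideal_gen sp[OF that \<eta> False]] show ?thesis by (simp add: mult.assoc)
    qed
    have "A * b' \<eta> - a' \<eta> * B = (\<Sum>\<zeta>\<in>V. p \<zeta> * (a' \<zeta> * b' \<eta> - a' \<eta> * b' \<zeta>))"
      unfolding A_def B_def sum_distrib_left sum_distrib_right sum_subtractf[symmetric]
      by (intro sum.cong refl) (simp add: algebra_simps)
    then have "s \<eta> * (A * b' \<eta> - a' \<eta> * B) = (\<Sum>\<zeta>\<in>V. s \<eta> * (p \<zeta> * (a' \<zeta> * b' \<eta> - a' \<eta> * b' \<zeta>)))"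
      by (simp add: sum_distrib_left)
    also have "\<dots> \<in> J" by (intro ideal_sum is_ideal_gen summand)
    finally have 1: "s \<eta> * (A * b' \<eta> - a' \<eta> * B) \<in> J" .
    \<comment> \<open>Combined so that \<open>A\<close> cancels: what remains is the numerator of
      \<open>fr v k - u \<eta>\<close> times a form not vanishing at \<eta>.\<close>
    have "k * (s \<eta> * (A * b' \<eta> - a' \<eta> * B)) - (s \<eta> * b' \<eta>) * (A * k - v * B) \<in> J"
      by (intro ideal_diff is_ideal_gen ideal_mult 1 v(2))
    also have "k * (s \<eta> * (A * b' \<eta> - a' \<eta> * B)) - (s \<eta> * b' \<eta>) * (A * k - v * B) = (s \<eta> * B) * ?g"
      by (simp add: algebra_simps)
    finally have "(s \<eta> * B) * ?g \<in> J" .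
    moreover have "s \<eta> * B \<in> S (\<sigma> + int ?E)" by (rule graded_piece_mult[OF s\<sigma> BS])
    moreover have "\<not> vanishes_at (s \<eta> * B) \<eta>"
      using vanishes_at_mult[OF s\<sigma> BS V_wproj[OF \<eta>]] s(2)[OF \<eta>] B_nonvan[OF \<eta>] by blast
    ultimately show ?thesis unfolding eq local_ideal_iff[OF V_wproj[OF \<eta>] gS dS dn] by blast
  qed
  then show ?thesis using v(1) by blast
qed

text \<open>Division by \<open>k\<close> maps \<open>S \<alpha>\<close> to the local rings. It is
  surjective onto the product of the local quotients, and its kernel is the degree \<alpha> part of
  \<open>I\<close> because membership in \<open>J\<close> is local.\<close>

lemma quotient_dim_eq_scheme_degree:
  assumes \<alpha>: "\<alpha> > (\<Sum>i=1..n. int (D i)) - (\<Sum>i\<le>n. int (q i))"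
    and k: "k \<in> S \<alpha>" "\<And>\<zeta>. \<zeta> \<in> V \<Longrightarrow> \<not> vanishes_at k \<zeta>"
  shows "quotient_dim const (S \<alpha>) (I \<inter> S \<alpha>) = scheme_degree n q I"
proof -
  let ?\<phi> = "\<lambda>v. fr v k" and ?\<iota> = "\<lambda>c. fr (const c) 1"
  have subI: "const.subspace (I \<inter> S \<alpha>)" unfolding I_graded by (rule graded_gen_subspace)
  have k0: "k \<noteq> 0" using Var_nonempty k(2) nonvanishing_nonzero by blast
  have inj: "inj_on ?\<phi> C" for C using k0 by (auto intro!: inj_onI simp: eq_fract)
  have \<phi>_sum: "?\<phi> (sum w C) = (\<Sum>b\<in>C. ?\<phi> (w b))" for w :: "poly_cox \<Rightarrow> poly_cox" and C
    by (induction C rule: infinite_finite_induct) (use k0 in \<open>simp_all add: fract_add_numerator Zero_fract_def eq_fract\<close>)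
  have ker: "v \<in> I \<inter> S \<alpha> \<longleftrightarrow> (\<forall>\<zeta>\<in>V. ?\<phi> v \<in> local_ideal n q I \<zeta>)" if v: "v \<in> S \<alpha>" for v
  proof
    assume "v \<in> I \<inter> S \<alpha>"
    then show "\<forall>\<zeta>\<in>V. ?\<phi> v \<in> local_ideal n q I \<zeta>" using k unfolding local_ideal_def by blast
  next
    assume *: "\<forall>\<zeta>\<in>V. ?\<phi> v \<in> local_ideal n q I \<zeta>"
    have "v \<in> J"
      by (rule mem_J_of_local) (use * local_ideal_iff[OF V_wproj v k(1) k(2)] in blast)
    then show "v \<in> I \<inter> S \<alpha>" unfolding I_graded using v by blast
  qed
  obtain C where C: "quotient_basis const (S \<alpha>) (I \<inter> S \<alpha>) C"
    using quotient_basis_graded_piece_exists[of n q "I \<inter> S \<alpha>" \<alpha>] q subI by blast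
  note C' = C[unfolded const.quotient_basis_iff[OF graded_piece_subspace subI]]
  have "\<exists>B. quotient_basis ?\<iota> (local_ring n q \<zeta>) (local_ideal n q I \<zeta>) B" if \<zeta>: "\<zeta> \<in> V" for \<zeta>
  proof (rule fract.quotient_basis_exists[OF local_ring_subspace[OF V_wproj[OF \<zeta>]] local_ideal_subspace[OF V_wproj[OF \<zeta>]], of "?\<phi> ` C"])
    show "finite (?\<phi> ` C)" using C' by simp
    show "?\<phi> ` C \<subseteq> local_ring n q \<zeta>" using C' local_ringI[OF _ k(1) k(2)[OF \<zeta>]] by blast
    fix x assume x: "x \<in> local_ring n q \<zeta>"
    \<comment> \<open>That the local quotient at one point is finite-dimensional follows from
      surjectivity, too: \<open>x\<close> is lifted together with 0 at the other points, and the
      lift is expanded in \<open>C\<close>.\<close>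
    have "\<exists>v\<in>S \<alpha>. \<forall>\<eta>\<in>V. ?\<phi> v - (if \<eta> = \<zeta> then x else 0) \<in> local_ideal n q I \<eta>"
      by (rule local_surjective[OF \<alpha> k]) (use x fract.subspace_0[OF local_ring_subspace[OF V_wproj]] in auto)
    then obtain v where v: "v \<in> S \<alpha>" "?\<phi> v - x \<in> local_ideal n q I \<zeta>" using \<zeta> by fastforce
    obtain c where c: "v - (\<Sum>b\<in>C. const (c b) * b) \<in> I \<inter> S \<alpha>" using C' v(1) by blast
    then have "?\<phi> (v - (\<Sum>b\<in>C. const (c b) * b)) \<in> local_ideal n q I \<zeta>" using ker \<zeta> by blast
    note diff = fract.subspace_diff[OF local_ideal_subspace[OF V_wproj[OF \<zeta>]] this v(2)]
    have group: "a' - (a - x) = x - a''" if "a = a' + a''" for a a' a'' :: "poly_cox fract"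
      using that by simp
    have "?\<phi> v = ?\<phi> (v - (\<Sum>b\<in>C. const (c b) * b)) + ?\<phi> (\<Sum>b\<in>C. const (c b) * b)"
      by (simp only: fract_add_numerator[OF k0, symmetric] diff_add_cancel)
    then have "x - ?\<phi> (\<Sum>b\<in>C. const (c b) * b) \<in> local_ideal n q I \<zeta>"
      using diff by (simp only: group)
    then have "x - (\<Sum>b\<in>C. ?\<iota> (c b) * ?\<phi> b) \<in> local_ideal n q I \<zeta>" by (simp add: \<phi>_sum)
    then show "\<exists>c. x - (\<Sum>a\<in>?\<phi> ` C. ?\<iota> (c a) * a) \<in> local_ideal n q I \<zeta>"
      by (intro exI[of _ "\<lambda>a. c (the_inv_into C ?\<phi> a)"])
         (simp add: sum.reindex[OF inj] the_inv_into_f_f[OF inj])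
  qed
  then obtain B where B: "\<And>\<zeta>. \<zeta> \<in> V \<Longrightarrow>
      quotient_basis ?\<iota> (local_ring n q \<zeta>) (local_ideal n q I \<zeta>) (B \<zeta>)" by metis
  have local_subspaces: "fract.subspace (local_ring n q \<zeta>)" "fract.subspace (local_ideal n q I \<zeta>)"
    if "\<zeta> \<in> V" for \<zeta>
    using local_ring_subspace[OF V_wproj[OF that]] local_ideal_subspace[OF V_wproj[OF that]] .
  have "\<exists>A. quotient_basis const (S \<alpha>) (I \<inter> S \<alpha>) A \<and> card A = (\<Sum>\<zeta>\<in>V. card (B \<zeta>))"
  proof (rule quotient_basis_product[where \<phi> = ?\<phi> and V' = "local_ring n q" and W' = "local_ideal n q I"])
    show "?\<phi> (x + y) = ?\<phi> x + ?\<phi> y" for x y by (rule fract_add_numerator[OF k0])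
    show "?\<phi> (const c * x) = ?\<iota> c * ?\<phi> x" for c x by simp
    show "?\<phi> v \<in> local_ring n q \<zeta>" if "v \<in> S \<alpha>" "\<zeta> \<in> V" for v \<zeta>
      by (rule local_ringI[OF that(1) k(1) k(2)[OF that(2)]])
    show "\<exists>v\<in>S \<alpha>. \<forall>\<zeta>\<in>V. ?\<phi> v - u \<zeta> \<in> local_ideal n q I \<zeta>"
      if "\<And>\<zeta>. \<zeta> \<in> V \<Longrightarrow> u \<zeta> \<in> local_ring n q \<zeta>" for u
      by (rule local_surjective[OF \<alpha> k that])
  qed (use B ker finite_Var subI local_subspaces in
      \<open>auto intro: const.complex_algebra_axioms fract.complex_algebra_axioms graded_piece_subspace\<close>)
  then obtain A where A: "quotient_basis const (S \<alpha>) (I \<inter> S \<alpha>) A" "card A = (\<Sum>\<zeta>\<in>V. card (B \<zeta>))" by blast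
  have "scheme_degree n q I = (\<Sum>\<zeta>\<in>V. enat (card (B \<zeta>)))"
    unfolding scheme_degree_def point_multiplicity_def
    by (intro sum.cong refl fract.quotient_dim_eq_card local_ring_subspace local_ideal_subspace V_wproj B)
  also have "\<dots> = enat (card A)" by (simp add: A(2) flip: of_nat_eq_enat)
  also have "\<dots> = quotient_dim const (S \<alpha>) (I \<inter> S \<alpha>)"
    by (rule const.quotient_dim_eq_card[OF graded_piece_subspace subI A(1), symmetric])
  finally show ?thesis ..
qed

lemma mem_Reg:
  assumes \<alpha>: "\<alpha> > (\<Sum>i=1..n. int (D i)) - (\<Sum>i\<le>n. int (q i))" and bpf: "basepoint_free n q I \<alpha>"
  shows "\<alpha> \<in> Reg n q I"
proof -
  obtain k where "k \<in> S \<alpha>" "\<forall>\<zeta>\<in>V. \<not> vanishes_at k \<zeta>"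
    using common_nonvanishing_form[of V n q \<alpha>] V_wproj finite_Var bpf unfolding basepoint_free_def by blast
  then show ?thesis
    using quotient_dim_eq_scheme_degree[OF \<alpha>] bpf saturation_graded unfolding Reg_def by auto
qed

end

lemma basepoint_free_add:
  assumes "basepoint_free n q I \<alpha>" "basepoint_free n q I \<beta>"
  shows "basepoint_free n q I (\<alpha> + \<beta>)"
  unfolding basepoint_free_def
proof clarify
  fix \<zeta> assume \<zeta>: "\<zeta> \<in> Var n q I" "\<forall>g\<in>graded_piece n q (\<alpha> + \<beta>). vanishes_at g \<zeta>"
  obtain g where g: "g \<in> graded_piece n q \<alpha>" "\<not> vanishes_at g \<zeta>"
    using assms(1) \<zeta>(1) unfolding basepoint_free_def by blast
  obtain h where h: "h \<in> graded_piece n q \<beta>" "\<not> vanishes_at h \<zeta>"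
    using assms(2) \<zeta>(1) unfolding basepoint_free_def by blast
  have "\<zeta> \<in> wproj n q" using \<zeta>(1) by (simp add: Var_def)
  then show False
    using vanishes_at_mult[OF g(1) h(1)] g(2) h(2) \<zeta>(2) graded_piece_mult[OF g(1) h(1)] by blast
qed

theorem theorem4p6:
  fixes n :: nat and q d :: "nat \<Rightarrow> nat" and f :: "nat \<Rightarrow> poly_cox"
    and I :: "poly_cox set" and l :: nat and d_reg d\<^sub>0 :: int
  assumes weights_pos: "\<forall>i\<le>n. q i > 0"
    and weights_coprime: "\<forall>i\<le>n. Gcd (q ` ({..n} - {i})) = 1"
    and l: "l = Lcm (q ` {..n})"
    and f: "\<forall>i\<in>{1..n}. f i \<in> graded_piece n q (int (l * d i))"
    and I: "I = Idl\<^bsub>cox_ring n\<^esub> (f ` {1..n})"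
    and d_reg: "d_reg > int (l * (\<Sum>i=1..n. d i)) - int (\<Sum>j=0..n. q j)"
    and d_reg_bpf: "basepoint_free n q I d_reg"
    and ci: "complete_intersection n q I" "zero_dimensional n q I"
    and d0: "d\<^sub>0 \<in> effective_classes n q" "d\<^sub>0 > 0" "basepoint_free n q I d\<^sub>0"
  shows "regularity_pair n q I (d_reg, d\<^sub>0)"
proof -
  have dim: "zariski_dim n q (Var n q I) = 0" using ci(2) by (simp add: zero_dimensional_def)
  have hom: "homogeneous n q g" if "g \<in> f ` {1..n}" for g
    using that f unfolding homogeneous_def by blast
  have fin: "finite (Var n q I)"
    unfolding I by (rule finite_Var_of_zariski_dim_0) (use weights_pos hom dim I in auto)
  have l0: "l > 0" using weights_pos unfolding l by (intro Nat.gr0I) (auto simp: Lcm_0_iff)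
  have ql: "q j dvd l" if "j \<le> n" for j unfolding l using that by (intro dvd_Lcm) auto
  have sub: "Var n q I \<subseteq> wproj n q" by (auto simp: Var_def)
  obtain h where h: "h \<in> graded_piece n q d\<^sub>0" "\<forall>\<zeta>\<in>Var n q I. \<not> vanishes_at h \<zeta>"
    using common_nonvanishing_form[OF sub fin, of d\<^sub>0] d0(3) unfolding basepoint_free_def by blast
  \<comment> \<open>The power \<open>l\<close> makes the degree of the auxiliary form divisible by
    every weight, and \<open>d\<^sub>0 > 0\<close> makes it positive.\<close>
  interpret weighted_complete_intersection n q "\<lambda>i. l * d i" f "l * nat d\<^sub>0" "h ^ l"
  proof
    show "h ^ l \<in> graded_piece n q (int (l * nat d\<^sub>0))"
      using graded_piece_power[OF h(1), of l] d0(2) by simp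
    show "\<not> vanishes_at (h ^ l) \<zeta>" if "\<zeta> \<in> Var n q (Idl\<^bsub>cox_ring n\<^esub> (f ` {1..n}))" for \<zeta>
      using not_vanishes_at_power[OF h(1), of \<zeta> l] that h(2) unfolding I Var_def by blast
    show "Var n q (Idl\<^bsub>cox_ring n\<^esub> (f ` {1..n})) \<noteq> {}"
      using Var_nonempty_of_zariski_dim_0[OF dim] unfolding I .
  qed (use weights_pos f fin I l0 ql d0(2) in auto)
  have bound: "d_reg > (\<Sum>i=1..n. int (l * d i)) - (\<Sum>i\<le>n. int (q i))"
    using d_reg by (simp add: sum_distrib_left atMost_atLeast0)
  have "d_reg \<in> Reg n q I" unfolding I by (rule mem_Reg[OF bound]) (use d_reg_bpf I in simp)
  \<comment> \<open>The bound persists because \<open>d\<^sub>0\<close> is positive, and products of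
    forms give basepoint freeness of the sum.\<close>
  moreover have "d_reg + d\<^sub>0 \<in> Reg n q I"
    unfolding I by (rule mem_Reg) (use bound d0 basepoint_free_add[OF d_reg_bpf d0(3)] I in auto)
  ultimately show ?thesis using d0(3) by (simp add: regularity_pair_def)
qed

end
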